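(* Suppose that all assumptions (A1)--(A9) listed in the context hold and that the identifiability condition $$\forall \varepsilon>0, \quad \inf_{\theta\in\Theta:\,|\theta-\theta_0|\geq\varepsilon} R(\theta) > R(\theta_0)$$ holds. Let additionally $\theta_0$ be an interior point of $\Theta$. If $h\asymp n^{-\gamma}$ with $\gamma=1/(2\alpha)$ and $\ddot{R}(\theta_0)\neq 0$, then $$\sqrt{n}(\hat{\theta}_n-\theta_0)=O_{\mathbb{P}}(1).$$
   Context: Setting. On a probability space $(\Omega,\mathcal{F},\mathbb{P})$ let $W=(W_t)_{t\ge 0}$ be a Brownian motion and $\xi$ a random variable independent of $W$. Consider the stochastic differential equation $$dX_t=\mu(X_t;\theta)\,dt+\sigma(X_t)\,dW_t,\qquad X_0=\xi,$$ with $\theta\in\Theta\subset\mathbb{R}$ an unknown parameter. The true value is $\theta_0\in\Theta$, and $X$ is the solution for $\theta=\theta_0$ with $\xi\sim\pi(\cdot;\theta_0)$, where $\pi(\cdot;\theta)$ is the invariant density. One observes $Z_j=X_{j\Delta}$, $j=0,\ldots,n$, with $\Delta>0$ fixed. All convergence is as $n\to\infty$. Notation. A dot denotes a derivative with respect to $\theta$ (so $\ddot R$ is the second derivative of $R$), a prime a derivative with respect to $x$; $\pi^{(\alpha)}$ is the $\alpha$-th derivative of $\pi$ with respect to $x$; $\stackrel{(i)}{\mu}$ is the $i$-th derivative of $\mu$ with respect to $\theta$ (with $\stackrel{(0)}{\mu}=\mu$). $a_n\asymp b_n$ means that the sequences are asymptotically of the same order. Mixing coefficients: $$\alpha_{\Delta}(k)=\sup_{m\ge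 0}\ \sup_{A\in\sigma(Z_j,\,j\le m),\ B\in\sigma(Z_j,\,j\ge m+k)}|\mathbb{P}(AB)-\mathbb{P}(A)\mathbb{P}(B)|;$$ the sequence is $\alpha$-mixing if $\alpha_\Delta(k)\to0$. Estimator. With a kernel $K$ and bandwidth $h=h_n>0$, $$\hat{\pi}(x)=\frac{1}{(n+1)h}\sum_{j=0}^nK\left(\frac{x-Z_j}{h}\right),$$ $$R_n(\theta)=\int_{\mathbb{R}}\left(\mu(x;\theta)\hat{\pi}(x)-\tfrac12[\sigma^2(x)\hat{\pi}(x)]'\right)^2w(x)\,dx,$$ and $\hat{\theta}_n$ is a (measurable) minimiser of $R_n$ over $\Theta$, $\hat\theta_n=\operatorname{argmin}_{\theta\in\Theta}R_n(\theta)$. The limit criterion is $$R(\theta)=\int_{\mathbb{R}}\left(\mu(x;\theta)\pi(x;\theta_0)-\tfrac12[\sigma^2(x)\pi(x;\theta_0)]'\right)^2w(x)\,dx.$$ Assumptions. (A1) $\Theta=[a,b]$ with $a<b$. (A2) $\mu(\cdot;\theta)$ is known up to $\theta$ and $\sigma(\cdot)$ is a known function. There is a unique strong solution $X$ to the equation with respect to $W$ and $\xi$; it is a homogeneous Markov process with transition density $p(t,x,y;\theta)$. It is ergodic with bounded invariant density $\pi(\cdot;\cdot)$ that has a bounded, continuous and integrable derivative $\pi'(\cdot;\cdot)$, and for $\xi\sim\pi(\cdot;\theta)$ it is strictly stationary. Also $\dot\pi(\cdot;\cdot)$ exists. For all $\theta\in\Theta$ the support of $\pi(\cdot;\theta)$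 (the state space of $X$) is $\mathbb{R}$. (A3) The sample $X_0,X_\Delta,\ldots$ corresponding to $\theta_0$ is $\alpha$-mixing with $\sum_{k=0}^\infty\alpha_\Delta(k)<\infty$. (A4) For some integer $\alpha>3$ and some constant $L_\theta>0$ (possibly depending on $\theta$), for all $t\in\mathbb{R}$, $\left\{\int_{\mathbb{R}}(\pi^{(\alpha)}(x+t;\theta)-\pi^{(\alpha)}(x;\theta))^2dx\right\}^{1/2}\le L_\theta$ (the derivative $\pi^{(\alpha)}$ being understood to exist). (A5) $K$ is symmetric, continuously differentiable, has support $[-1,1]$, and $\int_{-1}^1K(u)du=1$, $\int_{-1}^1u^lK(u)du=0$ for $l=1,\ldots,\alpha$, with the same $\alpha$ as in (A4). (A6) $h=h_n\downarrow0$ and $nh^4\to\infty$ as $n\to\infty$. (A7) $w$ is nonnegative, continuously differentiable, bounded and integrable. (A8) $\sigma$ is differentiable and $\pi(\cdot;\theta_0)$ solves $\mu(x;\theta_0)\pi(x)-\tfrac12[\sigma^2(x)\pi(x)]'=0$ in the unknown function $\pi(\cdot)$. (A9) $\mu(\cdot;\cdot)$ is three times differentiable in $\theta$. The drift and dispersion coefficients and the corresponding derivatives are continuous functions of $x$ and $\theta$. There exist functions $\widetilde\mu_1,\ldots,\widetilde\mu_4$ with $\sup_{\theta\in\Theta}|\stackrel{(i)}{\mu}(x;\theta)|\le\widetilde\mu_{i+1}(x)$ for all $x\in\mathbb{R}$, $i=0,1,2,3$, and a function $\widetilde\mu_5$ with $\sup_{\theta\in\Theta}|\dot\mu'(x;\theta)|\le\widetilde\mu_5(x)$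 for all $x\in\mathbb{R}$. The following functions of $x$ are bounded and integrable: $\widetilde\mu_1^2w$, $\sigma^4w$, $\sigma^2(\sigma')^2w$, $\widetilde\mu_2\widetilde\mu_1w$, $\widetilde\mu_5\sigma^2w$, $\widetilde\mu_2^2w$, $\sigma^2w$, $\sigma\sigma'w$, $\widetilde\mu_2\sigma^2w'$, $\widetilde\mu_3\widetilde\mu_1w$, $\widetilde\mu_3\sigma^4w$, $\widetilde\mu_3\sigma\sigma'w$, $\widetilde\mu_3\sigma^2w$, $\widetilde\mu_3\widetilde\mu_2w$, $\widetilde\mu_4\widetilde\mu_1w$, $\widetilde\mu_4\sigma\sigma'w$, $\widetilde\mu_4\sigma^2w$, $\widetilde\mu_2\sigma^2w$, $\widetilde\mu_2\sigma\sigma'w$. Finally, $\lim_{|x|\to\infty}\widetilde\mu_2(x)w(x)\sigma^2(x)=0$. *)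

theory Defs
  imports "HOL-Probability.Probability" "HOL-Library.Landau_Symbols"
begin

definition sigma_gen :: "'a measure \<Rightarrow> ('i \<Rightarrow> 'a \<Rightarrow> real) \<Rightarrow> 'i set \<Rightarrow> 'a measure" where
  "sigma_gen M X I = sigma (space M) {X i -` A \<inter> space M | i A. i \<in> I \<and> A \<in> sets borel}"

definition brownian_motion :: "'a measure \<Rightarrow> (real \<Rightarrow> 'a \<Rightarrow> real) \<Rightarrow> bool" where
  "brownian_motion M W \<longleftrightarrow>
     (\<forall>t\<ge>0. W t \<in> borel_measurable M) \<and>
     (AE \<omega> in M. W 0 \<omega> = 0) \<and>
     (AE \<omega> in M. continuous_on {0..} (\<lambda>t. W t \<omega>)) \<and>
     (\<forall>s\<ge>0. \<forall>t>s. distributed M lborel (\<lambda>\<omega>. W t \<omega> - W s \<omega>) (normal_density 0 (sqrt (t - s)))) \<and>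
     (\<forall>(m::nat) \<tau>. 0 \<le> \<tau> 0 \<and> (\<forall>i<m. \<tau> i < \<tau> (Suc i)) \<longrightarrow>
        prob_space.indep_vars M (\<lambda>_. borel) (\<lambda>i \<omega>. W (\<tau> (Suc i)) \<omega> - W (\<tau> i) \<omega>) {..<m})"

definition indep_of_process :: "'a measure \<Rightarrow> ('a \<Rightarrow> real) \<Rightarrow> (real \<Rightarrow> 'a \<Rightarrow> real) \<Rightarrow> bool" where
  "indep_of_process M \<xi> W \<longleftrightarrow>
     prob_space.indep_set M (sets (vimage_algebra (space M) \<xi> borel)) (sets (sigma_gen M W {0..}))"

definition aug_filtration ::
    "'a measure \<Rightarrow> (real \<Rightarrow> 'a \<Rightarrow> real) \<Rightarrow> ('a \<Rightarrow> real) \<Rightarrow> real \<Rightarrow> 'a measure" where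
  "aug_filtration M W \<xi> t =
     sigma (space M)
       (sets (vimage_algebra (space M) \<xi> borel) \<union> sets (sigma_gen M W {0..t}) \<union> null_sets M)"

text \<open>Measurability is part of the definition because \<open>measure\<close> is 0 on non-measurable sets.\<close>

definition tendsto_zero_in_prob :: "'a measure \<Rightarrow> (nat \<Rightarrow> 'a \<Rightarrow> real) \<Rightarrow> bool" where
  "tendsto_zero_in_prob M Y \<longleftrightarrow>
     (\<forall>k. Y k \<in> borel_measurable M) \<and>
     (\<forall>\<epsilon>>0. (\<lambda>k. measure M {\<omega> \<in> space M. \<bar>Y k \<omega>\<bar> > \<epsilon>}) \<longlonglongrightarrow> 0)"

text \<open>A simple predictable process takes the value \<open>\<eta> i \<omega>\<close> on \<open>(\<tau> i, \<tau> (Suc i)]\<close>, \<open>i < m\<close>,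
  and vanishes elsewhere.\<close>

definition simple_integrand ::
    "(real \<Rightarrow> 'a measure) \<Rightarrow> nat \<Rightarrow> (nat \<Rightarrow> real) \<Rightarrow> (nat \<Rightarrow> 'a \<Rightarrow> real) \<Rightarrow> bool" where
  "simple_integrand F m \<tau> \<eta> \<longleftrightarrow>
     0 \<le> \<tau> 0 \<and> (\<forall>i<m. \<tau> i < \<tau> (Suc i)) \<and>
     (\<forall>i<m. \<eta> i \<in> borel_measurable (F (\<tau> i)) \<and> bounded (\<eta> i ` space (F (\<tau> i))))"

definition simple_value ::
    "nat \<Rightarrow> (nat \<Rightarrow> real) \<Rightarrow> (nat \<Rightarrow> 'a \<Rightarrow> real) \<Rightarrow> real \<Rightarrow> 'a \<Rightarrow> real" where
  "simple_value m \<tau> \<eta> s \<omega> = (\<Sum>i<m. \<eta> i \<omega> * indicator {\<tau> i<..\<tau> (Suc i)} s)"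

definition simple_ito ::
    "(real \<Rightarrow> 'a \<Rightarrow> real) \<Rightarrow> nat \<Rightarrow> (nat \<Rightarrow> real) \<Rightarrow> (nat \<Rightarrow> 'a \<Rightarrow> real) \<Rightarrow> real \<Rightarrow> 'a \<Rightarrow> real" where
  "simple_ito W m \<tau> \<eta> t \<omega> = (\<Sum>i<m. \<eta> i \<omega> * (W (min (\<tau> (Suc i)) t) \<omega> - W (min (\<tau> i) t) \<omega>))"

text \<open>\<open>J\<close> is (a version of) the Ito integral of \<open>H\<close> with respect to \<open>W\<close> over \<open>[0,t]\<close>:
  the limit in probability of the integrals of simple processes \<open>H\<^sub>k\<close> for which
  \<open>\<integral>\<^sub>0\<^sup>t (H\<^sub>k - H)\<^sup>2 ds\<close> tends to zero in probability.\<close>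

definition has_ito_integral ::
    "'a measure \<Rightarrow> (real \<Rightarrow> 'a measure) \<Rightarrow> (real \<Rightarrow> 'a \<Rightarrow> real) \<Rightarrow> (real \<Rightarrow> 'a \<Rightarrow> real) \<Rightarrow>
      real \<Rightarrow> ('a \<Rightarrow> real) \<Rightarrow> bool" where
  "has_ito_integral M F W H t J \<longleftrightarrow>
     (AE \<omega> in M. set_integrable lborel {0..t} (\<lambda>s. (H s \<omega>)\<^sup>2)) \<and>
     (\<exists>m \<tau> \<eta>.
        (\<forall>k. simple_integrand F (m k) (\<tau> k) (\<eta> k)) \<and>
        tendsto_zero_in_prob M
          (\<lambda>k \<omega>. LINT s:{0..t}|lborel. (simple_value (m k) (\<tau> k) (\<eta> k) s \<omega> - H s \<omega>)\<^sup>2) \<and>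
        tendsto_zero_in_prob M (\<lambda>k \<omega>. simple_ito W (m k) (\<tau> k) (\<eta> k) t \<omega> - J \<omega>))"

definition strong_solution ::
    "'a measure \<Rightarrow> (real \<Rightarrow> 'a \<Rightarrow> real) \<Rightarrow> ('a \<Rightarrow> real) \<Rightarrow> (real \<Rightarrow> real) \<Rightarrow> (real \<Rightarrow> real) \<Rightarrow>
      (real \<Rightarrow> 'a \<Rightarrow> real) \<Rightarrow> bool" where
  "strong_solution M W \<xi> b \<sigma> X \<longleftrightarrow>
     (\<forall>t\<ge>0. X t \<in> borel_measurable (aug_filtration M W \<xi> t)) \<and>
     (\<forall>\<omega>\<in>space M. continuous_on {0..} (\<lambda>t. X t \<omega>)) \<and>
     (AE \<omega> in M. X 0 \<omega> = \<xi> \<omega>) \<and>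
     (\<forall>t\<ge>0. AE \<omega> in M. set_integrable lborel {0..t} (\<lambda>s. b (X s \<omega>)) \<and>
                        set_integrable lborel {0..t} (\<lambda>s. (\<sigma> (X s \<omega>))\<^sup>2)) \<and>
     (\<forall>t\<ge>0. \<exists>J. has_ito_integral M (aug_filtration M W \<xi>) W (\<lambda>s \<omega>. \<sigma> (X s \<omega>)) t J \<and>
        (AE \<omega> in M. X t \<omega> = \<xi> \<omega> + (LINT s:{0..t}|lborel. b (X s \<omega>)) + J \<omega>))"

definition unique_strong_solution ::
    "'a measure \<Rightarrow> (real \<Rightarrow> 'a \<Rightarrow> real) \<Rightarrow> ('a \<Rightarrow> real) \<Rightarrow> (real \<Rightarrow> real) \<Rightarrow> (real \<Rightarrow> real) \<Rightarrow> bool" where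
  "unique_strong_solution M W \<xi> b \<sigma> \<longleftrightarrow>
     (\<exists>X. strong_solution M W \<xi> b \<sigma> X) \<and>
     (\<forall>X Y. strong_solution M W \<xi> b \<sigma> X \<and> strong_solution M W \<xi> b \<sigma> Y \<longrightarrow>
        (AE \<omega> in M. \<forall>t\<ge>0. X t \<omega> = Y t \<omega>))"

definition prob_density :: "(real \<Rightarrow> real) \<Rightarrow> bool" where
  "prob_density f \<longleftrightarrow>
     f \<in> borel_measurable borel \<and> (\<forall>x. 0 \<le> f x) \<and> integrable lborel f \<and> (LINT x|lborel. f x) = 1"

definition transition_density :: "(real \<Rightarrow> real \<Rightarrow> real \<Rightarrow> real) \<Rightarrow> bool" where
  "transition_density q \<longleftrightarrow>
     (\<forall>t>0. (\<lambda>(x, y). q t x y) \<in> borel_measurable (borel \<Otimes>\<^sub>M borel) \<and> (\<forall>x. prob_density (q t x)))"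

definition markov_with_density ::
    "'a measure \<Rightarrow> (real \<Rightarrow> 'a \<Rightarrow> real) \<Rightarrow> (real \<Rightarrow> real \<Rightarrow> real \<Rightarrow> real) \<Rightarrow> bool" where
  "markov_with_density M X q \<longleftrightarrow>
     (\<forall>s\<ge>0. \<forall>t>0. \<forall>A\<in>sets borel.
        AE \<omega> in M. real_cond_exp M (sigma_gen M X {0..s}) (indicator (X (s + t) -` A \<inter> space M)) \<omega>
                   = (LINT y:A|lborel. q t (X s \<omega>) y))"

definition invariant_density :: "(real \<Rightarrow> real \<Rightarrow> real \<Rightarrow> real) \<Rightarrow> (real \<Rightarrow> real) \<Rightarrow> bool" where
  "invariant_density q f \<longleftrightarrow>
     (\<forall>t>0. \<forall>A\<in>sets borel. (LINT x|lborel. f x * (LINT y:A|lborel. q t x y)) = (LINT x:A|lborel. f x))"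

text \<open>Ergodicity of the invariant law: every Borel set that is invariant under the transition
  semigroup has probability 0 or 1.\<close>

definition ergodic_density :: "(real \<Rightarrow> real \<Rightarrow> real \<Rightarrow> real) \<Rightarrow> (real \<Rightarrow> real) \<Rightarrow> bool" where
  "ergodic_density q f \<longleftrightarrow>
     invariant_density q f \<and>
     (\<forall>B\<in>sets borel.
        (\<forall>t>0. AE x in density lborel f. (LINT y:B|lborel. q t x y) = indicator B x) \<longrightarrow>
        (LINT x:B|lborel. f x) \<in> {0, 1})"

definition strictly_stationary :: "'a measure \<Rightarrow> (real \<Rightarrow> 'a \<Rightarrow> real) \<Rightarrow> bool" where
  "strictly_stationary M X \<longleftrightarrow>
     (\<forall>s\<ge>0. distr M (Pi\<^sub>M {0..} (\<lambda>_. borel)) (\<lambda>\<omega>. \<lambda>t\<in>{0..}. X (s + t) \<omega>) =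
             distr M (Pi\<^sub>M {0..} (\<lambda>_. borel)) (\<lambda>\<omega>. \<lambda>t\<in>{0..}. X t \<omega>))"

definition mixing_coeff :: "'a measure \<Rightarrow> (nat \<Rightarrow> 'a \<Rightarrow> real) \<Rightarrow> nat \<Rightarrow> real" where
  "mixing_coeff M Z k =
     Sup {\<bar>measure M (A \<inter> B) - measure M A * measure M B\<bar> | m A B.
            A \<in> sets (sigma_gen M Z {..m}) \<and> B \<in> sets (sigma_gen M Z {m + k..})}"

definition bounded_in_prob :: "'a measure \<Rightarrow> (nat \<Rightarrow> 'a \<Rightarrow> real) \<Rightarrow> bool" where
  "bounded_in_prob M Y \<longleftrightarrow>
     (\<forall>\<epsilon>>0. \<exists>C. \<forall>\<^sub>F n in sequentially. measure M {\<omega> \<in> space M. \<bar>Y n \<omega>\<bar> > C} < \<epsilon>)"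

definition kernel_estimator ::
    "(real \<Rightarrow> real) \<Rightarrow> (nat \<Rightarrow> real) \<Rightarrow> (nat \<Rightarrow> 'a \<Rightarrow> real) \<Rightarrow> nat \<Rightarrow> 'a \<Rightarrow> real \<Rightarrow> real" where
  "kernel_estimator K h Z n \<omega> x = 1 / (real (n + 1) * h n) * (\<Sum>j\<le>n. K ((x - Z j \<omega>) / h n))"

text \<open>With \<open>q\<close> the kernel estimator this is \<open>R\<^sub>n\<close>; with \<open>q\<close> the true invariant density it is \<open>R\<close>.\<close>

definition criterion ::
    "(real \<Rightarrow> real \<Rightarrow> real) \<Rightarrow> (real \<Rightarrow> real) \<Rightarrow> (real \<Rightarrow> real) \<Rightarrow> (real \<Rightarrow> real) \<Rightarrow> real \<Rightarrow> real" where
  "criterion \<mu> \<sigma> w q \<theta> =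
     (LINT x|lborel. (\<mu> x \<theta> * q x - 1 / 2 * deriv (\<lambda>y. (\<sigma> y)\<^sup>2 * q y) x)\<^sup>2 * w x)"

text \<open>Derivatives in the parameter are taken relative to the parameter set, hence are one-sided
  at the endpoints of an interval.\<close>

definition param_deriv :: "real set \<Rightarrow> (real \<Rightarrow> real \<Rightarrow> real) \<Rightarrow> real \<Rightarrow> real \<Rightarrow> real" where
  "param_deriv T f x \<theta> = vector_derivative (f x) (at \<theta> within T)"

definition bdd_integrable :: "(real \<Rightarrow> real) \<Rightarrow> bool" where
  "bdd_integrable f \<longleftrightarrow> bounded (range f) \<and> integrable lborel f"

end

theory Submission
  imports Defs
begin

text \<open>
For a function \<open>q\<close> close to the invariant density \<open>\<pi>\<close> put \<open>d = q - \<pi>\<close> and let \<open>flux q = (\<sigma>\<^sup>2 q)' / 2\<close>, so that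
the contrast is the squared norm of \<open>\<mu>\<^sub>\<theta> q - flux q\<close> in \<open>L\<^sup>2(w)\<close>. The stationary equation says that \<open>\<pi>\<close> has
residual zero at \<open>\<theta>\<^sub>0\<close>; hence the residual \<open>\<rho>\<close> of \<open>q\<close> at \<open>\<theta>\<^sub>0\<close> is linear in \<open>d\<close>, and the contrast of \<open>\<pi>\<close> at \<open>\<theta>\<close> is the
squared norm of \<open>m \<pi>\<close> with \<open>m = \<mu>\<^sub>\<theta> - \<mu>\<^sub>\<theta>\<^sub>0\<close>.

Let \<open>\<theta>\<close> minimise the contrast of \<open>q\<close>. Since the contrast is a squared norm, \<open>\<theta>\<close> almost minimises the contrast of
\<open>\<pi>\<close> if \<open>d\<close> and \<open>d'\<close> are small in weighted \<open>L\<^sup>2\<close>, and by identifiability it is close to \<open>\<theta>\<^sub>0\<close>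
(\<open>criterion_minimiser_le\<close>). For the rate, compare the contrast of \<open>q\<close> at \<open>\<theta>\<close> and at \<open>\<theta>\<^sub>0\<close>: the difference is the
integral of \<open>(m\<^sup>2 q\<^sup>2 + 2 m q \<rho>) w\<close>. Expanding \<open>m\<close> at \<open>\<theta>\<^sub>0\<close>, the first term is bounded below by a multiple of
\<open>(\<theta> - \<theta>\<^sub>0)\<^sup>2\<close>, the factor being positive because the second derivative of the limit contrast does not vanish
(\<open>second_derivative_criterion\<close>), while the second term is linear in \<open>\<theta> - \<theta>\<^sub>0\<close> with the score, the integral of
\<open>\<mu>1 q \<rho> w\<close>, as coefficient, up to small errors. So \<open>\<bar>\<theta> - \<theta>\<^sub>0\<bar>\<close> is at most a multiple of the score (\<open>minimiser_rate\<close>).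

The score contains \<open>d'\<close>, for which no sufficient rate is available. Integrating by parts, its linear part becomes
the integral of \<open>d\<close> against a fixed function, and its quadratic part, where \<open>d d'\<close> is half the derivative of \<open>d\<^sup>2\<close>, is
bounded by a weighted integral of \<open>d\<^sup>2\<close> (\<open>score_linear_part\<close>, \<open>score_quadratic_part\<close>).

It remains to take for \<open>q\<close> the kernel estimator. Under summable mixing coefficients the average of \<open>n + 1\<close>
functionals bounded by \<open>C\<close> has variance of order \<open>C\<^sup>2 / n\<close> (\<open>variance_mean_mixing\<close>). For \<open>q\<close>, for its derivative
and for a linear functional of \<open>q\<close> the bound \<open>C\<close> is of order \<open>1 / h\<close>, \<open>1 / h\<^sup>2\<close> and \<open>1\<close>. Since \<open>n h\<^sup>4\<close> tends to
infinity, the weighted integral of \<open>d\<^sup>2\<close> is of order \<open>1 / sqrt n\<close> and that of \<open>d'\<^sup>2\<close> tends to zero, while the linear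
functional is of order \<open>1 / sqrt n\<close>. The biases agree with this: that of \<open>q\<close> is of order \<open>h\<^sup>\<alpha>\<close> in \<open>L\<^sup>2\<close>
(\<open>smooth_bias_L2\<close>), and \<open>h\<^sup>2\<^sup>\<alpha>\<close> is of order \<open>1 / n\<close>.
\<close>

section \<open>Covariances under strong mixing\<close>

text \<open>Layer-cake principle for covariances: a bounded \<open>U\<close> is, up to a constant, the integral over levels
\<open>s\<close> of the indicators of \<open>s < U\<close>, and the constant is harmless against a centred \<open>Y\<close>. Bounds that
are known for events therefore pass to bounded random variables, at the price of the length \<open>2 * C\<close>
of the range.\<close>

lemma integral_mult_le_superlevel:
  fixes U Y :: "'a \<Rightarrow> real"
  assumes "prob_space M"
    and U [measurable]: "U \<in> borel_measurable M" and UC: "\<And>\<omega>. \<omega> \<in> space M \<Longrightarrow> \<bar>U \<omega>\<bar> \<le> C"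
    and Y [measurable]: "Y \<in> borel_measurable M" and YB: "\<And>\<omega>. \<omega> \<in> space M \<Longrightarrow> \<bar>Y \<omega>\<bar> \<le> B"
    and Y0: "(\<integral>\<omega>. Y \<omega> \<partial>M) = 0"
    and c: "\<And>s. \<bar>\<integral>\<omega>. indicator {\<omega>\<in>space M. s < U \<omega>} \<omega> * Y \<omega> \<partial>M\<bar> \<le> c"
  shows "\<bar>\<integral>\<omega>. U \<omega> * Y \<omega> \<partial>M\<bar> \<le> 2 * C * c"
proof -
  interpret prob_space M by fact
  interpret pair_sigma_finite M "lborel :: real measure" ..
  have C0: "0 \<le> C" and B0: "0 \<le> B"
    using not_empty UC YB by (force)+
  define F where "F = (\<lambda>\<omega> s. indicator {-C..C} s * (indicator {\<omega>\<in>space M. s < U \<omega>} \<omega> * Y \<omega>))"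
  have F_alt: "F \<omega> s = indicator {-C..C} s * ((if s < U \<omega> then 1 else 0) * Y \<omega>)" if "\<omega> \<in> space M" for \<omega> s
    using that by (auto simp: F_def)
  have Fm: "case_prod F \<in> borel_measurable (M \<Otimes>\<^sub>M lborel)"
  proof -
    have "(\<lambda>(\<omega>, s). indicator {-C..C} s * ((if s < U \<omega> then 1 else 0) * Y \<omega>)) \<in> borel_measurable (M \<Otimes>\<^sub>M lborel)"
      by measurable
    then show ?thesis
      by (rule measurable_cong[THEN iffD1, rotated]) (auto simp: F_alt space_pair_measure)
  qed
  have Fint: "integrable (M \<Otimes>\<^sub>M lborel) (case_prod F)"
  proof (rule integrableI_bounded_set[where A = "space M \<times> {-C..C}" and B = B])
    show "emeasure (M \<Otimes>\<^sub>M lborel) (space M \<times> {-C..C}) < \<infinity>"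
      using C0 by (subst lborel.emeasure_pair_measure_Times) (auto simp: emeasure_space_1)
    show "AE x in M \<Otimes>\<^sub>M lborel. x \<in> space M \<times> {- C..C} \<longrightarrow> norm (case x of (x, xa) \<Rightarrow> F x xa) \<le> B"
      by (rule AE_I2) (use YB B0 in \<open>auto simp: F_alt indicator_def\<close>)
    show "AE x in M \<Otimes>\<^sub>M lborel. x \<notin> space M \<times> {- C..C} \<longrightarrow> (case x of (x, xa) \<Rightarrow> F x xa) = 0"
      by (rule AE_I2) (auto simp: F_def space_pair_measure indicator_def)
  qed (use Fm in auto)
  have inner: "(LBINT s. F \<omega> s) = (U \<omega> + C) * Y \<omega>" if "\<omega> \<in> space M" for \<omega>
  proof -
    have "F \<omega> s = indicator {-C..<U \<omega>} s * Y \<omega>" for s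
      using UC[OF that] that by (auto simp: F_def indicator_def)
    moreover have "(LBINT s. indicator {-C..<U \<omega>} s * Y \<omega>) = (U \<omega> + C) * Y \<omega>"
      using UC[OF that] by (simp add: abs_le_iff algebra_simps)
    ultimately show ?thesis by presburger
  qed
  have intY: "integrable M Y"
    by (rule integrable_const_bound[where B=B]) (use YB in auto)
  have intUY: "integrable M (\<lambda>\<omega>. U \<omega> * Y \<omega>)"
    by (rule integrable_const_bound[where B="C*B"])
       (use YB UC C0 in \<open>auto simp: abs_mult intro!: mult_mono\<close>)
  have "(\<integral>\<omega>. U \<omega> * Y \<omega> \<partial>M) = (\<integral>\<omega>. U \<omega> * Y \<omega> + C * Y \<omega> \<partial>M)"
    using intY intUY Y0 by simp
  also have "\<dots> = (\<integral>\<omega>. (LBINT s. F \<omega> s) \<partial>M)"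
    by (intro Bochner_Integration.integral_cong refl) (simp add: inner algebra_simps)
  also have "\<dots> = (LBINT s. (\<integral>\<omega>. F \<omega> s \<partial>M))"
    using Fubini_integral[OF Fint] by simp
  also have "\<bar>\<dots>\<bar> \<le> (LBINT s. indicator {-C..C} s * c)"
  proof (rule order_trans[OF integral_abs_bound], rule integral_mono)
    show "integrable lborel (\<lambda>s. \<bar>\<integral>\<omega>. F \<omega> s \<partial>M\<bar>)"
      using integrable_snd[OF Fint] by simp
    show "integrable lborel (\<lambda>s. indicator {-C..C} s * c)"
      using C0 by (intro integrable_mult_left integrable_real_indicator) auto
    show "\<bar>\<integral>\<omega>. F \<omega> s \<partial>M\<bar> \<le> indicator {-C..C} s * c" for s
      using c[of s] unfolding F_def by (auto simp: indicator_def)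
  qed
  also have "\<dots> = 2 * C * c" using C0 by simp
  finally show ?thesis .
qed

text \<open>The mixing coefficient is a real supremum, which is an upper bound only for sets that are bounded
above.\<close>

lemma mixing_set_bdd_above:
  assumes "prob_space M" and Z: "\<And>j. Z j \<in> borel_measurable M"
  shows "bdd_above {\<bar>measure M (A \<inter> B) - measure M A * measure M B\<bar> | m A B.
            A \<in> sets (sigma_gen M Z {..m}) \<and> B \<in> sets (sigma_gen M Z {m + k..})}"
proof -
  interpret prob_space M by fact
  show ?thesis
  proof (rule bdd_aboveI[where M=1], clarsimp)
    fix A B
    have "0 \<le> prob A * prob B" "prob A * prob B \<le> 1" by (auto simp: mult_le_one)
    moreover have "0 \<le> prob (A \<inter> B)" "prob (A \<inter> B) \<le> 1" by auto
    ultimately show "\<bar>prob (A \<inter> B) - prob A * prob B\<bar> \<le> 1" by linarith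
  qed
qed

lemma mixing_coeff_upper:
  assumes "prob_space M" "\<And>j. Z j \<in> borel_measurable M"
    and "A \<in> sets (sigma_gen M Z {..m})" "B \<in> sets (sigma_gen M Z {m + k..})"
  shows "\<bar>measure M (A \<inter> B) - measure M A * measure M B\<bar> \<le> mixing_coeff M Z k"
  unfolding mixing_coeff_def
  by (rule cSup_upper[OF _ mixing_set_bdd_above[OF assms(1,2)]]) (use assms in auto)

lemma vimage_in_sigma_gen:
  assumes "i \<in> I" "A \<in> sets borel"
  shows "X i -` A \<inter> space M \<in> sets (sigma_gen M X I)"
proof -
  have "{X i -` A \<inter> space M | i A. i \<in> I \<and> A \<in> sets borel} \<subseteq> Pow (space M)" by auto
  then show ?thesis
    unfolding sigma_gen_def using assms by (subst sets_measure_of) (auto intro!: sigma_sets.Basic)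
qed

lemma mixing_coeff_nonneg:
  assumes "prob_space M" "\<And>j. Z j \<in> borel_measurable M"
  shows "0 \<le> mixing_coeff M Z k"
  using mixing_coeff_upper[OF assms, where A="{}" and m=0 and B="{}" and k=k]
  by simp

text \<open>The layer-cake principle is applied twice, once to each variable; what remains is the covariance of
two events, one from the past and one from the future, which the mixing coefficient bounds by
definition.\<close>

lemma covariance_le_mixing:
  fixes f g :: "real \<Rightarrow> real"
  assumes "prob_space M" and Z [measurable]: "\<And>j. Z j \<in> borel_measurable M"
    and f [measurable]: "f \<in> borel_measurable borel" and fC: "\<And>z. \<bar>f z\<bar> \<le> C"
    and g [measurable]: "g \<in> borel_measurable borel" and gC: "\<And>z. \<bar>g z\<bar> \<le> C"
  shows "\<bar>\<integral>\<omega>. f (Z i \<omega>) * (g (Z (i + k) \<omega>) - (\<integral>\<omega>. g (Z (i + k) \<omega>) \<partial>M)) \<partial>M\<bar>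
           \<le> 4 * C\<^sup>2 * mixing_coeff M Z k"
proof -
  interpret prob_space M by fact
  define e where "e = (\<integral>\<omega>. g (Z (i + k) \<omega>) \<partial>M)"
  have eC: "\<bar>e\<bar> \<le> C"
  proof -
    have "\<bar>e\<bar> \<le> (\<integral>\<omega>. \<bar>g (Z (i + k) \<omega>)\<bar> \<partial>M)" unfolding e_def by (rule integral_abs_bound)
    also have "\<dots> \<le> (\<integral>\<omega>. C \<partial>M)"
      by (rule integral_mono) (use gC in \<open>auto intro!: integrable_const_bound[where B=C]\<close>)
    finally show ?thesis by (simp add: prob_space)
  qed
  have int_g: "integrable M (\<lambda>\<omega>. g (Z (i + k) \<omega>))"
    by (rule integrable_const_bound[where B=C]) (use gC in auto)
  \<comment> \<open>Here the first variable is already reduced to an event \<open>A\<close> of the past. Moving the centring from \<open>g\<close> to the indicator of \<open>A\<close> makes the second reduction an instance of the same principle.\<close>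
  have half: "\<bar>\<integral>\<omega>. indicator {\<omega>\<in>space M. s < f (Z i \<omega>)} \<omega> * (g (Z (i + k) \<omega>) - e) \<partial>M\<bar>
      \<le> 2 * C * mixing_coeff M Z k" for s
  proof -
    define A where "A = {\<omega>\<in>space M. s < f (Z i \<omega>)}"
    have A [measurable]: "A \<in> sets M" unfolding A_def by measurable
    have A_past: "A \<in> sets (sigma_gen M Z {..i})"
    proof -
      have "A = Z i -` (f -` {s<..} \<inter> space borel) \<inter> space M" by (auto simp: A_def)
      moreover have "f -` {s<..} \<inter> space borel \<in> sets borel" by measurable
      ultimately show ?thesis using vimage_in_sigma_gen by (metis atMost_iff order_refl)
    qed
    have int_A: "integrable M (indicat_real A)" by (rule integrable_const_bound[where B=1]) auto
    have int_gA: "integrable M (\<lambda>\<omega>. g (Z (i + k) \<omega>) * indicator A \<omega>)"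
      by (rule integrable_real_mult_indicator) (use int_g in auto)
    have "(\<integral>\<omega>. indicator A \<omega> * (g (Z (i + k) \<omega>) - e) \<partial>M)
        = (\<integral>\<omega>. g (Z (i + k) \<omega>) * indicator A \<omega> - e * indicator A \<omega> \<partial>M)"
      by (simp add: algebra_simps)
    also have "\<dots> = (\<integral>\<omega>. g (Z (i + k) \<omega>) * indicator A \<omega> \<partial>M) - prob A * e"
      by (subst Bochner_Integration.integral_diff) (use int_gA int_A in auto)
    also have "\<dots> = (\<integral>\<omega>. g (Z (i + k) \<omega>) * indicator A \<omega> - prob A * g (Z (i + k) \<omega>) \<partial>M)"
      unfolding e_def using int_gA int_g by (subst Bochner_Integration.integral_diff) auto
    also have "\<dots> = (\<integral>\<omega>. g (Z (i + k) \<omega>) * (indicator A \<omega> - prob A) \<partial>M)"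
      by (simp add: algebra_simps)
    also have "\<bar>\<dots>\<bar> \<le> 2 * C * mixing_coeff M Z k"
    proof (rule integral_mult_le_superlevel[where B = 1])
      show "\<bar>indicator A \<omega> - prob A\<bar> \<le> 1" for \<omega>
        using prob_le_1[of A] by (auto simp: indicator_def)
      show "(\<integral>\<omega>. indicator A \<omega> - prob A \<partial>M) = 0" using int_A by (simp add: prob_space)
      fix t
      define B where "B = {\<omega>\<in>space M. t < g (Z (i + k) \<omega>)}"
      have B [measurable]: "B \<in> sets M" unfolding B_def by measurable
      have B_future: "B \<in> sets (sigma_gen M Z {i + k..})"
      proof -
        have "B = Z (i + k) -` (g -` {t<..} \<inter> space borel) \<inter> space M" by (auto simp: B_def)
        moreover have "g -` {t<..} \<inter> space borel \<in> sets borel" by measurable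
        ultimately show ?thesis using vimage_in_sigma_gen by (metis atLeast_iff order_refl)
      qed
      have "(\<integral>\<omega>. indicator B \<omega> * (indicator A \<omega> - prob A) \<partial>M)
          = (\<integral>\<omega>. indicator (A \<inter> B) \<omega> - indicator B \<omega> * prob A \<partial>M)"
        by (intro Bochner_Integration.integral_cong) (auto simp: indicator_def)
      also have "\<dots> = (\<integral>\<omega>. indicator (A \<inter> B) \<omega> \<partial>M) - (\<integral>\<omega>. indicator B \<omega> * prob A \<partial>M)"
        by (rule Bochner_Integration.integral_diff; rule integrable_const_bound[where B=1])
           (auto simp: indicator_def)
      also have "\<dots> = prob (A \<inter> B) - prob A * prob B" by simp
      also have "\<bar>\<dots>\<bar> \<le> mixing_coeff M Z k"
        by (rule mixing_coeff_upper) (use assms A_past B_future in auto)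
      finally show "\<bar>\<integral>\<omega>. indicator {\<omega>\<in>space M. t < g (Z (i + k) \<omega>)} \<omega> * (indicator A \<omega> - prob A) \<partial>M\<bar>
          \<le> mixing_coeff M Z k" unfolding B_def .
    qed (use assms gC in auto)
    finally show ?thesis unfolding A_def .
  qed
  have "\<bar>\<integral>\<omega>. f (Z i \<omega>) * (g (Z (i + k) \<omega>) - e) \<partial>M\<bar> \<le> 2 * C * (2 * C * mixing_coeff M Z k)"
  proof (rule integral_mult_le_superlevel[where B = "2 * C"])
    show "\<bar>g (Z (i + k) \<omega>) - e\<bar> \<le> 2 * C" for \<omega>
      using gC[of "Z (i + k) \<omega>"] eC by linarith
    show "(\<integral>\<omega>. g (Z (i + k) \<omega>) - e \<partial>M) = 0" using int_g by (simp add: e_def prob_space)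
  qed (use assms fC half in auto)
  then show ?thesis by (simp add: e_def power2_eq_square mult_ac)
qed

text \<open>A row sum of the covariance matrix of a sequence: every lag occurs at most twice.\<close>

lemma sum_abs_diff_le:
  fixes u :: "nat \<Rightarrow> real"
  assumes "summable u" "\<And>k. 0 \<le> u k"
  shows "(\<Sum>j\<le>n. u (if i \<le> j then j - i else i - j)) \<le> 2 * suminf u"
proof -
  have "(\<Sum>j\<le>n. u (if i \<le> j then j - i else i - j))
      = (\<Sum>j\<le>n. if i \<le> j then u (j - i) else u (i - j))"
    by (intro sum.cong) auto
  also have "\<dots> = (\<Sum>j\<in>{..n} \<inter> {i..}. u (j - i)) + (\<Sum>j\<in>{..n} \<inter> {..<i}. u (i - j))"
    by (subst sum.If_cases) (auto intro!: arg_cong2[where f="(+)"] sum.cong)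
  also have "(\<Sum>j\<in>{..n} \<inter> {i..}. u (j - i)) = sum u ((\<lambda>j. j - i) ` ({..n} \<inter> {i..}))"
    by (subst sum.reindex) (auto simp: inj_on_def)
  also have "\<dots> \<le> suminf u" by (rule sum_le_suminf) (use assms in auto)
  also have "(\<Sum>j\<in>{..n} \<inter> {..<i}. u (i - j)) = sum u ((\<lambda>j. i - j) ` ({..n} \<inter> {..<i}))"
    by (subst sum.reindex) (auto simp: inj_on_def)
  also have "\<dots> \<le> suminf u" by (rule sum_le_suminf) (use assms in auto)
  finally show ?thesis by simp
qed

text \<open>Summable mixing coefficients make averages of bounded functionals concentrate at the same rate
\<open>1 / n\<close> as for independent variables. Only the bound \<open>C\<close> enters, so the estimate can be
used for functionals that change with \<open>n\<close>.\<close>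

lemma variance_mean_mixing:
  fixes g :: "real \<Rightarrow> real"
  assumes "prob_space M" and Z [measurable]: "\<And>j. Z j \<in> borel_measurable M"
    and summ: "summable (mixing_coeff M Z)"
    and g [measurable]: "g \<in> borel_measurable borel" and gC: "\<And>z. \<bar>g z\<bar> \<le> C"
    and mean: "\<And>j. (\<integral>\<omega>. g (Z j \<omega>) \<partial>M) = e"
  shows "(\<integral>\<omega>. ((\<Sum>j\<le>n. g (Z j \<omega>)) / real (n + 1) - e)\<^sup>2 \<partial>M)
           \<le> 8 * C\<^sup>2 * suminf (mixing_coeff M Z) / real (n + 1)"
proof -
  interpret prob_space M by fact
  define u where "u = mixing_coeff M Z"
  define Y where "Y = (\<lambda>j \<omega>. g (Z j \<omega>) - e)"
  have Ym [measurable]: "Y j \<in> borel_measurable M" for j unfolding Y_def by measurable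
  have YB: "\<bar>Y j \<omega>\<bar> \<le> C + \<bar>e\<bar>" for j \<omega> unfolding Y_def using gC[of "Z j \<omega>"] by linarith
  have int_g: "integrable M (\<lambda>\<omega>. g (Z j \<omega>))" for j
    by (rule integrable_const_bound[where B=C]) (use gC in auto)
  have int_Y: "integrable M (Y j)" for j unfolding Y_def using int_g by simp
  have int_YY: "integrable M (\<lambda>\<omega>. Y i \<omega> * Y j \<omega>)" for i j
    by (rule integrable_const_bound[where B="(C + \<bar>e\<bar>) * (C + \<bar>e\<bar>)"])
       (use YB in \<open>auto simp: abs_mult intro!: AE_I2 mult_mono order_trans[OF abs_ge_zero YB]\<close>)
  have EY: "(\<integral>\<omega>. Y j \<omega> \<partial>M) = 0" for j
    unfolding Y_def using int_g mean by (simp add: prob_space)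
  have cov: "(\<integral>\<omega>. Y i \<omega> * Y (i + k) \<omega> \<partial>M) \<le> 4 * C\<^sup>2 * u k" for i k
  proof -
    have int_gY: "integrable M (\<lambda>\<omega>. g (Z i \<omega>) * Y (i + k) \<omega>)"
      by (rule integrable_const_bound[where B="C * (C + \<bar>e\<bar>)"])
         (use YB gC in \<open>auto simp: abs_mult intro!: AE_I2 mult_mono order_trans[OF abs_ge_zero gC]\<close>)
    have "(\<integral>\<omega>. Y i \<omega> * Y (i + k) \<omega> \<partial>M) = (\<integral>\<omega>. g (Z i \<omega>) * Y (i + k) \<omega> - e * Y (i + k) \<omega> \<partial>M)"
      by (simp add: Y_def algebra_simps)
    also have "\<dots> = (\<integral>\<omega>. g (Z i \<omega>) * Y (i + k) \<omega> \<partial>M)"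
      using int_gY int_Y EY by simp
    also have "\<dots> \<le> 4 * C\<^sup>2 * u k"
      using covariance_le_mixing[where Z=Z and i=i and k=k, OF assms(1) Z g gC g gC, unfolded mean]
      unfolding u_def Y_def by linarith
    finally show ?thesis .
  qed
  have cov': "(\<integral>\<omega>. Y i \<omega> * Y j \<omega> \<partial>M) \<le> 4 * C\<^sup>2 * u (if i \<le> j then j - i else i - j)" for i j
    using cov[of i "j - i"] cov[of j "i - j"] by (cases "i \<le> j") (auto simp: mult.commute)
  have u0: "0 \<le> u k" for k unfolding u_def by (rule mixing_coeff_nonneg[OF assms(1) Z])
  have summ_u: "summable u" unfolding u_def by (rule summ)
  have sq: "(\<Sum>j\<le>n. Y j \<omega>)\<^sup>2 = (\<Sum>i\<le>n. \<Sum>j\<le>n. Y i \<omega> * Y j \<omega>)" for \<omega>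
    by (simp add: power2_eq_square sum_product)
  have "(\<integral>\<omega>. (\<Sum>j\<le>n. Y j \<omega>)\<^sup>2 \<partial>M) = (\<Sum>i\<le>n. \<Sum>j\<le>n. \<integral>\<omega>. Y i \<omega> * Y j \<omega> \<partial>M)"
    unfolding sq using int_YY by (simp add: Bochner_Integration.integral_sum)
  also have "\<dots> \<le> (\<Sum>i\<le>n. \<Sum>j\<le>n. 4 * C\<^sup>2 * u (if i \<le> j then j - i else i - j))"
    by (intro sum_mono cov')
  also have "\<dots> = 4 * C\<^sup>2 * (\<Sum>i\<le>n. \<Sum>j\<le>n. u (if i \<le> j then j - i else i - j))"
    by (simp add: sum_distrib_left)
  also have "\<dots> \<le> 4 * C\<^sup>2 * (\<Sum>i\<le>n. 2 * suminf u)"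
    by (intro mult_left_mono sum_mono sum_abs_diff_le summ_u u0) auto
  finally have bound: "(\<integral>\<omega>. (\<Sum>j\<le>n. Y j \<omega>)\<^sup>2 \<partial>M) \<le> 8 * C\<^sup>2 * suminf u * real (n + 1)"
    by (simp add: algebra_simps)
  have "(\<Sum>j\<le>n. g (Z j \<omega>)) / real (n + 1) - e = (\<Sum>j\<le>n. Y j \<omega>) / real (n + 1)" for \<omega>
    by (simp add: Y_def sum_subtractf field_simps)
  then have "(\<integral>\<omega>. ((\<Sum>j\<le>n. g (Z j \<omega>)) / real (n + 1) - e)\<^sup>2 \<partial>M)
      = (\<integral>\<omega>. (\<Sum>j\<le>n. Y j \<omega>)\<^sup>2 \<partial>M) / (real (n + 1))\<^sup>2"
    by (simp add: power_divide)
  also have "\<dots> \<le> (8 * C\<^sup>2 * suminf u * real (n + 1)) / (real (n + 1))\<^sup>2"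
    by (intro divide_right_mono bound) auto
  also have "\<dots> = 8 * C\<^sup>2 * suminf u / real (n + 1)"
    by (simp add: power2_eq_square)
  finally show ?thesis unfolding u_def .
qed

section \<open>Bias of kernel smoothing\<close>

text \<open>A derivative is a pointwise limit of difference quotients, hence measurable even if discontinuous.
This matters for the derivative of highest order, about which only a square-integrated modulus of
continuity is known.\<close>

lemma borel_measurable_has_derivative_real:
  fixes f f' :: "real \<Rightarrow> real"
  assumes "\<And>x. (f has_real_derivative f' x) (at x)"
  shows "f' \<in> borel_measurable borel"
proof -
  have f [measurable]: "f \<in> borel_measurable borel"
    using assms by (intro borel_measurable_continuous_onI DERIV_continuous_on) auto
  have "(\<lambda>n. (f (x + 1 / real (Suc n)) - f x) / (1 / real (Suc n))) \<longlonglongrightarrow> f' x" for x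
  proof -
    have "((\<lambda>t. (f (x + t) - f x) / t) \<longlongrightarrow> f' x) (at 0)"
      using assms[of x] by (simp add: DERIV_def)
    moreover have "filterlim (\<lambda>n. 1 / real (Suc n)) (at 0) sequentially"
      using LIMSEQ_inverse_real_of_nat
      by (intro filterlim_atI) (auto simp: inverse_eq_divide)
    ultimately show ?thesis by (rule filterlim_compose)
  qed
  then show ?thesis
    by (rule borel_measurable_LIMSEQ_real) measurable
qed

text \<open>Taylor's formula with integral remainder, from which the term of order \<open>p\<close> has been subtracted, so
that only the oscillation of the \<open>p\<close>-th derivative remains. The formula itself concerns the
Henstock--Kurzweil integral; stating the bound in the extended nonnegative reals makes it trivial
where the oscillation is not Lebesgue integrable.\<close>

lemma taylor_remainder_le_oscillation:
  fixes D :: "nat \<Rightarrow> real \<Rightarrow> real"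
  assumes D: "\<And>i x. i < p \<Longrightarrow> (D i has_real_derivative D (Suc i) x) (at x)" and p: "0 < p"
    and meas [measurable]: "D p \<in> borel_measurable borel"
  shows "ennreal \<bar>D 0 (x + c) - (\<Sum>i\<le>p. c ^ i / fact i * D i x)\<bar>
           \<le> ennreal (\<bar>c\<bar> ^ p) * (\<integral>\<^sup>+ s. ennreal \<bar>D p (x + s * c) - D p x\<bar> * indicator {0..1} s \<partial>lborel)"
    (is "ennreal \<bar>?R\<bar> \<le> _ * ?I")
proof (cases "c = 0 \<or> ?I = \<infinity>")
  case True
  moreover have "?R = 0" if "c = 0"
  proof -
    have "(\<Sum>i\<le>p. c ^ i / fact i * D i x) = (\<Sum>i\<le>p. if i = 0 then D 0 x else 0)"
      using that by (intro sum.cong) (auto simp: power_0_left)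
    then show ?thesis using that by simp
  qed
  ultimately show ?thesis by (auto simp: ennreal_mult_top)
next
  case False
  define k where "k = (\<lambda>s::real. (1 - s) ^ (p - 1) / fact (p - 1))"
  have k01: "\<bar>k s\<bar> \<le> 1" if "s \<in> {0..1}" for s
  proof -
    have "\<bar>(1 - s) ^ (p - 1)\<bar> \<le> 1" using that by (auto simp: power_abs intro!: power_le_one)
    moreover have "(1::real) \<le> fact (p - 1)" by (rule fact_ge_1)
    ultimately show ?thesis unfolding k_def
      by (simp add: divide_le_eq del: fact_ge_1)
  qed
  have tay: "((\<lambda>s. ((1 - s) ^ (p - 1) / fact (p - 1)) *\<^sub>R (c ^ p * D p (x + s * c))) has_integral
      D 0 (x + 1 * c) - (\<Sum>i<p. ((1 - 0) ^ i / fact i) *\<^sub>R (c ^ i * D i (x + 0 * c)))) {0..1}"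
  proof (rule Taylor_has_integral[where Df = "\<lambda>i s. c ^ i * D i (x + s * c)"])
    fix m t :: real and m' :: nat assume "m' < p"
    then have "((\<lambda>s. D m' (x + s * c)) has_real_derivative D (Suc m') (x + t * c) * c) (at t within {0..1})"
      by (intro DERIV_chain'[where f = "\<lambda>s. x + s * c" and g = "D m'"] D) (auto intro!: derivative_eq_intros)
    then have "((\<lambda>s. c ^ m' * D m' (x + s * c)) has_real_derivative c ^ m' * (D (Suc m') (x + t * c) * c)) (at t within {0..1})"
      by (rule DERIV_cmult)
    then show "((\<lambda>s. c ^ m' * D m' (x + s * c)) has_vector_derivative c ^ Suc m' * D (Suc m') (x + t * c)) (at t within {0..1})"
      by (simp add: has_real_derivative_iff_has_vector_derivative mult_ac)
  qed (use p in auto)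
  have "((\<lambda>s. (1 - s) ^ (p - 1) / fact (p - 1)) has_integral (- ((1 - 1) ^ p / fact p)) - (- ((1 - 0) ^ p / fact p :: real))) {0..1}"
  proof (rule fundamental_theorem_of_calculus)
    fix s :: real
    obtain q where q: "p = Suc q" using p by (cases p) auto
    have "((\<lambda>s. 1 - s :: real) has_real_derivative -1) (at s within {0..1})"
      by (auto intro!: derivative_eq_intros)
    from DERIV_minus[OF DERIV_cdivide[OF DERIV_power_Suc[OF this, of q], of "fact (Suc q)"]]
    show "((\<lambda>s. - ((1 - s) ^ p / fact p)) has_vector_derivative (1 - s) ^ (p - 1) / fact (p - 1)) (at s within {0..1})"
      unfolding has_real_derivative_iff_has_vector_derivative[symmetric] q
      by (simp add: divide_simps)
  qed auto
  then have "((\<lambda>s. (1 - s) ^ (p - 1) / fact (p - 1) * (c ^ p * D p x)) has_integral 1 / fact p * (c ^ p * D p x)) {0..1}"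
    using p by (intro has_integral_mult_left) (auto simp: power_0_left)
  from has_integral_diff[OF tay this]
  have hi: "((\<lambda>s. k s * (c ^ p * (D p (x + s * c) - D p x))) has_integral ?R) {0..1}"
    by (simp add: k_def algebra_simps lessThan_Suc_atMost[symmetric] diff_diff_eq)
  define G where "G = (\<lambda>s. D p (x + s * c) - D p x)"
  have Gm [measurable]: "G \<in> borel_measurable borel" unfolding G_def by measurable
  have Gint: "set_integrable lborel {0..1} G"
    unfolding set_integrable_def integrable_iff_bounded
  proof
    have "(\<integral>\<^sup>+ s. norm (indicat_real {0..1} s *\<^sub>R G s) \<partial>lborel) = ?I"
      by (intro nn_integral_cong) (auto simp: G_def indicator_def)
    then show "(\<integral>\<^sup>+ s. norm (indicat_real {0..1} s *\<^sub>R G s) \<partial>lborel) < \<infinity>"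
      using False by (simp add: less_top[symmetric])
  qed measurable
  have GkI: "set_integrable lborel {0..1} (\<lambda>s. k s * (c ^ p * G s))"
  proof (rule set_integrable_bound)
    show "set_integrable lborel {0..1} (\<lambda>s. c ^ p * G s)" using Gint by simp
    show "set_borel_measurable lborel {0..1} (\<lambda>s. k s * (c ^ p * G s))"
      unfolding set_borel_measurable_def k_def by measurable
    show "AE s in lborel. s \<in> {0..1} \<longrightarrow> norm (k s * (c ^ p * G s)) \<le> norm (c ^ p * G s)"
      using k01 by (intro AE_I2) (auto simp: abs_mult intro!: mult_left_le_one_le)
  qed
  have "?R = (LINT s:{0..1}|lborel. k s * (c ^ p * G s))"
    using hi set_borel_integral_eq_integral(2)[OF GkI] unfolding G_def by (simp add: integral_unique)
  then have "ennreal \<bar>?R\<bar> \<le> (\<integral>\<^sup>+ s. norm (indicator {0..1} s *\<^sub>R (k s * (c ^ p * G s))) \<partial>lborel)"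
    unfolding set_lebesgue_integral_def
    using integral_norm_bound_ennreal[OF GkI[unfolded set_integrable_def]] by simp
  also have "\<dots> \<le> (\<integral>\<^sup>+ s. ennreal (\<bar>c\<bar> ^ p) * (ennreal \<bar>G s\<bar> * indicator {0..1} s) \<partial>lborel)"
  proof (rule nn_integral_mono)
    fix s
    have "\<bar>k s\<bar> * (\<bar>c\<bar> ^ p * \<bar>G s\<bar>) \<le> \<bar>c\<bar> ^ p * \<bar>G s\<bar>" if "s \<in> {0..1}"
      using k01[OF that] by (intro mult_left_le_one_le) auto
    then show "ennreal (norm (indicator {0..1} s *\<^sub>R (k s * (c ^ p * G s))))
        \<le> ennreal (\<bar>c\<bar> ^ p) * (ennreal \<bar>G s\<bar> * indicator {0..1} s)"
      by (auto simp: indicator_def abs_mult power_abs ennreal_mult[symmetric])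
  qed
  also have "\<dots> = ennreal (\<bar>c\<bar> ^ p) * (\<integral>\<^sup>+ s. ennreal \<bar>G s\<bar> * indicator {0..1} s \<partial>lborel)"
    by (rule nn_integral_cmult) measurable
  finally show ?thesis unfolding G_def .
qed

text \<open>By Cauchy--Schwarz in \<open>s\<close> and Tonelli, the pointwise remainder bound becomes one in \<open>L\<^sup>2\<close>, where only
the \<open>L\<^sup>2\<close>-modulus of the \<open>p\<close>-th derivative occurs.\<close>

lemma taylor_remainder_L2:
  fixes D :: "nat \<Rightarrow> real \<Rightarrow> real"
  assumes D: "\<And>i x. i < p \<Longrightarrow> (D i has_real_derivative D (Suc i) x) (at x)" and p: "0 < p"
    and L: "\<And>t. (\<integral>\<^sup>+ x. ennreal ((D p (x + t) - D p x)\<^sup>2) \<partial>lborel) \<le> ennreal (L\<^sup>2)"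
  shows "(\<integral>\<^sup>+ x. ennreal ((D 0 (x + c) - (\<Sum>i\<le>p. c ^ i / fact i * D i x))\<^sup>2) \<partial>lborel)
           \<le> ennreal ((\<bar>c\<bar> ^ p * L)\<^sup>2)"
proof -
  have meas [measurable]: "D p \<in> borel_measurable borel"
    using borel_measurable_has_derivative_real[of "D (p - 1)" "D p"] D[of "p - 1"] p by simp
  define C where "C = ennreal (\<bar>c\<bar> ^ p)"
  have "ennreal ((D 0 (x + c) - (\<Sum>i\<le>p. c ^ i / fact i * D i x))\<^sup>2)
      \<le> C\<^sup>2 * (\<integral>\<^sup>+ s. ennreal ((D p (x + s * c) - D p x)\<^sup>2) * indicator {0..1} s \<partial>lborel)" (is "?l \<le> _ * ?J x") for x
  proof -
    have "?l = (ennreal \<bar>D 0 (x + c) - (\<Sum>i\<le>p. c ^ i / fact i * D i x)\<bar>)\<^sup>2"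
      by (simp add: ennreal_power)
    also have "\<dots> \<le> (C * (\<integral>\<^sup>+ s. ennreal \<bar>D p (x + s * c) - D p x\<bar> * indicator {0..1} s \<partial>lborel))\<^sup>2"
      unfolding C_def by (intro power_mono taylor_remainder_le_oscillation D p meas) auto
    also have "\<dots> = C\<^sup>2 * (\<integral>\<^sup>+ s. (ennreal \<bar>D p (x + s * c) - D p x\<bar> * indicator {0..1} s) * indicator {0..1} s \<partial>lborel)\<^sup>2"
      by (simp add: power_mult_distrib mult.assoc indicator_inter_arith[symmetric])
    also have "\<dots> \<le> C\<^sup>2 * ((\<integral>\<^sup>+ s. (ennreal \<bar>D p (x + s * c) - D p x\<bar> * indicator {0..1} s)\<^sup>2 \<partial>lborel)
        * (\<integral>\<^sup>+ s. (indicator {0..1} s)\<^sup>2 \<partial>(lborel::real measure)))"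
      by (intro mult_left_mono Cauchy_Schwarz_nn_integral) auto
    also have "(\<integral>\<^sup>+ s. (indicator {0..1} s)\<^sup>2 \<partial>(lborel::real measure)) = (\<integral>\<^sup>+ s. indicator {0..1} s \<partial>(lborel::real measure))"
      by (intro nn_integral_cong) (auto simp: indicator_def)
    also have "\<dots> = 1" by simp
    also have "(\<integral>\<^sup>+ s. (ennreal \<bar>D p (x + s * c) - D p x\<bar> * indicator {0..1} s)\<^sup>2 \<partial>lborel) = ?J x"
      by (intro nn_integral_cong) (auto simp: indicator_def ennreal_power)
    finally show ?thesis by simp
  qed
  then have "(\<integral>\<^sup>+ x. ennreal ((D 0 (x + c) - (\<Sum>i\<le>p. c ^ i / fact i * D i x))\<^sup>2) \<partial>lborel)
      \<le> (\<integral>\<^sup>+ x. C\<^sup>2 * (\<integral>\<^sup>+ s. ennreal ((D p (x + s * c) - D p x)\<^sup>2) * indicator {0..1} s \<partial>lborel) \<partial>lborel)"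
    by (rule nn_integral_mono)
  also have "\<dots> = C\<^sup>2 * (\<integral>\<^sup>+ x. (\<integral>\<^sup>+ s. ennreal ((D p (x + s * c) - D p x)\<^sup>2) * indicator {0..1} s \<partial>lborel) \<partial>lborel)"
    by (rule nn_integral_cmult) measurable
  also have "(\<integral>\<^sup>+ x. (\<integral>\<^sup>+ s. ennreal ((D p (x + s * c) - D p x)\<^sup>2) * indicator {0..1} s \<partial>lborel) \<partial>lborel)
     = (\<integral>\<^sup>+ s. (\<integral>\<^sup>+ x. ennreal ((D p (x + s * c) - D p x)\<^sup>2) * indicator {0..1} s \<partial>lborel) \<partial>lborel)"
    by (rule lborel_pair.Fubini') measurable
  also have "\<dots> = (\<integral>\<^sup>+ s. (\<integral>\<^sup>+ x. ennreal ((D p (x + s * c) - D p x)\<^sup>2) \<partial>lborel) * indicator {0..1} s \<partial>lborel)"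
    by (intro nn_integral_cong nn_integral_multc) measurable
  also have "\<dots> \<le> (\<integral>\<^sup>+ s. ennreal (L\<^sup>2) * indicator {0..1} (s::real) \<partial>lborel)"
    by (intro nn_integral_mono mult_right_mono L) auto
  also have "\<dots> = ennreal (L\<^sup>2)" by (subst nn_integral_cmult_indicator) auto
  finally have "(\<integral>\<^sup>+ x. ennreal ((D 0 (x + c) - (\<Sum>i\<le>p. c ^ i / fact i * D i x))\<^sup>2) \<partial>lborel)
      \<le> C\<^sup>2 * ennreal (L\<^sup>2)" by (simp add: mult_left_mono)
  also have "\<dots> = ennreal ((\<bar>c\<bar> ^ p * L)\<^sup>2)"
    unfolding C_def by (simp add: ennreal_power ennreal_mult[symmetric] power_mult_distrib)
  finally show ?thesis .
qed

locale smoothing_kernel =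
  fixes K K' :: "real \<Rightarrow> real"
  assumes deriv_K: "\<And>u. (K has_real_derivative K' u) (at u)"
    and cont_K': "continuous_on UNIV K'"
    and K_outside: "\<And>u. 1 \<le> \<bar>u\<bar> \<Longrightarrow> K u = 0"
begin

lemma K'_outside:
  assumes "1 < \<bar>u\<bar>" shows "K' u = 0"
proof -
  have "open {u::real. 1 < \<bar>u\<bar>}" by (intro open_Collect_less continuous_intros)
  moreover have "K v = 0" if "v \<in> {u. 1 < \<bar>u\<bar>}" for v using that K_outside[of v] by auto
  ultimately have "(K has_real_derivative 0) (at u)"
    using assms by (subst has_field_derivative_cong_eventually[of _ "\<lambda>_. 0"])
      (auto simp: eventually_at_topological K_outside intro!: exI[of _ "{u::real. 1 < \<bar>u\<bar>}"])
  with deriv_K show ?thesis using DERIV_unique by blast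
qed

lemma cont_K: "continuous_on UNIV K"
  using deriv_K by (intro DERIV_continuous_on) auto

lemma K_measurable [measurable]: "K \<in> borel_measurable borel"
  by (rule borel_measurable_continuous_onI[OF cont_K])

lemma K'_measurable [measurable]: "K' \<in> borel_measurable borel"
  by (rule borel_measurable_continuous_onI[OF cont_K'])

lemma compactly_supported_bounded:
  fixes f :: "real \<Rightarrow> real"
  assumes "continuous_on UNIV f" "\<And>u. 1 < \<bar>u\<bar> \<Longrightarrow> f u = 0"
  shows "\<exists>C\<ge>0. \<forall>u. \<bar>f u\<bar> \<le> C"
proof -
  have "bounded (f ` {-1..1})"
    by (intro compact_imp_bounded compact_continuous_image continuous_on_subset[OF assms(1)]) auto
  then obtain C where C: "\<And>u. u \<in> {-1..1} \<Longrightarrow> \<bar>f u\<bar> \<le> C"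
    unfolding bounded_iff by (metis image_eqI real_norm_def)
  have "\<bar>f u\<bar> \<le> \<bar>C\<bar>" for u
    using C[of u] assms(2)[of u] by (cases "u \<in> {-1..1}") (force simp: abs_le_iff)+
  then show ?thesis by (intro exI[of _ "\<bar>C\<bar>"]) auto
qed

lemma K_bounded: "\<exists>C\<ge>0. \<forall>u. \<bar>K u\<bar> \<le> C \<and> \<bar>K' u\<bar> \<le> C"
proof -
  obtain C C' where "C \<ge> 0" "\<And>u. \<bar>K u\<bar> \<le> C" "C' \<ge> 0" "\<And>u. \<bar>K' u\<bar> \<le> C'"
    using compactly_supported_bounded[OF cont_K] compactly_supported_bounded[OF cont_K'] K_outside K'_outside
    by (metis less_imp_le)
  then show ?thesis by (intro exI[of _ "max C C'"]) (auto simp: le_max_iff_disj)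
qed

lemma integrable_K_mult:
  fixes f :: "real \<Rightarrow> real"
  assumes [measurable]: "f \<in> borel_measurable borel"
    and f: "\<And>u. u \<in> {-1..1} \<Longrightarrow> \<bar>f u\<bar> \<le> B"
  shows "integrable lborel (\<lambda>u. K u * f u)" "integrable lborel (\<lambda>u. K' u * f u)"
proof -
  obtain C where C: "C \<ge> 0" "\<And>u. \<bar>K u\<bar> \<le> C" "\<And>u. \<bar>K' u\<bar> \<le> C" using K_bounded by auto
  show "integrable lborel (\<lambda>u. K u * f u)"
    by (rule integrableI_bounded_set[where A="{-1..1}" and B="C * B"])
       (use f C in \<open>auto simp: abs_mult intro!: AE_I2 mult_mono K_outside\<close>)
  show "integrable lborel (\<lambda>u. K' u * f u)"
    by (rule integrableI_bounded_set[where A="{-1..1}" and B="C * B"])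
       (use f C in \<open>auto simp: abs_mult intro!: AE_I2 mult_mono K'_outside\<close>)
qed

text \<open>Convolution with the rescaled kernel: the mean of the kernel density estimator with bandwidth \<open>\<eta>\<close>
if \<open>f\<close> is the density of the observations.\<close>

definition smooth :: "real \<Rightarrow> (real \<Rightarrow> real) \<Rightarrow> real \<Rightarrow> real" where
  "smooth \<eta> f x = (LBINT u. K u * f (x - \<eta> * u))"

lemma smooth_measurable [measurable]:
  assumes [measurable]: "f \<in> borel_measurable borel"
  shows "smooth \<eta> f \<in> borel_measurable borel"
  unfolding smooth_def by measurable

lemma smooth_eq_convolution:
  assumes "\<eta> > 0"
  shows "(LBINT z. K ((x - z) / \<eta>) / \<eta> * f z) = smooth \<eta> f x"
  unfolding smooth_def
  by (subst lborel_integral_real_affine[where c="-\<eta>" and t=x])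
     (use assms in \<open>auto simp del: integral_mult_right_zero integral_divide_zero simp: integral_mult_right_zero[symmetric]\<close>)

lemma abs_smooth_le:
  assumes [measurable]: "f \<in> borel_measurable borel" and "\<And>x. \<bar>f x\<bar> \<le> B"
  shows "\<bar>smooth \<eta> f x\<bar> \<le> B * (LBINT u. \<bar>K u\<bar>)"
proof -
  have "\<bar>smooth \<eta> f x\<bar> \<le> (LBINT u. \<bar>K u * f (x - \<eta> * u)\<bar>)"
    unfolding smooth_def by (rule integral_abs_bound)
  also have "\<dots> \<le> (LBINT u. B * \<bar>K u\<bar>)"
  proof (rule integral_mono)
    show "integrable lborel (\<lambda>u. \<bar>K u * f (x - \<eta> * u)\<bar>)"
      by (rule integrable_abs, rule integrable_K_mult[where B=B]) (use assms in auto)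
    show "integrable lborel (\<lambda>u. B * \<bar>K u\<bar>)"
      using integrable_K_mult(1)[of "\<lambda>_. 1" 1] by auto
    show "\<bar>K u * f (x - \<eta> * u)\<bar> \<le> B * \<bar>K u\<bar>" for u
      using assms(2)[of "x - \<eta> * u"] by (simp add: abs_mult mult.commute[of B] mult_left_mono)
  qed
  also have "\<dots> = B * (LBINT u. \<bar>K u\<bar>)" by simp
  finally show ?thesis .
qed

text \<open>Integration by parts moves the derivative from the kernel to the density, so the mean of the
derivative of a kernel estimator is the smoothed derivative. The boundary terms vanish with the
kernel.\<close>

lemma smooth_derivative:
  fixes f f' :: "real \<Rightarrow> real"
  assumes \<eta>: "\<eta> > 0" and f: "\<And>x. (f has_real_derivative f' x) (at x)"
    and f': "continuous_on UNIV f'"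
  shows "(LBINT z. K' ((x - z) / \<eta>) / \<eta>\<^sup>2 * f z) = smooth \<eta> f' x"
proof -
  have cont_f: "continuous_on UNIV f" using f by (intro DERIV_continuous_on) auto
  have [measurable]: "f \<in> borel_measurable borel" "f' \<in> borel_measurable borel"
    using cont_f f' by (auto intro: borel_measurable_continuous_onI)
  define F where "F = (\<lambda>u. K u * f (x - \<eta> * u))"
  define F' where "F' = (\<lambda>u. K' u * f (x - \<eta> * u) - \<eta> * (K u * f' (x - \<eta> * u)))"
  have bdd: "\<exists>B. \<forall>u\<in>{-1..1}. \<bar>g (x - \<eta> * u)\<bar> \<le> B" if "continuous_on UNIV g" for g :: "real \<Rightarrow> real"
  proof -
    have "bounded ((\<lambda>u. g (x - \<eta> * u)) ` {-1..1})"
      by (intro compact_imp_bounded compact_continuous_image continuous_intros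
          continuous_on_compose2[OF that]) auto
    then show ?thesis unfolding bounded_iff by auto
  qed
  obtain B1 where B1: "\<And>u. u \<in> {-1..1} \<Longrightarrow> \<bar>f (x - \<eta> * u)\<bar> \<le> B1" using bdd[OF cont_f] by blast
  obtain B2 where B2: "\<And>u. u \<in> {-1..1} \<Longrightarrow> \<bar>f' (x - \<eta> * u)\<bar> \<le> B2" using bdd[OF f'] by blast
  have I1: "integrable lborel (\<lambda>u. K' u * f (x - \<eta> * u))"
    by (rule integrable_K_mult[where B=B1]) (use B1 in auto)
  have I2: "integrable lborel (\<lambda>u. K u * f' (x - \<eta> * u))"
    by (rule integrable_K_mult[where B=B2]) (use B2 in auto)
  have F: "(F has_real_derivative F' u) (at u)" for u
  proof -
    have "((\<lambda>u. f (x - \<eta> * u)) has_real_derivative f' (x - \<eta> * u) * (- \<eta>)) (at u)"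
      by (intro DERIV_chain'[where f = "\<lambda>u. x - \<eta> * u" and g = f] f) (auto intro!: derivative_eq_intros)
    from DERIV_mult[OF deriv_K this] show ?thesis by (simp add: F_def F'_def algebra_simps)
  qed
  have F'c: "continuous_on UNIV F'" unfolding F'_def
    by (intro continuous_intros cont_K cont_K' continuous_on_compose2[OF cont_f] continuous_on_compose2[OF f']) auto
  have "(LBINT u. F' u * indicator {-1..1} u) = F 1 - F (-1)"
    by (rule integral_FTC_Icc_real) (use F F'c in \<open>auto simp: continuous_on_eq_continuous_at\<close>)
  moreover have "F' u * indicator {-1..1} u = F' u" for u
    using K_outside[of u] K'_outside[of u] by (cases "u \<in> {-1..1}") (auto simp: F'_def indicator_def)
  ultimately have "(LBINT u. F' u) = 0" using K_outside by (simp add: F_def)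
  then have "(LBINT u. K' u * f (x - \<eta> * u)) = \<eta> * smooth \<eta> f' x"
    unfolding F'_def smooth_def using I1 I2 by simp
  moreover have "(LBINT z. K' ((x - z) / \<eta>) / \<eta>\<^sup>2 * f z)
      = (LBINT u. K' u * f (x - \<eta> * u)) / \<eta>"
    by (subst lborel_integral_real_affine[where c="-\<eta>" and t=x])
       (use \<eta> in \<open>auto simp: power2_eq_square divide_simps simp flip: integral_mult_right_zero integral_divide_zero\<close>)
  ultimately show ?thesis using \<eta> by simp
qed

lemma smooth_tendsto:
  fixes f :: "real \<Rightarrow> real"
  assumes K1: "(LBINT u. K u) = 1"
    and f: "continuous_on UNIV f" and B: "\<And>x. \<bar>f x\<bar> \<le> B" and h: "h \<longlonglongrightarrow> 0"
  shows "(\<lambda>n. smooth (h n) f x) \<longlonglongrightarrow> f x"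
proof -
  have [measurable]: "f \<in> borel_measurable borel" using f by (rule borel_measurable_continuous_onI)
  have "(\<lambda>n. LBINT u. K u * f (x - h n * u)) \<longlonglongrightarrow> (LBINT u. K u * f x)"
  proof (rule integral_dominated_convergence[where w = "\<lambda>u. B * \<bar>K u\<bar>"])
    show "integrable lborel (\<lambda>u. B * \<bar>K u\<bar>)"
      using integrable_K_mult(1)[of "\<lambda>_. 1" 1] by auto
    show "AE u in lborel. (\<lambda>n. K u * f (x - h n * u)) \<longlonglongrightarrow> K u * f x"
    proof (rule AE_I2)
      fix u
      have "(\<lambda>n. x - h n * u) \<longlonglongrightarrow> x - 0 * u" by (intro tendsto_intros h)
      then have "(\<lambda>n. f (x - h n * u)) \<longlonglongrightarrow> f (x - 0 * u)"
        using f by (intro isCont_tendsto_compose[of _ f]) (auto simp: continuous_on_eq_continuous_at)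
      then show "(\<lambda>n. K u * f (x - h n * u)) \<longlonglongrightarrow> K u * f x" by (intro tendsto_intros) simp
    qed
    show "AE u in lborel. norm (K u * f (x - h n * u)) \<le> B * \<bar>K u\<bar>" for n
      using B by (intro AE_I2) (simp add: abs_mult mult.commute[of B] mult_left_mono)
  qed measurable
  then show ?thesis using K1 by (simp add: smooth_def)
qed

lemma smooth_tendsto_L2:
  fixes f V :: "real \<Rightarrow> real"
  assumes K1: "(LBINT u. K u) = 1"
    and f: "continuous_on UNIV f" and B: "\<And>x. \<bar>f x\<bar> \<le> B" and h: "h \<longlonglongrightarrow> 0"
    and V: "integrable lborel V" "\<And>x. 0 \<le> V x"
  shows "(\<lambda>n. LBINT x. V x * (smooth (h n) f x - f x)\<^sup>2) \<longlonglongrightarrow> 0"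
proof -
  have [measurable]: "f \<in> borel_measurable borel" using f by (rule borel_measurable_continuous_onI)
  have [measurable]: "V \<in> borel_measurable borel" using V by (auto dest: borel_measurable_integrable)
  define C where "C = B * (LBINT u. \<bar>K u\<bar>) + B"
  have "(\<lambda>n. LBINT x. V x * (smooth (h n) f x - f x)\<^sup>2) \<longlonglongrightarrow> (LBINT x. V x * (f x - f x)\<^sup>2)"
  proof (rule integral_dominated_convergence[where w = "\<lambda>x. V x * C\<^sup>2"])
    show "AE x in lborel. (\<lambda>n. V x * (smooth (h n) f x - f x)\<^sup>2) \<longlonglongrightarrow> V x * (f x - f x)\<^sup>2"
      by (intro AE_I2 tendsto_intros smooth_tendsto[OF K1 f B h])
    show "AE x in lborel. norm (V x * (smooth (h n) f x - f x)\<^sup>2) \<le> V x * C\<^sup>2" for n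
    proof (rule AE_I2)
      fix x
      have "\<bar>smooth (h n) f x - f x\<bar> \<le> C"
        using order_trans[OF abs_triangle_ineq4 add_mono[OF abs_smooth_le B]] B unfolding C_def by simp
      then have "(smooth (h n) f x - f x)\<^sup>2 \<le> C\<^sup>2"
        by (metis abs_ge_zero power2_abs power_mono)
      then show "norm (V x * (smooth (h n) f x - f x)\<^sup>2) \<le> V x * C\<^sup>2"
        using V(2)[of x] by (simp add: abs_mult mult_left_mono)
    qed
  qed (use V in auto)
  then show ?thesis by simp
qed

text \<open>Because the kernel has mass one and vanishing moments of orders \<open>1,\<dots>,p\<close>, the Taylor polynomial of
order \<open>p\<close> reproduces \<open>D 0 x\<close> exactly and the bias is an average of remainders. Including the
order \<open>p\<close> is what replaces integrability of the \<open>p\<close>-th derivative by its modulus of continuity.\<close>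

lemma smooth_bias_L2:
  fixes D :: "nat \<Rightarrow> real \<Rightarrow> real"
  assumes D: "\<And>i x. i < p \<Longrightarrow> (D i has_real_derivative D (Suc i) x) (at x)" and p: "0 < p"
    and B: "\<And>x. \<bar>D 0 x\<bar> \<le> B"
    and L: "\<And>t. (\<integral>\<^sup>+ x. ennreal ((D p (x + t) - D p x)\<^sup>2) \<partial>lborel) \<le> ennreal (L\<^sup>2)"
    and K1: "(LBINT u. K u) = 1"
    and Kl: "\<And>l. l \<in> {1..p} \<Longrightarrow> (LBINT u. u ^ l * K u) = 0"
    and \<eta>: "\<eta> \<ge> 0"
  defines "C \<equiv> 2 * L\<^sup>2 * (LBINT u. (K u)\<^sup>2)"
  shows "integrable lborel (\<lambda>x. (smooth \<eta> (D 0) x - D 0 x)\<^sup>2)"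
    and "(LBINT x. (smooth \<eta> (D 0) x - D 0 x)\<^sup>2) \<le> C * \<eta> ^ (2 * p)"
proof -
  have Dm [measurable]: "D i \<in> borel_measurable borel" if "i \<le> p" for i
  proof (cases "i = p")
    case True
    then show ?thesis
      using borel_measurable_has_derivative_real[of "D (p - 1)" "D p"] D[of "p - 1"] p by simp
  next
    case False
    then show ?thesis
      using D[of i] that by (intro borel_measurable_continuous_onI DERIV_continuous_on) auto
  qed
  have D0m [measurable]: "D 0 \<in> borel_measurable borel" by (rule Dm) simp
  define rem where "rem = (\<lambda>x c. D 0 (x + c) - (\<Sum>i\<le>p. c ^ i / fact i * D i x))"
  have rem_m [measurable]: "case_prod (\<lambda>x u. rem x (- \<eta> * u)) \<in> borel_measurable (borel \<Otimes>\<^sub>M borel)"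
    unfolding rem_def by measurable
  have intK: "integrable lborel (\<lambda>u. K u * u ^ i)" for i
    by (rule integrable_K_mult[where B=1]) (auto simp: power_abs intro!: power_le_one)
  have bias: "smooth \<eta> (D 0) x - D 0 x = (LBINT u. K u * rem x (- \<eta> * u))" for x
  proof -
    have 1: "integrable lborel (\<lambda>u. K u * D 0 (x - \<eta> * u))"
      by (rule integrable_K_mult[where B=B]) (use B in auto)
    have 2: "integrable lborel (\<lambda>u. \<Sum>i\<le>p. (- \<eta>) ^ i / fact i * D i x * (K u * u ^ i))"
      using intK by auto
    have "(LBINT u. K u * rem x (- \<eta> * u))
        = (LBINT u. K u * D 0 (x - \<eta> * u) - (\<Sum>i\<le>p. (- \<eta>) ^ i / fact i * D i x * (K u * u ^ i)))"
      by (intro Bochner_Integration.integral_cong refl)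
         (simp only: rem_def power_mult_distrib right_diff_distrib sum_distrib_left, simp add: mult_ac)
    also have "\<dots> = smooth \<eta> (D 0) x - (LBINT u. (\<Sum>i\<le>p. (- \<eta>) ^ i / fact i * D i x * (K u * u ^ i)))"
      unfolding smooth_def using 1 2 by (rule Bochner_Integration.integral_diff)
    also have "(LBINT u. (\<Sum>i\<le>p. (- \<eta>) ^ i / fact i * D i x * (K u * u ^ i)))
        = (\<Sum>i\<le>p. (- \<eta>) ^ i / fact i * D i x * (LBINT u. K u * u ^ i))"
      using intK by (simp add: Bochner_Integration.integral_sum)
    also have "\<dots> = (\<Sum>i\<le>p. if i = 0 then D 0 x else 0)"
      using K1 Kl by (intro sum.cong refl) (auto simp: mult.commute Suc_le_eq)
    also have "\<dots> = D 0 x" by simp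
    finally show ?thesis by simp
  qed
  have intK2: "integrable lborel (\<lambda>u. (K u)\<^sup>2)"
  proof -
    obtain C where "\<And>u. \<bar>K u\<bar> \<le> C" using K_bounded by auto
    then show ?thesis unfolding power2_eq_square by (intro integrable_K_mult[where B=C]) auto
  qed
  define Q where "Q = (LBINT u. (K u)\<^sup>2)"
  have Q: "(\<integral>\<^sup>+ u. ennreal ((K u)\<^sup>2) \<partial>lborel) = ennreal Q" "0 \<le> Q"
    unfolding Q_def by (auto intro!: nn_integral_eq_integral intK2)
  have sq: "ennreal ((smooth \<eta> (D 0) x - D 0 x)\<^sup>2)
      \<le> ennreal Q * (\<integral>\<^sup>+ u. ennreal ((rem x (- \<eta> * u))\<^sup>2) * indicator {-1..1} u \<partial>lborel)" for x
  proof -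
    have "ennreal ((smooth \<eta> (D 0) x - D 0 x)\<^sup>2) = (ennreal \<bar>LBINT u. K u * rem x (- \<eta> * u)\<bar>)\<^sup>2"
      by (simp add: bias ennreal_power)
    also have "\<dots> \<le> (\<integral>\<^sup>+ u. ennreal \<bar>K u * rem x (- \<eta> * u)\<bar> \<partial>lborel)\<^sup>2"
    proof (intro power_mono)
      show "ennreal \<bar>LBINT u. K u * rem x (- \<eta> * u)\<bar> \<le> (\<integral>\<^sup>+ u. ennreal \<bar>K u * rem x (- \<eta> * u)\<bar> \<partial>lborel)"
        using integral_norm_bound_ennreal[of lborel "\<lambda>u. K u * rem x (- \<eta> * u)"]
        by (cases "integrable lborel (\<lambda>u. K u * rem x (- \<eta> * u))") (auto simp: not_integrable_integral_eq)
    qed auto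
    also have "(\<integral>\<^sup>+ u. ennreal \<bar>K u * rem x (- \<eta> * u)\<bar> \<partial>lborel)
        = (\<integral>\<^sup>+ u. ennreal \<bar>K u\<bar> * (ennreal \<bar>rem x (- \<eta> * u)\<bar> * indicator {-1..1} u) \<partial>lborel)"
      using K_outside by (intro nn_integral_cong) (auto simp: indicator_def abs_mult ennreal_mult[symmetric])
    also have "\<dots>\<^sup>2 \<le> (\<integral>\<^sup>+ u. (ennreal \<bar>K u\<bar>)\<^sup>2 \<partial>lborel) * (\<integral>\<^sup>+ u. (ennreal \<bar>rem x (- \<eta> * u)\<bar> * indicator {-1..1} u)\<^sup>2 \<partial>lborel)"
      by (rule Cauchy_Schwarz_nn_integral) measurable
    also have "(\<integral>\<^sup>+ u. (ennreal \<bar>K u\<bar>)\<^sup>2 \<partial>lborel) = ennreal Q" using Q by (simp add: ennreal_power)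
    also have "(\<integral>\<^sup>+ u. (ennreal \<bar>rem x (- \<eta> * u)\<bar> * indicator {-1..1} u)\<^sup>2 \<partial>lborel)
        = (\<integral>\<^sup>+ u. ennreal ((rem x (- \<eta> * u))\<^sup>2) * indicator {-1..1} u \<partial>lborel)"
      by (intro nn_integral_cong) (auto simp: indicator_def ennreal_power)
    finally show ?thesis .
  qed
  have "(\<integral>\<^sup>+ x. ennreal ((smooth \<eta> (D 0) x - D 0 x)\<^sup>2) \<partial>lborel)
     \<le> (\<integral>\<^sup>+ x. ennreal Q * (\<integral>\<^sup>+ u. ennreal ((rem x (- \<eta> * u))\<^sup>2) * indicator {-1..1} u \<partial>lborel) \<partial>lborel)"
    by (rule nn_integral_mono) (rule sq)
  also have "\<dots> = ennreal Q * (\<integral>\<^sup>+ x. (\<integral>\<^sup>+ u. ennreal ((rem x (- \<eta> * u))\<^sup>2) * indicator {-1..1} u \<partial>lborel) \<partial>lborel)"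
    by (rule nn_integral_cmult) measurable
  also have "(\<integral>\<^sup>+ x. (\<integral>\<^sup>+ u. ennreal ((rem x (- \<eta> * u))\<^sup>2) * indicator {-1..1} u \<partial>lborel) \<partial>lborel)
      = (\<integral>\<^sup>+ u. (\<integral>\<^sup>+ x. ennreal ((rem x (- \<eta> * u))\<^sup>2) * indicator {-1..1} u \<partial>lborel) \<partial>lborel)"
    by (rule lborel_pair.Fubini') measurable
  also have "\<dots> = (\<integral>\<^sup>+ u. (\<integral>\<^sup>+ x. ennreal ((rem x (- \<eta> * u))\<^sup>2) \<partial>lborel) * indicator {-1..1} u \<partial>lborel)"
    by (intro nn_integral_cong nn_integral_multc) measurable
  also have "\<dots> \<le> (\<integral>\<^sup>+ u. ennreal ((\<eta> ^ p * L)\<^sup>2) * indicator {-1..1} (u::real) \<partial>lborel)"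
  proof (intro nn_integral_mono)
    fix u :: real
    have "(\<integral>\<^sup>+ x. ennreal ((rem x (- \<eta> * u))\<^sup>2) \<partial>lborel) \<le> ennreal ((\<eta> ^ p * L)\<^sup>2)" if "u \<in> {-1..1}"
    proof -
      have "(\<integral>\<^sup>+ x. ennreal ((rem x (- \<eta> * u))\<^sup>2) \<partial>lborel) \<le> ennreal ((\<bar>- \<eta> * u\<bar> ^ p * L)\<^sup>2)"
        unfolding rem_def by (rule taylor_remainder_L2) (use D p L in auto)
      also have "\<dots> \<le> ennreal ((\<eta> ^ p * L)\<^sup>2)"
      proof (intro ennreal_leI)
        have "\<bar>- \<eta> * u\<bar> \<le> \<eta>" using that \<eta> by (auto simp: abs_mult intro!: mult_left_le)
        then have "\<bar>- \<eta> * u\<bar> ^ p \<le> \<eta> ^ p" by (rule power_mono) auto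
        then have "(\<bar>- \<eta> * u\<bar> ^ p)\<^sup>2 \<le> (\<eta> ^ p)\<^sup>2" by (rule power_mono) simp
        then show "(\<bar>- \<eta> * u\<bar> ^ p * L)\<^sup>2 \<le> (\<eta> ^ p * L)\<^sup>2"
          unfolding power_mult_distrib[of _ L] by (rule mult_right_mono) simp
      qed
      finally show ?thesis .
    qed
    then show "(\<integral>\<^sup>+ x. ennreal ((rem x (- \<eta> * u))\<^sup>2) \<partial>lborel) * indicator {-1..1} u
        \<le> ennreal ((\<eta> ^ p * L)\<^sup>2) * indicator {-1..1} u" by (auto simp: indicator_def)
  qed
  also have "\<dots> = ennreal ((\<eta> ^ p * L)\<^sup>2) * 2" by (subst nn_integral_cmult_indicator) auto
  finally have "(\<integral>\<^sup>+ x. ennreal ((smooth \<eta> (D 0) x - D 0 x)\<^sup>2) \<partial>lborel)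
      \<le> ennreal Q * (ennreal ((\<eta> ^ p * L)\<^sup>2) * 2)" by (simp add: mult_left_mono)
  also have "\<dots> = ennreal Q * (ennreal ((\<eta> ^ p * L)\<^sup>2) * ennreal 2)" by simp
  also have "\<dots> = ennreal (Q * ((\<eta> ^ p * L)\<^sup>2 * 2))"
    using Q(2) by (simp only: ennreal_mult[symmetric] zero_le_power2 zero_le_mult_iff zero_le_numeral)
       (simp add: ennreal_mult)
  also have "Q * ((\<eta> ^ p * L)\<^sup>2 * 2) = C * \<eta> ^ (2 * p)"
    by (simp add: C_def Q_def power_mult_distrib power_mult[symmetric] mult.commute)
  finally have fin: "(\<integral>\<^sup>+ x. ennreal ((smooth \<eta> (D 0) x - D 0 x)\<^sup>2) \<partial>lborel) \<le> ennreal (C * \<eta> ^ (2 * p))" .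
  have C0: "0 \<le> C" unfolding C_def by (auto intro!: mult_nonneg_nonneg integral_nonneg_AE)
  show I: "integrable lborel (\<lambda>x. (smooth \<eta> (D 0) x - D 0 x)\<^sup>2)"
    by (rule integrableI_nonneg) (use fin in \<open>auto simp: order_le_less_trans\<close>)
  show "(LBINT x. (smooth \<eta> (D 0) x - D 0 x)\<^sup>2) \<le> C * \<eta> ^ (2 * p)"
    using fin nn_integral_eq_integral[OF I] C0 \<eta> by (simp add: ennreal_le_iff)
qed

end

section \<open>Mean square errors of averages over a mixing sample\<close>

text \<open>The form in which Fubini's theorem is justified below: a bound by an integrable function of \<open>x\<close>
alone suffices on a probability space.\<close>

lemma (in prob_space) integrable_pair_dominated:
  fixes G :: "'a \<Rightarrow> real \<Rightarrow> real"
  assumes [measurable]: "case_prod G \<in> borel_measurable (M \<Otimes>\<^sub>M lborel)"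
    and v: "integrable lborel v" and le: "\<And>\<omega> x. \<bar>G \<omega> x\<bar> \<le> v x"
  shows "integrable (M \<Otimes>\<^sub>M lborel) (case_prod G)"
  unfolding integrable_iff_bounded
proof
  have v0: "0 \<le> v x" for x using le[of undefined x] by (meson abs_ge_zero order_trans)
  have "(\<integral>\<^sup>+ y. norm (case_prod G y) \<partial>(M \<Otimes>\<^sub>M lborel)) = (\<integral>\<^sup>+ \<omega>. \<integral>\<^sup>+ x. norm (G \<omega> x) \<partial>lborel \<partial>M)"
    by (subst lborel.nn_integral_fst[symmetric]) auto
  also have "\<dots> \<le> (\<integral>\<^sup>+ \<omega>. \<integral>\<^sup>+ x. v x \<partial>lborel \<partial>M)"
    by (intro nn_integral_mono ennreal_leI) (use le in auto)
  also have "\<dots> = ennreal (LBINT x. v x)"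
    using v v0 by (simp add: nn_integral_eq_integral emeasure_space_1)
  finally show "(\<integral>\<^sup>+ y. norm (case_prod G y) \<partial>(M \<Otimes>\<^sub>M lborel)) < \<infinity>"
    by (simp add: order_le_less_trans)
qed fact

lemma power2_sum_le: "(x + y)\<^sup>2 \<le> 2 * x\<^sup>2 + 2 * y\<^sup>2" for x y :: real
  using zero_le_power2[of "x - y"] by (simp add: power2_eq_square algebra_simps)

lemma power2_mono_abs: "\<bar>x\<bar> \<le> y \<Longrightarrow> x\<^sup>2 \<le> y\<^sup>2" for x y :: real
  using power_mono[of "\<bar>x\<bar>" y 2] by simp

locale stationary_sample = prob_space M for M :: "'a measure" +
  fixes Z :: "nat \<Rightarrow> 'a \<Rightarrow> real" and f :: "real \<Rightarrow> real"
  assumes Z_meas [measurable]: "\<And>j. Z j \<in> borel_measurable M"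
    and summable_mixing: "summable (mixing_coeff M Z)"
    and marginal: "\<And>j. distributed M lborel (Z j) f"
    and f_nonneg: "\<And>x. 0 \<le> f x"
begin

definition "mixing_total = suminf (mixing_coeff M Z)"

lemma mean_eq:
  fixes g :: "real \<Rightarrow> real"
  assumes [measurable]: "g \<in> borel_measurable borel"
  shows "(\<integral>\<omega>. g (Z j \<omega>) \<partial>M) = (LBINT z. g z * f z)"
  using distributed_integral[OF marginal, of g j] f_nonneg by (simp add: mult.commute)

lemma variance_mean:
  fixes g :: "real \<Rightarrow> real"
  assumes [measurable]: "g \<in> borel_measurable borel" and "\<And>z. \<bar>g z\<bar> \<le> C"
  shows "(\<integral>\<omega>. ((\<Sum>j\<le>n. g (Z j \<omega>)) / real (n + 1) - (LBINT z. g z * f z))\<^sup>2 \<partial>M)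
           \<le> 8 * C\<^sup>2 * mixing_total / real (n + 1)"
  unfolding mixing_total_def
  by (rule variance_mean_mixing[OF prob_space_axioms Z_meas summable_mixing]) (use assms mean_eq in auto)

lemma abs_mean_le:
  assumes "\<And>z. \<bar>g z\<bar> \<le> (C::real)"
  shows "\<bar>(\<Sum>j\<le>n. g (Z j \<omega>)) / real (n + 1)\<bar> \<le> C"
proof -
  have "\<bar>\<Sum>j\<le>n. g (Z j \<omega>)\<bar> \<le> (\<Sum>j\<le>n. C)"
    using assms by (intro order_trans[OF sum_abs] sum_mono)
  then show ?thesis by (simp add: field_simps)
qed

text \<open>Bias and variance of a random function \<open>x \<Rightarrow> (\<Sum>j\<le>n. g x (Z j)) / (n + 1)\<close> as an estimator of \<open>d\<close>, in
weighted mean square. The variance is bounded separately for every \<open>x\<close> and then integrated.\<close>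

lemma weighted_mean_square_error:
  fixes g :: "real \<Rightarrow> real \<Rightarrow> real" and V d m :: "real \<Rightarrow> real"
  assumes g [measurable]: "case_prod g \<in> borel_measurable (borel \<Otimes>\<^sub>M borel)"
    and gC: "\<And>x z. \<bar>g x z\<bar> \<le> C"
    and m: "\<And>x. (LBINT z. g x z * f z) = m x"
    and d [measurable]: "d \<in> borel_measurable borel" and dB: "\<And>x. \<bar>d x\<bar> \<le> B"
    and V: "integrable lborel V" "\<And>x. 0 \<le> V x"
  defines "E \<equiv> (\<lambda>n \<omega> x. (\<Sum>j\<le>n. g x (Z j \<omega>)) / real (n + 1) - d x)"
  shows "integrable M (\<lambda>\<omega>. LBINT x. V x * (E n \<omega> x)\<^sup>2)"
    and "(\<integral>\<omega>. (LBINT x. V x * (E n \<omega> x)\<^sup>2) \<partial>M)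
           \<le> 16 * C\<^sup>2 * mixing_total / real (n + 1) * (LBINT x. V x)
             + 2 * (LBINT x. V x * (m x - d x)\<^sup>2)"
proof -
  interpret pair_sigma_finite M "lborel :: real measure" ..
  have Vm [measurable]: "V \<in> borel_measurable borel" using V by (auto dest: borel_measurable_integrable)
  have Em [measurable]: "(\<lambda>(\<omega>, x). E n \<omega> x) \<in> borel_measurable (M \<Otimes>\<^sub>M borel)"
    unfolding E_def by measurable
  have mm [measurable]: "m \<in> borel_measurable borel"
  proof -
    have [measurable]: "f \<in> borel_measurable borel"
      using distributed_real_measurable[OF _ marginal[of 0]] f_nonneg by simp
    have "(\<lambda>x. LBINT z. g x z * f z) \<in> borel_measurable borel" by measurable
    then show ?thesis using m by simp
  qed
  have EB: "\<bar>E n \<omega> x\<bar> \<le> C + B" for \<omega> x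
    unfolding E_def by (rule order_trans[OF abs_triangle_ineq4 add_mono[OF abs_mean_le[OF gC] dB]])
  have EB2: "(E n \<omega> x)\<^sup>2 \<le> (C + B)\<^sup>2" for \<omega> x
    using EB by (rule power2_mono_abs)
  have mC: "\<bar>m x\<bar> \<le> C" for x
  proof -
    have "m x = (\<integral>\<omega>. g x (Z 0 \<omega>) \<partial>M)" using m mean_eq[of "g x" 0] by simp
    also have "\<bar>\<dots>\<bar> \<le> (\<integral>\<omega>. \<bar>g x (Z 0 \<omega>)\<bar> \<partial>M)" by (rule integral_abs_bound)
    also have "\<dots> \<le> (\<integral>\<omega>. C \<partial>M)"
      by (rule integral_mono) (use gC in \<open>auto intro!: integrable_const_bound[where B=C]\<close>)
    finally show ?thesis by (simp add: prob_space)
  qed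
  have mdB: "(m x - d x)\<^sup>2 \<le> (C + B)\<^sup>2" for x
  proof -
    have "\<bar>m x - d x\<bar> \<le> C + B" using mC[of x] dB[of x] by linarith
    then show ?thesis by (rule power2_mono_abs)
  qed
  have int: "integrable (M \<Otimes>\<^sub>M lborel) (case_prod (\<lambda>\<omega> x. V x * (E n \<omega> x)\<^sup>2))"
    by (rule integrable_pair_dominated[where v = "\<lambda>x. V x * (C + B)\<^sup>2"])
       (use V EB2 in \<open>auto simp: abs_mult intro!: mult_left_mono\<close>)
  show "integrable M (\<lambda>\<omega>. LBINT x. V x * (E n \<omega> x)\<^sup>2)"
    using integrable_fst[OF int] by simp
  have "(\<integral>\<omega>. (LBINT x. V x * (E n \<omega> x)\<^sup>2) \<partial>M) = (LBINT x. (\<integral>\<omega>. V x * (E n \<omega> x)\<^sup>2 \<partial>M))"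
    using Fubini_integral[OF int] by simp
  also have "\<dots> \<le> (LBINT x. V x * (16 * C\<^sup>2 * mixing_total / real (n + 1)) + 2 * (V x * (m x - d x)\<^sup>2))"
  proof (rule integral_mono)
    show "integrable lborel (\<lambda>x. \<integral>\<omega>. V x * (E n \<omega> x)\<^sup>2 \<partial>M)"
      using integrable_snd[OF int] by simp
    have "integrable lborel (\<lambda>x. V x * (m x - d x)\<^sup>2)"
      by (rule Bochner_Integration.integrable_bound[where f = "\<lambda>x. V x * (C + B)\<^sup>2"])
         (use V mdB in \<open>auto simp: abs_mult intro!: mult_left_mono\<close>)
    then show "integrable lborel (\<lambda>x. V x * (16 * C\<^sup>2 * mixing_total / real (n + 1)) + 2 * (V x * (m x - d x)\<^sup>2))"
      using V by simp
    fix x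
    define A where "A = (\<lambda>\<omega>. (\<Sum>j\<le>n. g x (Z j \<omega>)) / real (n + 1) - m x)"
    have Am [measurable]: "A \<in> borel_measurable M" unfolding A_def by measurable
    have "\<bar>A \<omega>\<bar> \<le> C + C" for \<omega>
      unfolding A_def by (rule order_trans[OF abs_triangle_ineq4 add_mono[OF abs_mean_le[OF gC] mC]])
    then have "(A \<omega>)\<^sup>2 \<le> (C + C)\<^sup>2" for \<omega> by (rule power2_mono_abs)
    then have intA: "integrable M (\<lambda>\<omega>. (A \<omega>)\<^sup>2)"
      by (intro integrable_const_bound[where B="(C + C)\<^sup>2"]) auto
    have varA: "(\<integral>\<omega>. (A \<omega>)\<^sup>2 \<partial>M) \<le> 8 * C\<^sup>2 * mixing_total / real (n + 1)"
      using variance_mean[of "g x" C n] gC m unfolding A_def by simp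
    have "(\<integral>\<omega>. (E n \<omega> x)\<^sup>2 \<partial>M) \<le> (\<integral>\<omega>. 2 * (A \<omega>)\<^sup>2 + 2 * (m x - d x)\<^sup>2 \<partial>M)"
    proof (rule integral_mono)
      show "integrable M (\<lambda>\<omega>. (E n \<omega> x)\<^sup>2)"
        by (rule integrable_const_bound[where B="(C + B)\<^sup>2"]) (use EB2 in auto)
      show "integrable M (\<lambda>\<omega>. 2 * (A \<omega>)\<^sup>2 + 2 * (m x - d x)\<^sup>2)" using intA by simp
      fix \<omega>
      have "E n \<omega> x = A \<omega> + (m x - d x)" by (simp add: E_def A_def)
      then show "(E n \<omega> x)\<^sup>2 \<le> 2 * (A \<omega>)\<^sup>2 + 2 * (m x - d x)\<^sup>2"
        by (simp only: power2_sum_le)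
    qed
    also have "\<dots> = 2 * (\<integral>\<omega>. (A \<omega>)\<^sup>2 \<partial>M) + 2 * (m x - d x)\<^sup>2"
      using intA by (simp add: prob_space)
    also have "\<dots> \<le> 16 * C\<^sup>2 * mixing_total / real (n + 1) + 2 * (m x - d x)\<^sup>2"
      using varA by simp
    finally have "V x * (\<integral>\<omega>. (E n \<omega> x)\<^sup>2 \<partial>M)
        \<le> V x * (16 * C\<^sup>2 * mixing_total / real (n + 1) + 2 * (m x - d x)\<^sup>2)"
      using V(2) by (rule mult_left_mono)
    then show "(\<integral>\<omega>. V x * (E n \<omega> x)\<^sup>2 \<partial>M) \<le> V x * (16 * C\<^sup>2 * mixing_total / real (n + 1)) + 2 * (V x * (m x - d x)\<^sup>2)"
      by (simp add: algebra_simps)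
  qed
  also have "\<dots> = 16 * C\<^sup>2 * mixing_total / real (n + 1) * (LBINT x. V x)
      + 2 * (LBINT x. V x * (m x - d x)\<^sup>2)"
  proof -
    have "integrable lborel (\<lambda>x. V x * (m x - d x)\<^sup>2)"
      by (rule Bochner_Integration.integrable_bound[where f = "\<lambda>x. V x * (C + B)\<^sup>2"])
         (use V mdB in \<open>auto simp: abs_mult intro!: mult_left_mono\<close>)
    then show ?thesis using V by (simp add: mult.commute)
  qed
  finally show "(\<integral>\<omega>. (LBINT x. V x * (E n \<omega> x)\<^sup>2) \<partial>M)
           \<le> 16 * C\<^sup>2 * mixing_total / real (n + 1) * (LBINT x. V x)
             + 2 * (LBINT x. V x * (m x - d x)\<^sup>2)" .
qed

text \<open>A linear functional of the random function is itself the average of the functional \<open>\<psi>\<close> of \<open>g\<close>. What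
counts for its variance is the bound \<open>G\<close> of \<open>\<psi>\<close> and no longer the bound of \<open>g\<close>; for kernel
estimators \<open>G\<close> does not grow as the bandwidth shrinks, which gives the parametric rate.\<close>

lemma linear_functional_error:
  fixes g :: "real \<Rightarrow> real \<Rightarrow> real" and \<phi> d m :: "real \<Rightarrow> real"
  assumes g [measurable]: "case_prod g \<in> borel_measurable (borel \<Otimes>\<^sub>M borel)"
    and gC: "\<And>x z. \<bar>g x z\<bar> \<le> C"
    and m: "\<And>x. (LBINT z. g x z * f z) = m x"
    and d [measurable]: "d \<in> borel_measurable borel" and dB: "\<And>x. \<bar>d x\<bar> \<le> B"
    and \<phi>: "integrable lborel \<phi>"
    and G: "\<And>z. \<bar>LBINT x. \<phi> x * g x z\<bar> \<le> G"
  defines "E \<equiv> (\<lambda>n \<omega> x. (\<Sum>j\<le>n. g x (Z j \<omega>)) / real (n + 1) - d x)"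
  shows "(\<lambda>\<omega>. LBINT x. \<phi> x * E n \<omega> x) \<in> borel_measurable M"
    and "integrable M (\<lambda>\<omega>. (LBINT x. \<phi> x * E n \<omega> x)\<^sup>2)"
    and "(\<integral>\<omega>. (LBINT x. \<phi> x * E n \<omega> x)\<^sup>2 \<partial>M)
           \<le> 16 * G\<^sup>2 * mixing_total / real (n + 1) + 2 * (LBINT x. \<phi> x * (m x - d x))\<^sup>2"
proof -
  interpret pair_sigma_finite M "lborel :: real measure" ..
  have \<phi>m [measurable]: "\<phi> \<in> borel_measurable borel" using \<phi> by (auto dest: borel_measurable_integrable)
  have Em [measurable]: "(\<lambda>(\<omega>, x). E n \<omega> x) \<in> borel_measurable (M \<Otimes>\<^sub>M borel)"
    unfolding E_def by measurable
  show meas [measurable]: "(\<lambda>\<omega>. LBINT x. \<phi> x * E n \<omega> x) \<in> borel_measurable M" by measurable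
  define \<psi> where "\<psi> = (\<lambda>z. LBINT x. \<phi> x * g x z)"
  have \<psi>m [measurable]: "\<psi> \<in> borel_measurable borel" unfolding \<psi>_def by measurable
  have int_\<phi>g: "integrable lborel (\<lambda>x. \<phi> x * g x z)" for z
    by (rule Bochner_Integration.integrable_bound[where f = "\<lambda>x. \<phi> x * C"])
       (use \<phi> gC in \<open>auto simp: abs_mult intro!: mult_left_mono order_trans[OF gC abs_ge_self]\<close>)
  have int_\<phi>d: "integrable lborel (\<lambda>x. \<phi> x * d x)"
    by (rule Bochner_Integration.integrable_bound[where f = "\<lambda>x. \<phi> x * B"])
       (use \<phi> dB in \<open>auto simp: abs_mult intro!: mult_left_mono order_trans[OF dB abs_ge_self]\<close>)
  have int: "integrable (M \<Otimes>\<^sub>M lborel) (case_prod (\<lambda>\<omega> x. \<phi> x * g x (Z 0 \<omega>)))"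
    by (rule integrable_pair_dominated[where v = "\<lambda>x. \<bar>\<phi> x\<bar> * C"])
       (use \<phi> gC in \<open>auto simp: abs_mult intro!: mult_left_mono\<close>)
  have mean_\<psi>: "(LBINT z. \<psi> z * f z) = (LBINT x. \<phi> x * m x)"
  proof -
    have "(LBINT z. \<psi> z * f z) = (\<integral>\<omega>. \<psi> (Z 0 \<omega>) \<partial>M)" by (simp add: mean_eq)
    also have "\<dots> = (LBINT x. (\<integral>\<omega>. \<phi> x * g x (Z 0 \<omega>) \<partial>M))"
      unfolding \<psi>_def using Fubini_integral[OF int] by simp
    also have "\<dots> = (LBINT x. \<phi> x * m x)" by (simp add: mean_eq m)
    finally show ?thesis .
  qed
  have int_\<phi>m: "integrable lborel (\<lambda>x. \<phi> x * m x)"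
    using integrable_snd[OF int] by (simp add: mean_eq m)
  define b where "b = (LBINT x. \<phi> x * (m x - d x))"
  define A where "A = (\<lambda>\<omega>. (\<Sum>j\<le>n. \<psi> (Z j \<omega>)) / real (n + 1) - (LBINT z. \<psi> z * f z))"
  have eq: "(LBINT x. \<phi> x * E n \<omega> x) = A \<omega> + b" for \<omega>
  proof -
    have "(LBINT x. \<phi> x * E n \<omega> x)
        = (LBINT x. (\<Sum>j\<le>n. \<phi> x * g x (Z j \<omega>)) / real (n + 1) - \<phi> x * d x)"
      by (simp add: E_def right_diff_distrib sum_distrib_left)
    also have "\<dots> = (LBINT x. (\<Sum>j\<le>n. \<phi> x * g x (Z j \<omega>)) / real (n + 1)) - (LBINT x. \<phi> x * d x)"
      by (rule Bochner_Integration.integral_diff) (use int_\<phi>d int_\<phi>g in auto)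
    also have "(LBINT x. (\<Sum>j\<le>n. \<phi> x * g x (Z j \<omega>)) / real (n + 1)) = (\<Sum>j\<le>n. \<psi> (Z j \<omega>)) / real (n + 1)"
      using int_\<phi>g by (simp add: Bochner_Integration.integral_sum \<psi>_def)
    finally show ?thesis using int_\<phi>d int_\<phi>m
      by (simp add: A_def b_def mean_\<psi> right_diff_distrib)
  qed
  have Am [measurable]: "A \<in> borel_measurable M" unfolding A_def by measurable
  have \<psi>G: "\<bar>\<psi> z\<bar> \<le> G" for z unfolding \<psi>_def by (rule G)
  have AB: "\<bar>A \<omega>\<bar> \<le> G + \<bar>LBINT z. \<psi> z * f z\<bar>" for \<omega>
    unfolding A_def by (rule order_trans[OF abs_triangle_ineq4 add_right_mono[OF abs_mean_le[OF \<psi>G]]])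
  have intA: "integrable M (\<lambda>\<omega>. (A \<omega>)\<^sup>2)"
    by (rule integrable_const_bound[where B="(G + \<bar>LBINT z. \<psi> z * f z\<bar>)\<^sup>2"])
       (use AB in \<open>auto intro!: power2_mono_abs\<close>)
  show intAb: "integrable M (\<lambda>\<omega>. (LBINT x. \<phi> x * E n \<omega> x)\<^sup>2)"
    unfolding eq
    by (rule Bochner_Integration.integrable_bound[where f = "\<lambda>\<omega>. 2 * (A \<omega>)\<^sup>2 + 2 * b\<^sup>2"])
       (use intA power2_sum_le in auto)
  have "(\<integral>\<omega>. (LBINT x. \<phi> x * E n \<omega> x)\<^sup>2 \<partial>M) \<le> (\<integral>\<omega>. 2 * (A \<omega>)\<^sup>2 + 2 * b\<^sup>2 \<partial>M)"
    by (rule integral_mono[OF intAb]) (use intA power2_sum_le in \<open>auto simp: eq\<close>)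
  also have "\<dots> = 2 * (\<integral>\<omega>. (A \<omega>)\<^sup>2 \<partial>M) + 2 * b\<^sup>2"
    using intA by (simp add: prob_space)
  also have "\<dots> \<le> 16 * G\<^sup>2 * mixing_total / real (n + 1) + 2 * b\<^sup>2"
    using variance_mean[of \<psi> G n, OF \<psi>m \<psi>G] unfolding A_def by simp
  finally show "(\<integral>\<omega>. (LBINT x. \<phi> x * E n \<omega> x)\<^sup>2 \<partial>M)
           \<le> 16 * G\<^sup>2 * mixing_total / real (n + 1) + 2 * (LBINT x. \<phi> x * (m x - d x))\<^sup>2"
    unfolding b_def .
qed

end

section \<open>Rates for the kernel density estimator and its derivative\<close>

locale kernel_density_estimation = stationary_sample M Z f + smoothing_kernel K K'
  for M :: "'a measure" and Z f K K' +
  fixes f' :: "real \<Rightarrow> real" and D :: "nat \<Rightarrow> real \<Rightarrow> real" and p :: nat and P L :: real and h :: "nat \<Rightarrow> real"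
  assumes K_integral: "(LBINT u. K u) = 1"
    and K_moments: "\<And>l. l \<in> {1..p} \<Longrightarrow> (LBINT u. u ^ l * K u) = 0"
    and f: "\<And>x. (f has_real_derivative f' x) (at x)" "continuous_on UNIV f'"
      "\<And>x. \<bar>f x\<bar> \<le> P" "\<And>x. \<bar>f' x\<bar> \<le> P"
    and D0: "D 0 = f" and p_pos: "0 < p"
    and D: "\<And>i x. i < p \<Longrightarrow> (D i has_real_derivative D (Suc i) x) (at x)"
    and L: "\<And>t. (\<integral>\<^sup>+ x. ennreal ((D p (x + t) - D p x)\<^sup>2) \<partial>lborel) \<le> ennreal (L\<^sup>2)"
    and h_pos: "\<And>n. 0 < h n" and h_null: "h \<longlonglongrightarrow> 0"
    and h_slow: "filterlim (\<lambda>n. real n * h n ^ 4) at_top sequentially"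
    and h_fast: "\<exists>A. \<forall>\<^sub>F n in sequentially. real n * h n ^ (2 * p) \<le> A"
begin

definition g where "g n x z = K ((x - z) / h n) / h n"
definition g' where "g' n x z = K' ((x - z) / h n) / (h n)\<^sup>2"
definition kde where "kde n \<omega> x = (\<Sum>j\<le>n. g n x (Z j \<omega>)) / real (n + 1)"
definition kde' where "kde' n \<omega> x = (\<Sum>j\<le>n. g' n x (Z j \<omega>)) / real (n + 1)"

lemma kernel_estimator_eq_kde: "kernel_estimator K h Z n \<omega> = kde n \<omega>"
  by (rule ext) (simp add: kernel_estimator_def kde_def g_def sum_divide_distrib[symmetric])

lemma kde_has_derivative: "(kde n \<omega> has_real_derivative kde' n \<omega> x) (at x)"
proof -
  have "((\<lambda>x. g n x z) has_real_derivative g' n x z) (at x)" for z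
  proof -
    have "((\<lambda>x. K ((x - z) / h n)) has_real_derivative K' ((x - z) / h n) * (1 / h n)) (at x)"
      by (rule DERIV_chain'[OF _ deriv_K]) (use h_pos[of n] in \<open>auto intro!: derivative_eq_intros\<close>)
    from DERIV_cdivide[OF this, of "h n"] show ?thesis by (simp add: g_def g'_def power2_eq_square)
  qed
  then show ?thesis unfolding kde_def[abs_def] kde'_def by (intro DERIV_cdivide DERIV_sum)
qed

lemma kde'_continuous: "continuous_on UNIV (kde' n \<omega>)"
proof -
  have "h n \<noteq> 0" using h_pos[of n] by simp
  then show ?thesis unfolding kde'_def[abs_def] g'_def
    by (intro continuous_intros continuous_on_compose2[OF cont_K']) auto
qed

lemma f_measurable [measurable]: "f \<in> borel_measurable borel" "f' \<in> borel_measurable borel"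
  using f by (auto intro!: borel_measurable_continuous_onI DERIV_continuous_on)

lemma g_measurable [measurable]:
  "case_prod (g n) \<in> borel_measurable (borel \<Otimes>\<^sub>M borel)" "case_prod (g' n) \<in> borel_measurable (borel \<Otimes>\<^sub>M borel)"
  unfolding g_def g'_def by measurable

lemma mean_g: "(LBINT z. g n x z * f z) = smooth (h n) f x" "(LBINT z. g' n x z * f z) = smooth (h n) f' x"
  unfolding g_def g'_def using smooth_eq_convolution[OF h_pos] smooth_derivative[OF h_pos f(1,2)] by auto

text \<open>The variances of the estimators of the density and of its derivative are governed by these two bounds.\<close>

lemma g_bounded: "\<exists>C\<ge>0. \<forall>n x z. \<bar>g n x z\<bar> \<le> C / h n \<and> \<bar>g' n x z\<bar> \<le> C / (h n)\<^sup>2"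
proof -
  obtain C where C: "0 \<le> C" "\<And>u. \<bar>K u\<bar> \<le> C" "\<And>u. \<bar>K' u\<bar> \<le> C" using K_bounded by auto
  have "\<bar>g n x z\<bar> \<le> C / h n \<and> \<bar>g' n x z\<bar> \<le> C / (h n)\<^sup>2" for n x z
    using C h_pos[of n] unfolding g_def g'_def by (auto simp: abs_divide intro!: divide_right_mono)
  with C(1) show ?thesis by blast
qed

lemma mixing_total_nonneg: "0 \<le> mixing_total"
  unfolding mixing_total_def by (rule suminf_nonneg[OF summable_mixing]) (rule mixing_coeff_nonneg[OF prob_space_axioms Z_meas])

lemma kde_near: "\<exists>B. \<forall>x. \<bar>kde n \<omega> x - f x\<bar> \<le> B \<and> \<bar>kde' n \<omega> x - f' x\<bar> \<le> B"
proof -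
  obtain C where C: "\<And>n x z. \<bar>g n x z\<bar> \<le> C / h n" "\<And>n x z. \<bar>g' n x z\<bar> \<le> C / (h n)\<^sup>2" using g_bounded by auto
  have 1: "\<bar>kde n \<omega> x - f x\<bar> \<le> C / h n + P" for x
    unfolding kde_def by (rule order_trans[OF abs_triangle_ineq4 add_mono[OF abs_mean_le[OF C(1)] f(3)]])
  have 2: "\<bar>kde' n \<omega> x - f' x\<bar> \<le> C / (h n)\<^sup>2 + P" for x
    unfolding kde'_def by (rule order_trans[OF abs_triangle_ineq4 add_mono[OF abs_mean_le[OF C(2)] f(4)]])
  show ?thesis
    by (rule exI[of _ "max (C / h n + P) (C / (h n)\<^sup>2 + P)"]) (use 1 2 in \<open>auto simp: le_max_iff_disj\<close>)
qed

lemma bias_L2: "\<exists>C\<ge>0. \<forall>n. integrable lborel (\<lambda>x. (smooth (h n) f x - f x)\<^sup>2) \<and>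
   (LBINT x. (smooth (h n) f x - f x)\<^sup>2) \<le> C * h n ^ (2 * p)"
proof -
  define C where "C = 2 * L\<^sup>2 * (LBINT u. (K u)\<^sup>2)"
  have "0 \<le> C" unfolding C_def by (auto intro!: mult_nonneg_nonneg integral_nonneg_AE)
  moreover have B: "\<bar>D 0 x\<bar> \<le> P" for x using f(3) D0 by simp
  note b = smooth_bias_L2[OF D p_pos B L K_integral K_moments less_imp_le[OF h_pos]]
  have "integrable lborel (\<lambda>x. (smooth (h n) f x - f x)\<^sup>2) \<and>
   (LBINT x. (smooth (h n) f x - f x)\<^sup>2) \<le> C * h n ^ (2 * p)" for n
    using b[of n] unfolding D0 C_def by blast
  ultimately show ?thesis by blast
qed

lemma slow_bandwidth: "\<forall>\<^sub>F n in sequentially. 1 \<le> real n * h n ^ 4 \<and> 1 \<le> n"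
  using h_slow eventually_ge_at_top[of "1::nat"] unfolding filterlim_at_top by (auto intro: eventually_conj)

text \<open>The variance is of order \<open>1 / (n * (h n)\<^sup>2)\<close>, which is at most a multiple of \<open>1 / sqrt n\<close> since \<open>n * (h n)^4\<close>
eventually exceeds one; the squared bias is of order \<open>(h n)^(2 * p)\<close>, hence of order \<open>1 / n\<close>.\<close>

lemma kde_L2_rate:
  assumes V: "integrable lborel V" "\<And>x. 0 \<le> V x" "\<And>x. V x \<le> Vm"
  shows "integrable M (\<lambda>\<omega>. LBINT x. V x * (kde n \<omega> x - f x)\<^sup>2)"
    and "\<exists>A. \<forall>\<^sub>F n in sequentially. sqrt (real n) * (\<integral>\<omega>. (LBINT x. V x * (kde n \<omega> x - f x)\<^sup>2) \<partial>M) \<le> A"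
proof -
  obtain C where C: "0 \<le> C" "\<And>n x z. \<bar>g n x z\<bar> \<le> C / h n" using g_bounded by blast
  note mse = weighted_mean_square_error[where g="g n" and n=n for n, OF g_measurable(1) C(2) mean_g(1) f_measurable(1) f(3) V(1,2), folded kde_def]
  show "integrable M (\<lambda>\<omega>. LBINT x. V x * (kde n \<omega> x - f x)\<^sup>2)" by (rule mse(1))
  obtain Cb where Cb: "0 \<le> Cb" "\<And>n. integrable lborel (\<lambda>x. (smooth (h n) f x - f x)\<^sup>2)"
    "\<And>n. (LBINT x. (smooth (h n) f x - f x)\<^sup>2) \<le> Cb * h n ^ (2 * p)" using bias_L2 by blast
  obtain A where A: "\<forall>\<^sub>F n in sequentially. real n * h n ^ (2 * p) \<le> A" using h_fast by blast
  define v where "v = (LBINT x. V x)"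
  have v0: "0 \<le> v" unfolding v_def using V(2) by (intro integral_nonneg_AE) auto
  have Vm0: "0 \<le> Vm" using V(2,3)[of 0] by linarith
  have bias: "(LBINT x. V x * (smooth (h n) f x - f x)\<^sup>2) \<le> Vm * (Cb * h n ^ (2 * p))" for n
  proof -
    have "(LBINT x. V x * (smooth (h n) f x - f x)\<^sup>2) \<le> (LBINT x. Vm * (smooth (h n) f x - f x)\<^sup>2)"
      by (rule integral_mono')
        (use Cb(2) V Vm0 in \<open>auto intro!: mult_right_mono mult_nonneg_nonneg\<close>)
    also have "\<dots> \<le> Vm * (Cb * h n ^ (2 * p))" using Cb(3)[of n] Vm0 by (simp add: mult_left_mono)
    finally show ?thesis .
  qed
  define A' where "A' = 16 * C\<^sup>2 * mixing_total * v + 2 * (Vm * (Cb * A))"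
  have "\<forall>\<^sub>F n in sequentially. sqrt (real n) * (\<integral>\<omega>. (LBINT x. V x * (kde n \<omega> x - f x)\<^sup>2) \<partial>M) \<le> A'"
    using A slow_bandwidth
  proof eventually_elim
    case (elim n)
    define s where "s = sqrt (real n)"
    have s: "0 < s" "s * s = real n" "s \<le> real n"
      using elim(2) by (auto simp: s_def sqrt_le_D real_le_lsqrt power2_eq_square)
    have sh: "1 \<le> s * (h n)\<^sup>2"
    proof -
      have "(s * (h n)\<^sup>2)\<^sup>2 = real n * h n ^ 4"
        using s(2) by (simp add: power_mult_distrib power2_eq_square power4_eq_xxxx mult_ac)
      then have "1\<^sup>2 \<le> (s * (h n)\<^sup>2)\<^sup>2" using elim(2) by simp
      then show ?thesis by (rule power2_le_imp_le) (use s in auto)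
    qed
    have "s * (16 * (C / h n)\<^sup>2 * mixing_total / real (n + 1) * v)
        = (16 * C\<^sup>2 * mixing_total * v) * (s / (real (n + 1) * (h n)\<^sup>2))"
      by (simp add: power_divide mult_ac)
    also have "\<dots> \<le> (16 * C\<^sup>2 * mixing_total * v) * 1"
    proof (rule mult_left_mono)
      have "s * 1 \<le> s * (s * (h n)\<^sup>2)" using sh s by (intro mult_left_mono) auto
      also have "\<dots> \<le> real (n + 1) * (h n)\<^sup>2" using s(2) by (simp add: mult.assoc[symmetric] mult_right_mono)
      finally show "s / (real (n + 1) * (h n)\<^sup>2) \<le> 1" using h_pos[of n] by (simp add: divide_le_eq)
      show "0 \<le> 16 * C\<^sup>2 * mixing_total * v" using mixing_total_nonneg v0 by simp
    qed
    finally have 1: "s * (16 * (C / h n)\<^sup>2 * mixing_total / real (n + 1) * v) \<le> 16 * C\<^sup>2 * mixing_total * v" by simp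
    have "s * h n ^ (2 * p) \<le> A"
      by (rule order_trans[OF mult_right_mono[OF s(3)] elim(1)]) (use h_pos[of n] in simp)
    then have "Vm * Cb * (s * h n ^ (2 * p)) \<le> Vm * Cb * A"
      using Vm0 Cb(1) by (intro mult_left_mono) auto
    then have 2: "s * (2 * (Vm * (Cb * h n ^ (2 * p)))) \<le> 2 * (Vm * (Cb * A))" by (simp add: mult_ac)
    have "s * (\<integral>\<omega>. (LBINT x. V x * (kde n \<omega> x - f x)\<^sup>2) \<partial>M)
        \<le> s * (16 * (C / h n)\<^sup>2 * mixing_total / real (n + 1) * v + 2 * (Vm * (Cb * h n ^ (2 * p))))"
      using mse(2)[of n] bias[of n] s(1) unfolding v_def by (intro mult_left_mono) auto
    also have "\<dots> \<le> A'" unfolding A'_def distrib_left using 1 2 by (rule add_mono)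
    finally show ?case unfolding s_def .
  qed
  then show "\<exists>A. \<forall>\<^sub>F n in sequentially. sqrt (real n) * (\<integral>\<omega>. (LBINT x. V x * (kde n \<omega> x - f x)\<^sup>2) \<partial>M) \<le> A" ..
qed

text \<open>The variance of the derivative is of order \<open>1 / (n * (h n)^4)\<close>, and its bias vanishes by dominated
convergence.\<close>

lemma kde'_L2_consistent:
  assumes V: "integrable lborel V" "\<And>x. 0 \<le> V x"
  shows "integrable M (\<lambda>\<omega>. LBINT x. V x * (kde' n \<omega> x - f' x)\<^sup>2)"
    and "(\<lambda>n. \<integral>\<omega>. (LBINT x. V x * (kde' n \<omega> x - f' x)\<^sup>2) \<partial>M) \<longlonglongrightarrow> 0"
proof -
  obtain C where C: "0 \<le> C" "\<And>n x z. \<bar>g' n x z\<bar> \<le> C / (h n)\<^sup>2" using g_bounded by blast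
  note mse = weighted_mean_square_error[where g="g' n" and n=n for n, OF g_measurable(2) C(2) mean_g(2) f_measurable(2) f(4) V(1,2), folded kde'_def]
  show "integrable M (\<lambda>\<omega>. LBINT x. V x * (kde' n \<omega> x - f' x)\<^sup>2)" by (rule mse(1))
  define v where "v = (LBINT x. V x)"
  have v0: "0 \<le> v" unfolding v_def using V(2) by (intro integral_nonneg_AE) auto
  define c where "c = 16 * C\<^sup>2 * mixing_total * v"
  have c0: "0 \<le> c" unfolding c_def using mixing_total_nonneg v0 by simp
  have lim: "(\<lambda>n. c * inverse (real n * h n ^ 4) + 2 * (LBINT x. V x * (smooth (h n) f' x - f' x)\<^sup>2)) \<longlonglongrightarrow> c * 0 + 2 * 0"
    by (intro tendsto_intros smooth_tendsto_L2[OF K_integral f(2,4) h_null V]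
        filterlim_compose[OF tendsto_inverse_0 filterlim_at_top_imp_at_infinity[OF h_slow]])
  show "(\<lambda>n. \<integral>\<omega>. (LBINT x. V x * (kde' n \<omega> x - f' x)\<^sup>2) \<partial>M) \<longlonglongrightarrow> 0"
  proof (rule Lim_null_comparison[OF _ lim[unfolded mult_zero_right add_0_left]])
    show "\<forall>\<^sub>F n in sequentially. norm (\<integral>\<omega>. (LBINT x. V x * (kde' n \<omega> x - f' x)\<^sup>2) \<partial>M)
        \<le> c * inverse (real n * h n ^ 4) + 2 * (LBINT x. V x * (smooth (h n) f' x - f' x)\<^sup>2)"
      using slow_bandwidth
    proof eventually_elim
      case (elim n)
      have n: "0 < real n" using elim by simp
      have "0 \<le> (\<integral>\<omega>. (LBINT x. V x * (kde' n \<omega> x - f' x)\<^sup>2) \<partial>M)"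
        using V(2) by (intro integral_nonneg_AE AE_I2) auto
      then have "norm (\<integral>\<omega>. (LBINT x. V x * (kde' n \<omega> x - f' x)\<^sup>2) \<partial>M)
          = (\<integral>\<omega>. (LBINT x. V x * (kde' n \<omega> x - f' x)\<^sup>2) \<partial>M)" by simp
      also have "\<dots> \<le> 16 * (C / (h n)\<^sup>2)\<^sup>2 * mixing_total / real (n + 1) * v
          + 2 * (LBINT x. V x * (smooth (h n) f' x - f' x)\<^sup>2)"
        using mse(2)[of n] unfolding v_def .
      also have "16 * (C / (h n)\<^sup>2)\<^sup>2 * mixing_total / real (n + 1) * v = c * (1 / (real (n + 1) * h n ^ 4))"
        by (simp add: c_def power_divide flip: power_mult)
      also have "\<dots> \<le> c * (1 / (real n * h n ^ 4))"
        using n h_pos[of n] c0 by (intro mult_left_mono divide_left_mono mult_right_mono) auto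
      finally show ?case by (simp add: inverse_eq_divide)
    qed
  qed
qed

text \<open>The variance of the functional is of order \<open>1 / n\<close>. Its bias is the pairing of \<open>\<phi>\<close> with the bias of
the density estimator and so of order \<open>(h n)^p\<close>, by Cauchy--Schwarz.\<close>

lemma kde_linear_functional_rate:
  assumes \<phi>: "integrable lborel \<phi>" "\<And>x. \<bar>\<phi> x\<bar> \<le> \<Phi>"
  shows "integrable M (\<lambda>\<omega>. (LBINT x. \<phi> x * (kde n \<omega> x - f x))\<^sup>2)"
    and "\<exists>A. \<forall>\<^sub>F n in sequentially. real n * (\<integral>\<omega>. (LBINT x. \<phi> x * (kde n \<omega> x - f x))\<^sup>2 \<partial>M) \<le> A"
proof -
  have \<phi>m [measurable]: "\<phi> \<in> borel_measurable borel" using \<phi>(1) by (auto dest: borel_measurable_integrable)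
  obtain C where C: "0 \<le> C" "\<And>n x z. \<bar>g n x z\<bar> \<le> C / h n" using g_bounded by blast
  define G where "G = \<Phi> * (LBINT u. \<bar>K u\<bar>)"
  have G: "\<bar>LBINT x. \<phi> x * g n x z\<bar> \<le> G" for n z
  proof -
    have hn: "h n \<noteq> 0" "0 < h n" using h_pos[of n] by auto
    have "(LBINT x. \<phi> x * g n x z) = (LBINT u. \<phi> (z + h n * u) * K u)"
      unfolding g_def
      by (subst lborel_integral_real_affine[where c="h n" and t=z, OF hn(1)])
         (use hn in simp)
    also have "\<dots> = smooth (- h n) \<phi> z" unfolding smooth_def by (simp add: mult.commute)
    also have "\<bar>\<dots>\<bar> \<le> G" unfolding G_def by (rule abs_smooth_le) (use \<phi> in auto)
    finally show ?thesis .
  qed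
  note lin = linear_functional_error[where g="g n" and n=n for n, OF g_measurable(1) C(2) mean_g(1) f_measurable(1) f(3) \<phi>(1) G, folded kde_def]
  show "integrable M (\<lambda>\<omega>. (LBINT x. \<phi> x * (kde n \<omega> x - f x))\<^sup>2)" by (rule lin(2))
  obtain Cb where Cb: "0 \<le> Cb" "\<And>n. integrable lborel (\<lambda>x. (smooth (h n) f x - f x)\<^sup>2)"
    "\<And>n. (LBINT x. (smooth (h n) f x - f x)\<^sup>2) \<le> Cb * h n ^ (2 * p)" using bias_L2 by blast
  obtain A where A: "\<forall>\<^sub>F n in sequentially. real n * h n ^ (2 * p) \<le> A" using h_fast by blast
  have sq_le: "(\<phi> x)\<^sup>2 \<le> \<bar>\<Phi> * \<phi> x\<bar>" for x
  proof -
    have "(\<phi> x)\<^sup>2 = \<bar>\<phi> x\<bar> * \<bar>\<phi> x\<bar>" by (simp add: power2_eq_square)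
    also have "\<dots> \<le> \<bar>\<Phi>\<bar> * \<bar>\<phi> x\<bar>" using \<phi>(2)[of x] by (intro mult_right_mono) auto
    finally show ?thesis by (simp add: abs_mult)
  qed
  have int_\<phi>2: "integrable lborel (\<lambda>x. (\<phi> x)\<^sup>2)"
    by (rule Bochner_Integration.integrable_bound[where f = "\<lambda>x. \<Phi> * \<phi> x"])
       (use \<phi>(1) sq_le in auto)
  define c where "c = ((LBINT x. (\<phi> x)\<^sup>2) + Cb) / 2"
  have bias: "(LBINT x. \<phi> x * (smooth (h n) f x - f x))\<^sup>2 \<le> c\<^sup>2 * h n ^ (2 * p)" for n
  proof -
    define t where "t = h n ^ p"
    have t: "0 < t" "t\<^sup>2 = h n ^ (2 * p)" using h_pos[of n] by (simp_all add: t_def power_mult[symmetric] mult.commute)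
    define \<beta> where "\<beta> = (\<lambda>x. smooth (h n) f x - f x)"
    have \<beta>: "integrable lborel (\<lambda>x. (\<beta> x)\<^sup>2)" "(LBINT x. (\<beta> x)\<^sup>2) \<le> Cb * t\<^sup>2"
      using Cb(2,3)[of n] unfolding \<beta>_def t(2) by auto
    have [measurable]: "\<beta> \<in> borel_measurable borel" unfolding \<beta>_def by measurable
    \<comment> \<open>Young's inequality weighted by \<open>t\<close>, the order of the bias, stands in for Cauchy--Schwarz.\<close>
    have le: "\<bar>\<phi> x * \<beta> x\<bar> \<le> (t * (\<phi> x)\<^sup>2 + (\<beta> x)\<^sup>2 / t) / 2" for x
    proof -
      have "0 \<le> (t * \<bar>\<phi> x\<bar> - \<bar>\<beta> x\<bar>)\<^sup>2 / t" using t(1) by simp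
      also have "\<dots> = t * \<bar>\<phi> x\<bar>\<^sup>2 + \<bar>\<beta> x\<bar>\<^sup>2 / t - 2 * (\<bar>\<phi> x\<bar> * \<bar>\<beta> x\<bar>)"
        using t(1) by (simp add: field_simps power2_eq_square)
      finally show ?thesis by (simp add: abs_mult)
    qed
    have int_r: "integrable lborel (\<lambda>x. (t * (\<phi> x)\<^sup>2 + (\<beta> x)\<^sup>2 / t) / 2)" using int_\<phi>2 \<beta>(1) by simp
    have int_l: "integrable lborel (\<lambda>x. \<phi> x * \<beta> x)"
      by (rule Bochner_Integration.integrable_bound[OF int_r]) (use le in \<open>auto intro: order_trans[OF _ abs_ge_self]\<close>)
    have "\<bar>LBINT x. \<phi> x * \<beta> x\<bar> \<le> (LBINT x. \<bar>\<phi> x * \<beta> x\<bar>)" by (rule integral_abs_bound)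
    also have "\<dots> \<le> (LBINT x. (t * (\<phi> x)\<^sup>2 + (\<beta> x)\<^sup>2 / t) / 2)"
      by (rule integral_mono) (use int_l int_r le in auto)
    also have "\<dots> = (t * (LBINT x. (\<phi> x)\<^sup>2) + (LBINT x. (\<beta> x)\<^sup>2) / t) / 2"
      using int_\<phi>2 \<beta>(1) by simp
    also have "\<dots> \<le> (t * (LBINT x. (\<phi> x)\<^sup>2) + (Cb * t\<^sup>2) / t) / 2"
      using \<beta>(2) t(1) by (intro divide_right_mono add_left_mono) auto
    also have "\<dots> = c * t" using t(1) by (simp add: c_def power2_eq_square field_simps)
    finally have "\<bar>LBINT x. \<phi> x * \<beta> x\<bar>\<^sup>2 \<le> (c * t)\<^sup>2" by (rule power_mono) simp
    then show ?thesis unfolding \<beta>_def power_mult_distrib t(2) by simp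
  qed
  define A' where "A' = 16 * G\<^sup>2 * mixing_total + 2 * (c\<^sup>2 * A)"
  have "\<forall>\<^sub>F n in sequentially. real n * (\<integral>\<omega>. (LBINT x. \<phi> x * (kde n \<omega> x - f x))\<^sup>2 \<partial>M) \<le> A'"
    using A
  proof eventually_elim
    case (elim n)
    have 1: "real n * (16 * G\<^sup>2 * mixing_total / real (n + 1)) \<le> 16 * G\<^sup>2 * mixing_total"
    proof -
      have "real n * (16 * G\<^sup>2 * mixing_total / real (n + 1)) = (16 * G\<^sup>2 * mixing_total) * (real n / real (n + 1))" by simp
      also have "\<dots> \<le> (16 * G\<^sup>2 * mixing_total) * 1"
        using mixing_total_nonneg by (intro mult_left_mono) auto
      finally show ?thesis by simp
    qed
    have 2: "real n * (2 * (c\<^sup>2 * h n ^ (2 * p))) \<le> 2 * (c\<^sup>2 * A)"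
      using mult_left_mono[OF elim, of "2 * c\<^sup>2"] by (simp add: mult_ac)
    have "real n * (\<integral>\<omega>. (LBINT x. \<phi> x * (kde n \<omega> x - f x))\<^sup>2 \<partial>M)
        \<le> real n * (16 * G\<^sup>2 * mixing_total / real (n + 1) + 2 * (c\<^sup>2 * h n ^ (2 * p)))"
      using lin(3)[of n] bias[of n] by (intro mult_left_mono) auto
    also have "\<dots> \<le> A'" unfolding A'_def distrib_left using 1 2 by (rule add_mono)
    finally show ?case .
  qed
  then show "\<exists>A. \<forall>\<^sub>F n in sequentially. real n * (\<integral>\<omega>. (LBINT x. \<phi> x * (kde n \<omega> x - f x))\<^sup>2 \<partial>M) \<le> A" ..
qed

end

section \<open>The contrast and its curvature at the truth\<close>

lemma integral_derivative_eq_0: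
  fixes F F' :: "real \<Rightarrow> real"
  assumes F: "\<And>x. (F has_real_derivative F' x) (at x)" and cont: "continuous_on UNIV F'"
    and int: "integrable lborel F'" and lim: "(F \<longlongrightarrow> 0) at_infinity"
  shows "(LBINT x. F' x) = 0"
proof -
  have "(LBINT x=-\<infinity>..\<infinity>. F' x) = 0 - 0"
  proof (rule interval_integral_FTC_integrable)
    show "((F \<circ> real_of_ereal) \<longlongrightarrow> 0) (at_right (-\<infinity>))"
      unfolding at_right_MInf tendsto_compose_filtermap filtermap_filtermap
      using filterlim_mono[OF lim order_refl at_bot_le_at_infinity]
      by (simp add: tendsto_compose_filtermap[symmetric] o_def filterlim_def filtermap_filtermap)
    show "((F \<circ> real_of_ereal) \<longlongrightarrow> 0) (at_left \<infinity>)"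
      unfolding at_left_PInf tendsto_compose_filtermap filtermap_filtermap
      using filterlim_mono[OF lim order_refl at_top_le_at_infinity]
      by (simp add: tendsto_compose_filtermap[symmetric] o_def filterlim_def filtermap_filtermap)
    show "set_integrable lborel (einterval (- \<infinity>) \<infinity>) F'"
      using int by (simp add: set_integrable_def)
  qed (use F cont in \<open>auto simp: has_real_derivative_iff_has_vector_derivative continuous_on_eq_continuous_at\<close>)
  then show ?thesis
    by (simp add: interval_lebesgue_integral_def set_lebesgue_integral_def)
qed

text \<open>A remainder bound of second order identifies a derivative; used to differentiate integrals with
respect to a parameter.\<close>

lemma has_derivative_quadratic_remainder:
  fixes f :: "real \<Rightarrow> real"
  assumes \<epsilon>: "\<epsilon> > 0" and rem: "\<And>t. \<bar>t\<bar> < \<epsilon> \<Longrightarrow> \<bar>f (x + t) - f x - t * c\<bar> \<le> C * t\<^sup>2"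
  shows "(f has_real_derivative c) (at x)"
  unfolding DERIV_def
proof (rule LIM_zero_cancel, rule Lim_null_comparison)
  show "\<forall>\<^sub>F t in at 0. norm ((f (x + t) - f x) / t - c) \<le> C * \<bar>t\<bar>"
    unfolding eventually_at
  proof (intro exI[of _ \<epsilon>] conjI ballI impI \<epsilon>)
    fix t :: real assume t: "t \<noteq> 0 \<and> dist t 0 < \<epsilon>"
    then have "norm ((f (x + t) - f x) / t - c) = \<bar>f (x + t) - f x - t * c\<bar> / \<bar>t\<bar>"
      by (simp add: abs_divide[symmetric] diff_divide_distrib del: abs_divide)
    also have "\<dots> \<le> C * t\<^sup>2 / \<bar>t\<bar>" using t by (intro divide_right_mono rem) auto
    also have "\<dots> = C * \<bar>t\<bar>" using t by (simp add: power2_eq_square abs_if)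
    finally show "norm ((f (x + t) - f x) / t - c) \<le> C * \<bar>t\<bar>" .
  qed
  have "((\<lambda>t::real. C * \<bar>t\<bar>) \<longlongrightarrow> C * \<bar>0\<bar>) (at 0)" by (intro tendsto_intros)
  then show "((\<lambda>t::real. C * \<bar>t\<bar>) \<longlongrightarrow> 0) (at 0)" by simp
qed

text \<open>The drift \<open>\<mu>\<close>, its derivatives \<open>\<mu>1\<close> and \<open>\<mu>2\<close> in the parameter with majorants \<open>m1\<close>, \<open>m2\<close>, \<open>m3\<close>, and the derivative
\<open>\<mu>1x\<close> of \<open>\<mu>1\<close> in the state at the true parameter with majorant \<open>m5\<close>. All products of coefficients that occur
as weights are dominated by the one integrable function \<open>V\<close>, so that every estimate can be expressed by the
integrals of \<open>V\<close> against the squared errors of a density and of its derivative. The fact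
\<open>balance\<close> is the stationary Fokker--Planck equation, integrated once.\<close>

locale contrast_model =
  fixes a b \<theta>\<^sub>0 :: real and \<mu> \<mu>1 \<mu>2 :: "real \<Rightarrow> real \<Rightarrow> real" and \<mu>1x :: "real \<Rightarrow> real"
    and \<pi> \<pi>' \<sigma> \<sigma>' w w' m1 m2 m3 m5 V :: "real \<Rightarrow> real" and P :: real
  assumes \<theta>\<^sub>0: "a < \<theta>\<^sub>0" "\<theta>\<^sub>0 < b"
    and \<mu>_deriv: "\<And>x \<theta>. \<theta> \<in> {a..b} \<Longrightarrow> (\<mu> x has_real_derivative \<mu>1 x \<theta>) (at \<theta> within {a..b})"
    and \<mu>1_deriv: "\<And>x \<theta>. \<theta> \<in> {a..b} \<Longrightarrow> (\<mu>1 x has_real_derivative \<mu>2 x \<theta>) (at \<theta> within {a..b})"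
    and \<mu>_le: "\<And>x \<theta>. \<theta> \<in> {a..b} \<Longrightarrow> \<bar>\<mu> x \<theta>\<bar> \<le> m1 x"
    and \<mu>1_le: "\<And>x \<theta>. \<theta> \<in> {a..b} \<Longrightarrow> \<bar>\<mu>1 x \<theta>\<bar> \<le> m2 x"
    and \<mu>2_le: "\<And>x \<theta>. \<theta> \<in> {a..b} \<Longrightarrow> \<bar>\<mu>2 x \<theta>\<bar> \<le> m3 x"
    and \<mu>_meas: "\<And>\<theta>. \<theta> \<in> {a..b} \<Longrightarrow> (\<lambda>x. \<mu> x \<theta>) \<in> borel_measurable borel"
    and \<mu>1_meas: "\<And>\<theta>. \<theta> \<in> {a..b} \<Longrightarrow> (\<lambda>x. \<mu>1 x \<theta>) \<in> borel_measurable borel"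
    and \<mu>1x: "\<And>x. ((\<lambda>x. \<mu>1 x \<theta>\<^sub>0) has_real_derivative \<mu>1x x) (at x)" "continuous_on UNIV \<mu>1x"
      "\<And>x. \<bar>\<mu>1x x\<bar> \<le> m5 x"
    and \<pi>: "\<And>x. (\<pi> has_real_derivative \<pi>' x) (at x)" "continuous_on UNIV \<pi>'"
      "\<And>x. \<bar>\<pi> x\<bar> \<le> P" "\<And>x. \<bar>\<pi>' x\<bar> \<le> P"
    and \<sigma>: "\<And>x. (\<sigma> has_real_derivative \<sigma>' x) (at x)" "continuous_on UNIV \<sigma>'"
    and w: "\<And>x. (w has_real_derivative w' x) (at x)" "continuous_on UNIV w'" "\<And>x. 0 \<le> w x"
    and balance: "\<And>x. \<mu> x \<theta>\<^sub>0 * \<pi> x = \<sigma> x * \<sigma>' x * \<pi> x + 1 / 2 * (\<sigma> x)\<^sup>2 * \<pi>' x"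
    and V: "integrable lborel V"
    and V_ge: "\<And>x. (m1 x)\<^sup>2 * w x \<le> V x" "\<And>x. (\<sigma> x)^4 * w x \<le> V x" "\<And>x. (\<sigma> x)\<^sup>2 * (\<sigma>' x)\<^sup>2 * w x \<le> V x"
      "\<And>x. m2 x * m1 x * w x \<le> V x" "\<And>x. m5 x * (\<sigma> x)\<^sup>2 * w x \<le> V x" "\<And>x. (m2 x)\<^sup>2 * w x \<le> V x"
      "\<And>x. m2 x * (\<sigma> x)\<^sup>2 * \<bar>w' x\<bar> \<le> V x" "\<And>x. m3 x * m1 x * w x \<le> V x"
      "\<And>x. m3 x * \<bar>\<sigma> x * \<sigma>' x\<bar> * w x \<le> V x" "\<And>x. m3 x * (\<sigma> x)\<^sup>2 * w x \<le> V x"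
      "\<And>x. m3 x * m2 x * w x \<le> V x" "\<And>x. m2 x * (\<sigma> x)\<^sup>2 * w x \<le> V x"
      "\<And>x. m2 x * \<bar>\<sigma> x * \<sigma>' x\<bar> * w x \<le> V x"
    and boundary: "((\<lambda>x. m2 x * w x * (\<sigma> x)\<^sup>2) \<longlongrightarrow> 0) at_infinity"
begin

lemma \<theta>\<^sub>0_mem: "\<theta>\<^sub>0 \<in> {a..b}" using \<theta>\<^sub>0 by simp

lemma m_nonneg: "0 \<le> m1 x" "0 \<le> m2 x" "0 \<le> m3 x" "0 \<le> m5 x"
  using \<mu>_le[OF \<theta>\<^sub>0_mem, of x] \<mu>1_le[OF \<theta>\<^sub>0_mem, of x] \<mu>2_le[OF \<theta>\<^sub>0_mem, of x] \<mu>1x(3)[of x] by linarith+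

lemma V_nonneg: "0 \<le> V x"
  using V_ge(1)[of x] w(3)[of x] by (meson mult_nonneg_nonneg order_trans zero_le_power2)

lemma P_nonneg: "0 \<le> P" using \<pi>(3)[of 0] by linarith

lemma coefficients_continuous: "continuous_on UNIV \<pi>" "continuous_on UNIV \<sigma>" "continuous_on UNIV w"
  "continuous_on UNIV (\<lambda>x. \<mu>1 x \<theta>\<^sub>0)"
  using \<pi>(1) \<sigma>(1) w(1) \<mu>1x(1) by (auto intro!: DERIV_continuous_on)

lemma coefficients_measurable [measurable]:
  "\<pi> \<in> borel_measurable borel" "\<pi>' \<in> borel_measurable borel" "\<sigma> \<in> borel_measurable borel"
  "\<sigma>' \<in> borel_measurable borel" "w \<in> borel_measurable borel" "w' \<in> borel_measurable borel"
  "\<mu>1x \<in> borel_measurable borel" "V \<in> borel_measurable borel"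
  using coefficients_continuous \<pi>(2) \<sigma>(2) w(2) \<mu>1x(2) V by (auto intro: borel_measurable_continuous_onI dest: borel_measurable_integrable)

lemmas drift_measurable_\<theta>\<^sub>0 [measurable] = \<mu>_meas[OF \<theta>\<^sub>0_mem] \<mu>1_meas[OF \<theta>\<^sub>0_mem]

lemma integrable_dominated:
  assumes "g \<in> borel_measurable borel" "\<And>x. \<bar>g x\<bar> \<le> c * V x"
  shows "integrable lborel g"
  by (rule Bochner_Integration.integrable_bound[where f = "\<lambda>x. c * V x"])
     (use assms V in \<open>auto intro: order_trans[OF _ abs_ge_self]\<close>)

lemma drift_Lipschitz:
  assumes "\<theta> \<in> {a..b}" "\<theta>' \<in> {a..b}"
  shows "\<bar>\<mu> x \<theta> - \<mu> x \<theta>'\<bar> \<le> m2 x * \<bar>\<theta> - \<theta>'\<bar>"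
    and "\<bar>\<mu>1 x \<theta> - \<mu>1 x \<theta>'\<bar> \<le> m3 x * \<bar>\<theta> - \<theta>'\<bar>"
  using field_differentiable_bound[of "{a..b}" "\<mu> x" "\<mu>1 x" "m2 x" \<theta> \<theta>'] \<mu>_deriv \<mu>1_le
    field_differentiable_bound[of "{a..b}" "\<mu>1 x" "\<mu>2 x" "m3 x" \<theta> \<theta>'] \<mu>1_deriv \<mu>2_le assms by auto

lemma drift_Taylor:
  assumes "\<theta> \<in> {a..b}" "\<theta>' \<in> {a..b}"
  shows "\<bar>\<mu> x \<theta> - \<mu> x \<theta>' - (\<theta> - \<theta>') * \<mu>1 x \<theta>'\<bar> \<le> m3 x * (\<theta> - \<theta>')\<^sup>2"
proof -
  have seg: "closed_segment \<theta>' \<theta> \<subseteq> {a..b}" using assms by (simp add: closed_segment_subset)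
  have "norm ((\<mu> x \<theta> - \<theta> * \<mu>1 x \<theta>') - (\<mu> x \<theta>' - \<theta>' * \<mu>1 x \<theta>')) \<le> m3 x * \<bar>\<theta> - \<theta>'\<bar> * norm (\<theta> - \<theta>')"
  proof (rule field_differentiable_bound[where S = "closed_segment \<theta>' \<theta>" and f' = "\<lambda>t. \<mu>1 x t - \<mu>1 x \<theta>'"])
    fix t assume t: "t \<in> closed_segment \<theta>' \<theta>"
    have "(\<mu> x has_real_derivative \<mu>1 x t) (at t within closed_segment \<theta>' \<theta>)"
      by (rule DERIV_subset[OF \<mu>_deriv seg]) (use t seg in auto)
    then show "((\<lambda>t. \<mu> x t - t * \<mu>1 x \<theta>') has_real_derivative \<mu>1 x t - \<mu>1 x \<theta>') (at t within closed_segment \<theta>' \<theta>)"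
      by (auto intro!: derivative_eq_intros)
    have "\<bar>\<mu>1 x t - \<mu>1 x \<theta>'\<bar> \<le> m3 x * \<bar>t - \<theta>'\<bar>" using t seg assms by (intro drift_Lipschitz) auto
    also have "\<dots> \<le> m3 x * \<bar>\<theta> - \<theta>'\<bar>"
      using t by (intro mult_left_mono m_nonneg) (auto simp: closed_segment_eq_real_ivl split: if_splits)
    finally show "norm (\<mu>1 x t - \<mu>1 x \<theta>') \<le> m3 x * \<bar>\<theta> - \<theta>'\<bar>" by simp
  qed auto
  then show ?thesis by (simp add: power2_eq_square algebra_simps)
qed

text \<open>Half the derivative of \<open>\<sigma>\<^sup>2 q\<close>, written so that it is linear in the pair \<open>(q, q')\<close>.\<close>

definition flux :: "(real \<Rightarrow> real) \<Rightarrow> (real \<Rightarrow> real) \<Rightarrow> real \<Rightarrow> real" where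
  "flux q q' x = \<sigma> x * \<sigma>' x * q x + 1 / 2 * (\<sigma> x)\<^sup>2 * q' x"

lemma flux_diff: "flux q q' x = flux \<pi> \<pi>' x + flux (\<lambda>x. q x - \<pi> x) (\<lambda>x. q' x - \<pi>' x) x"
  by (simp add: flux_def field_simps)

lemma balance_flux: "flux \<pi> \<pi>' x = \<mu> x \<theta>\<^sub>0 * \<pi> x"
  using balance by (simp add: flux_def)

lemma criterion_eq:
  assumes q: "\<And>x. (q has_real_derivative q' x) (at x)"
  shows "criterion \<mu> \<sigma> w q \<theta> = (LBINT x. (\<mu> x \<theta> * q x - flux q q' x)\<^sup>2 * w x)"
proof -
  have "deriv (\<lambda>y. (\<sigma> y)\<^sup>2 * q y) x = 2 * \<sigma> x * \<sigma>' x * q x + (\<sigma> x)\<^sup>2 * q' x" for x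
    by (rule DERIV_imp_deriv) (auto intro!: derivative_eq_intros \<sigma> q)
  then show ?thesis by (simp add: criterion_def flux_def algebra_simps)
qed

lemma criterion_truth: "criterion \<mu> \<sigma> w \<pi> \<theta> = (LBINT x. ((\<mu> x \<theta> - \<mu> x \<theta>\<^sub>0) * \<pi> x)\<^sup>2 * w x)"
  using criterion_eq[of \<pi> \<pi>', OF \<pi>(1)] by (simp add: balance_flux algebra_simps)

text \<open>Half the curvature of the limit contrast at its minimiser, as \<open>second_derivative_criterion\<close> shows.\<close>

definition information :: real where
  "information = (LBINT x. (\<mu>1 x \<theta>\<^sub>0 * \<pi> x)\<^sup>2 * w x)"

lemma \<pi>_sq_le: "(\<pi> x)\<^sup>2 \<le> P\<^sup>2"
  using power_mono[of "\<bar>\<pi> x\<bar>" P 2] \<pi>(3) by simp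

lemma \<pi>_sq_mult_le: "0 \<le> u \<Longrightarrow> u \<le> c \<Longrightarrow> (\<pi> x)\<^sup>2 * u \<le> P\<^sup>2 * c"
  using \<pi>_sq_le by (rule mult_mono) auto

lemma score_weight_le: "(\<mu>1 x \<theta>\<^sub>0)\<^sup>2 * w x \<le> V x"
proof -
  have "(\<mu>1 x \<theta>\<^sub>0)\<^sup>2 \<le> (m2 x)\<^sup>2" using power_mono[of "\<bar>\<mu>1 x \<theta>\<^sub>0\<bar>" "m2 x" 2] \<mu>1_le[OF \<theta>\<^sub>0_mem] by simp
  then have "(\<mu>1 x \<theta>\<^sub>0)\<^sup>2 * w x \<le> (m2 x)\<^sup>2 * w x" using w(3) by (rule mult_right_mono)
  also note V_ge(6)
  finally show ?thesis .
qed

lemma integrable_information: "integrable lborel (\<lambda>x. (\<mu>1 x \<theta>\<^sub>0 * \<pi> x)\<^sup>2 * w x)"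
proof (rule integrable_dominated)
  fix x
  note score_weight_le[of x]
  then have "(\<pi> x)\<^sup>2 * ((\<mu>1 x \<theta>\<^sub>0)\<^sup>2 * w x) \<le> P\<^sup>2 * V x"
    using w(3)[of x] by (intro \<pi>_sq_mult_le) auto
  then show "\<bar>(\<mu>1 x \<theta>\<^sub>0 * \<pi> x)\<^sup>2 * w x\<bar> \<le> P\<^sup>2 * V x" using w(3)[of x] by (simp add: power_mult_distrib abs_mult mult_ac)
qed measurable

lemma information_nonneg: "0 \<le> information"
  unfolding information_def by (intro integral_nonneg_AE AE_I2 mult_nonneg_nonneg w) auto

lemma integrable_criterion_truth:
  assumes "\<theta> \<in> {a..b}"
  shows "integrable lborel (\<lambda>x. ((\<mu> x \<theta> - \<mu> x \<theta>\<^sub>0) * \<pi> x)\<^sup>2 * w x)"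
proof (rule integrable_dominated)
  note [measurable] = \<mu>_meas[OF assms]
  show "(\<lambda>x. ((\<mu> x \<theta> - \<mu> x \<theta>\<^sub>0) * \<pi> x)\<^sup>2 * w x) \<in> borel_measurable borel" by measurable
  fix x
  have "(\<mu> x \<theta> - \<mu> x \<theta>\<^sub>0)\<^sup>2 \<le> (m2 x * \<bar>\<theta> - \<theta>\<^sub>0\<bar>)\<^sup>2"
    using power_mono[of "\<bar>\<mu> x \<theta> - \<mu> x \<theta>\<^sub>0\<bar>" _ 2] drift_Lipschitz(1)[OF assms \<theta>\<^sub>0_mem] by simp
  then have "(\<mu> x \<theta> - \<mu> x \<theta>\<^sub>0)\<^sup>2 * w x \<le> (m2 x * \<bar>\<theta> - \<theta>\<^sub>0\<bar>)\<^sup>2 * w x"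
    using w(3)[of x] by (rule mult_right_mono)
  also have "\<dots> = (\<theta> - \<theta>\<^sub>0)\<^sup>2 * ((m2 x)\<^sup>2 * w x)" by (simp add: power_mult_distrib)
  also have "\<dots> \<le> (\<theta> - \<theta>\<^sub>0)\<^sup>2 * V x" using V_ge(6) by (intro mult_left_mono) auto
  finally have "(\<pi> x)\<^sup>2 * ((\<mu> x \<theta> - \<mu> x \<theta>\<^sub>0)\<^sup>2 * w x) \<le> P\<^sup>2 * ((\<theta> - \<theta>\<^sub>0)\<^sup>2 * V x)"
    using w(3)[of x] by (intro \<pi>_sq_mult_le) auto
  then show "\<bar>((\<mu> x \<theta> - \<mu> x \<theta>\<^sub>0) * \<pi> x)\<^sup>2 * w x\<bar> \<le> (P\<^sup>2 * (\<theta> - \<theta>\<^sub>0)\<^sup>2) * V x"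
    using w(3)[of x] by (simp add: power_mult_distrib abs_mult mult_ac)
qed

definition criterion_deriv :: "real \<Rightarrow> real" where
  "criterion_deriv \<theta> = 2 * (LBINT x. \<mu>1 x \<theta> * (\<mu> x \<theta> - \<mu> x \<theta>\<^sub>0) * (\<pi> x)\<^sup>2 * w x)"

lemma integrable_criterion_deriv:
  assumes "\<theta> \<in> {a..b}"
  shows "integrable lborel (\<lambda>x. \<mu>1 x \<theta> * (\<mu> x \<theta> - \<mu> x \<theta>\<^sub>0) * (\<pi> x)\<^sup>2 * w x)"
proof (rule integrable_dominated)
  note [measurable] = \<mu>_meas[OF assms] \<mu>1_meas[OF assms]
  show "(\<lambda>x. \<mu>1 x \<theta> * (\<mu> x \<theta> - \<mu> x \<theta>\<^sub>0) * (\<pi> x)\<^sup>2 * w x) \<in> borel_measurable borel" by measurable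
  fix x
  have "\<bar>\<mu>1 x \<theta> * (\<mu> x \<theta> - \<mu> x \<theta>\<^sub>0)\<bar> \<le> m2 x * (m2 x * \<bar>\<theta> - \<theta>\<^sub>0\<bar>)"
    unfolding abs_mult using m_nonneg
    by (intro mult_mono \<mu>1_le drift_Lipschitz assms \<theta>\<^sub>0_mem) auto
  then have "\<bar>\<mu>1 x \<theta> * (\<mu> x \<theta> - \<mu> x \<theta>\<^sub>0)\<bar> * w x \<le> m2 x * (m2 x * \<bar>\<theta> - \<theta>\<^sub>0\<bar>) * w x"
    using w(3)[of x] by (rule mult_right_mono)
  also have "\<dots> = \<bar>\<theta> - \<theta>\<^sub>0\<bar> * ((m2 x)\<^sup>2 * w x)" by (simp add: power2_eq_square)
  also have "\<dots> \<le> \<bar>\<theta> - \<theta>\<^sub>0\<bar> * V x" using V_ge(6) by (intro mult_left_mono) auto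
  finally have "(\<pi> x)\<^sup>2 * (\<bar>\<mu>1 x \<theta> * (\<mu> x \<theta> - \<mu> x \<theta>\<^sub>0)\<bar> * w x) \<le> P\<^sup>2 * (\<bar>\<theta> - \<theta>\<^sub>0\<bar> * V x)"
    using w(3)[of x] by (intro \<pi>_sq_mult_le) auto
  then show "\<bar>\<mu>1 x \<theta> * (\<mu> x \<theta> - \<mu> x \<theta>\<^sub>0) * (\<pi> x)\<^sup>2 * w x\<bar> \<le> (P\<^sup>2 * \<bar>\<theta> - \<theta>\<^sub>0\<bar>) * V x"
    using w(3)[of x] by (simp add: abs_mult mult_ac)
qed

lemma integral_remainder_le:
  assumes [measurable]: "g \<in> borel_measurable borel"
    and g: "\<And>x. \<bar>g x\<bar> * w x \<le> c * V x"
  shows "\<bar>LBINT x. g x * (\<pi> x)\<^sup>2 * w x\<bar> \<le> P\<^sup>2 * c * (LBINT x. V x)"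
    and "integrable lborel (\<lambda>x. g x * (\<pi> x)\<^sup>2 * w x)"
proof -
  have le: "\<bar>g x * (\<pi> x)\<^sup>2 * w x\<bar> \<le> (P\<^sup>2 * c) * V x" for x
  proof -
    have "(\<pi> x)\<^sup>2 * (\<bar>g x\<bar> * w x) \<le> P\<^sup>2 * (c * V x)"
      using w(3)[of x] g by (intro \<pi>_sq_mult_le) auto
    then show ?thesis using w(3)[of x] by (simp add: abs_mult mult_ac)
  qed
  show int: "integrable lborel (\<lambda>x. g x * (\<pi> x)\<^sup>2 * w x)"
    by (rule integrable_dominated[OF _ le]) measurable
  have "\<bar>LBINT x. g x * (\<pi> x)\<^sup>2 * w x\<bar> \<le> (LBINT x. \<bar>g x * (\<pi> x)\<^sup>2 * w x\<bar>)"
    by (rule integral_abs_bound)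
  also have "\<dots> \<le> (LBINT x. (P\<^sup>2 * c) * V x)"
    by (rule integral_mono) (use int V le in auto)
  finally show "\<bar>LBINT x. g x * (\<pi> x)\<^sup>2 * w x\<bar> \<le> P\<^sup>2 * c * (LBINT x. V x)" by simp
qed

text \<open>Differentiation under the integral sign: the second-order remainder of the squared drift difference
is dominated by a multiple of \<open>V\<close>.\<close>

lemma criterion_has_derivative:
  assumes "\<theta> \<in> {a<..<b}"
  shows "(criterion \<mu> \<sigma> w \<pi> has_real_derivative criterion_deriv \<theta>) (at \<theta>)"
proof (rule has_derivative_quadratic_remainder)
  show "min (\<theta> - a) (b - \<theta>) > 0" using assms by simp
  fix t assume "\<bar>t\<bar> < min (\<theta> - a) (b - \<theta>)"
  then have mem: "\<theta> \<in> {a..b}" "\<theta> + t \<in> {a..b}" using assms by (auto simp: abs_if split: if_splits)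
  note [measurable] = \<mu>_meas[OF mem(1)] \<mu>1_meas[OF mem(1)] \<mu>_meas[OF mem(2)]
  define g where "g = (\<lambda>x. (\<mu> x (\<theta> + t) - \<mu> x \<theta>\<^sub>0)\<^sup>2 - (\<mu> x \<theta> - \<mu> x \<theta>\<^sub>0)\<^sup>2
      - 2 * t * (\<mu>1 x \<theta> * (\<mu> x \<theta> - \<mu> x \<theta>\<^sub>0)))"
  have g: "\<bar>g x\<bar> * w x \<le> ((1 + 2 * (b - a)) * t\<^sup>2) * V x" for x
  proof -
    define M where "M = \<mu> x \<theta> - \<mu> x \<theta>\<^sub>0"
    define N where "N = \<mu> x (\<theta> + t) - \<mu> x \<theta>"
    define r where "r = N - t * \<mu>1 x \<theta>"
    have M: "\<bar>M\<bar> \<le> m2 x * (b - a)"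
      unfolding M_def using mem(1) \<theta>\<^sub>0 m_nonneg(2)[of x]
      by (intro order_trans[OF drift_Lipschitz(1)[OF mem(1) \<theta>\<^sub>0_mem]] mult_left_mono) (auto simp: abs_if)
    have N: "\<bar>N\<bar> \<le> m2 x * \<bar>t\<bar>" unfolding N_def using drift_Lipschitz(1)[OF mem(2,1), of x] by simp
    have r: "\<bar>r\<bar> \<le> m3 x * t\<^sup>2" unfolding r_def N_def using drift_Taylor[OF mem(2,1), of x] by simp
    have "g x = N\<^sup>2 + 2 * (M * r)" unfolding g_def r_def N_def M_def by (simp add: power2_eq_square algebra_simps)
    also have "\<bar>\<dots>\<bar> \<le> \<bar>N\<bar>\<^sup>2 + 2 * (\<bar>M\<bar> * \<bar>r\<bar>)"
      by (rule order_trans[OF abs_triangle_ineq]) (simp add: abs_mult)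
    also have "\<dots> \<le> (m2 x * \<bar>t\<bar>)\<^sup>2 + 2 * ((m2 x * (b - a)) * (m3 x * t\<^sup>2))"
      using N M r by (intro add_mono mult_mono mult_left_mono power_mono) (auto intro: order_trans[OF abs_ge_zero])
    finally have "\<bar>g x\<bar> * w x \<le> ((m2 x * \<bar>t\<bar>)\<^sup>2 + 2 * ((m2 x * (b - a)) * (m3 x * t\<^sup>2))) * w x"
      using w(3) by (rule mult_right_mono)
    also have "\<dots> = t\<^sup>2 * ((m2 x)\<^sup>2 * w x) + 2 * (b - a) * t\<^sup>2 * (m3 x * m2 x * w x)"
      by (simp add: power_mult_distrib algebra_simps)
    also have "\<dots> \<le> t\<^sup>2 * V x + 2 * (b - a) * t\<^sup>2 * V x"
      using V_ge(6)[of x] V_ge(11)[of x] \<theta>\<^sub>0 by (intro add_mono mult_left_mono) auto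
    finally show ?thesis by (simp add: algebra_simps)
  qed
  have gm: "g \<in> borel_measurable borel" unfolding g_def by measurable
  have "criterion \<mu> \<sigma> w \<pi> (\<theta> + t) - criterion \<mu> \<sigma> w \<pi> \<theta> - t * criterion_deriv \<theta>
      = (LBINT x. g x * (\<pi> x)\<^sup>2 * w x)"
  proof -
    have "(LBINT x. g x * (\<pi> x)\<^sup>2 * w x)
      = (LBINT x. ((\<mu> x (\<theta> + t) - \<mu> x \<theta>\<^sub>0) * \<pi> x)\<^sup>2 * w x - ((\<mu> x \<theta> - \<mu> x \<theta>\<^sub>0) * \<pi> x)\<^sup>2 * w x
          - 2 * t * (\<mu>1 x \<theta> * (\<mu> x \<theta> - \<mu> x \<theta>\<^sub>0) * (\<pi> x)\<^sup>2 * w x))"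
      by (intro Bochner_Integration.integral_cong refl) (simp add: g_def power2_eq_square algebra_simps)
    then show ?thesis
      using integrable_criterion_truth[OF mem(1)] integrable_criterion_truth[OF mem(2)]
        integrable_criterion_deriv[OF mem(1)]
      by (simp add: criterion_truth criterion_deriv_def)
  qed
  then show "\<bar>criterion \<mu> \<sigma> w \<pi> (\<theta> + t) - criterion \<mu> \<sigma> w \<pi> \<theta> - t * criterion_deriv \<theta>\<bar>
      \<le> (P\<^sup>2 * (1 + 2 * (b - a)) * (LBINT x. V x)) * t\<^sup>2"
    using integral_remainder_le(1)[OF gm g] by (simp add: mult_ac)
qed

text \<open>Near the truth \<open>\<mu> x \<theta> - \<mu> x \<theta>\<^sub>0\<close> is \<open>(\<theta> - \<theta>\<^sub>0) * \<mu>1 x \<theta>\<^sub>0\<close> to first order, so the first derivative of the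
contrast is \<open>2 * (\<theta> - \<theta>\<^sub>0) * information\<close> up to a quadratic error. It has to be known on a
neighbourhood before it can be differentiated again.\<close>

lemma second_derivative_criterion:
  "(deriv ^^ 2) (criterion \<mu> \<sigma> w \<pi>) \<theta>\<^sub>0 = 2 * information"
proof -
  have "(criterion_deriv has_real_derivative 2 * information) (at \<theta>\<^sub>0)"
  proof (rule has_derivative_quadratic_remainder)
    show "min (\<theta>\<^sub>0 - a) (b - \<theta>\<^sub>0) > 0" using \<theta>\<^sub>0 by simp
    fix t assume "\<bar>t\<bar> < min (\<theta>\<^sub>0 - a) (b - \<theta>\<^sub>0)"
    then have mem: "\<theta>\<^sub>0 + t \<in> {a..b}" by (auto simp: abs_if split: if_splits)
    note [measurable] = \<mu>_meas[OF mem] \<mu>1_meas[OF mem]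
    define g where "g = (\<lambda>x. \<mu>1 x (\<theta>\<^sub>0 + t) * (\<mu> x (\<theta>\<^sub>0 + t) - \<mu> x \<theta>\<^sub>0) - t * (\<mu>1 x \<theta>\<^sub>0)\<^sup>2)"
    have gm: "g \<in> borel_measurable borel" unfolding g_def by measurable
    have g: "\<bar>g x\<bar> * w x \<le> (2 * t\<^sup>2) * V x" for x
    proof -
      define M where "M = \<mu> x (\<theta>\<^sub>0 + t) - \<mu> x \<theta>\<^sub>0"
      define N where "N = \<mu>1 x (\<theta>\<^sub>0 + t) - \<mu>1 x \<theta>\<^sub>0"
      define r where "r = M - t * \<mu>1 x \<theta>\<^sub>0"
      have M: "\<bar>M\<bar> \<le> m2 x * \<bar>t\<bar>" unfolding M_def using drift_Lipschitz(1)[OF mem \<theta>\<^sub>0_mem, of x] by simp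
      have N: "\<bar>N\<bar> \<le> m3 x * \<bar>t\<bar>" unfolding N_def using drift_Lipschitz(2)[OF mem \<theta>\<^sub>0_mem, of x] by simp
      have r: "\<bar>r\<bar> \<le> m3 x * t\<^sup>2" unfolding r_def M_def using drift_Taylor[OF mem \<theta>\<^sub>0_mem, of x] by simp
      have "g x = N * M + \<mu>1 x \<theta>\<^sub>0 * r" unfolding g_def r_def N_def M_def by (simp add: power2_eq_square algebra_simps)
      also have "\<bar>\<dots>\<bar> \<le> \<bar>N\<bar> * \<bar>M\<bar> + \<bar>\<mu>1 x \<theta>\<^sub>0\<bar> * \<bar>r\<bar>"
        by (rule order_trans[OF abs_triangle_ineq]) (simp add: abs_mult)
      also have "\<dots> \<le> (m3 x * \<bar>t\<bar>) * (m2 x * \<bar>t\<bar>) + m2 x * (m3 x * t\<^sup>2)"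
        using N M r \<mu>1_le[OF \<theta>\<^sub>0_mem, of x] m_nonneg(2)[of x]
        by (intro add_mono mult_mono) (auto intro: order_trans[OF abs_ge_zero])
      finally have "\<bar>g x\<bar> * w x \<le> ((m3 x * \<bar>t\<bar>) * (m2 x * \<bar>t\<bar>) + m2 x * (m3 x * t\<^sup>2)) * w x"
        using w(3) by (rule mult_right_mono)
      also have "\<dots> = (2 * t\<^sup>2) * (m3 x * m2 x * w x)"
        by (simp add: algebra_simps power2_eq_square)
      also have "\<dots> \<le> (2 * t\<^sup>2) * V x" using V_ge(11)[of x] by (intro mult_left_mono) auto
      finally show ?thesis .
    qed
    have "(LBINT x. g x * (\<pi> x)\<^sup>2 * w x)
      = (LBINT x. \<mu>1 x (\<theta>\<^sub>0 + t) * (\<mu> x (\<theta>\<^sub>0 + t) - \<mu> x \<theta>\<^sub>0) * (\<pi> x)\<^sup>2 * w x - t * ((\<mu>1 x \<theta>\<^sub>0 * \<pi> x)\<^sup>2 * w x))"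
      by (simp add: g_def power_mult_distrib left_diff_distrib mult.assoc)
    then have "criterion_deriv (\<theta>\<^sub>0 + t) - criterion_deriv \<theta>\<^sub>0 - t * (2 * information)
        = 2 * (LBINT x. g x * (\<pi> x)\<^sup>2 * w x)"
      using integrable_criterion_deriv[OF mem] integrable_information
      by (simp add: criterion_deriv_def information_def)
    then show "\<bar>criterion_deriv (\<theta>\<^sub>0 + t) - criterion_deriv \<theta>\<^sub>0 - t * (2 * information)\<bar>
        \<le> (4 * P\<^sup>2 * (LBINT x. V x)) * t\<^sup>2"
      using integral_remainder_le(1)[OF gm g] by (simp add: abs_mult mult_ac)
  qed
  moreover have "\<forall>\<^sub>F \<theta> in nhds \<theta>\<^sub>0. deriv (criterion \<mu> \<sigma> w \<pi>) \<theta> = criterion_deriv \<theta>"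
    using \<theta>\<^sub>0 eventually_nhds_in_open[of "{a<..<b}" \<theta>\<^sub>0]
    by (auto elim!: eventually_mono intro!: DERIV_imp_deriv criterion_has_derivative)
  ultimately have "(deriv (criterion \<mu> \<sigma> w \<pi>) has_real_derivative 2 * information) (at \<theta>\<^sub>0)"
    by (subst DERIV_cong_ev[OF refl _ refl]) auto
  then show ?thesis by (simp add: numeral_2_eq_2 DERIV_imp_deriv)
qed

text \<open>The density of the linear part of the score: \<open>\<mu>1 \<mu> \<pi> w + (\<mu>1 \<pi> w)' \<sigma>\<^sup>2 / 2\<close> at the true parameter. The
second summand arises when the derivative in the flux is integrated by parts.\<close>

definition influence :: "real \<Rightarrow> real" where
  "influence x = \<mu>1 x \<theta>\<^sub>0 * \<mu> x \<theta>\<^sub>0 * \<pi> x * w x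
     + 1 / 2 * ((\<mu>1x x * \<pi> x + \<mu>1 x \<theta>\<^sub>0 * \<pi>' x) * w x + \<mu>1 x \<theta>\<^sub>0 * \<pi> x * w' x) * (\<sigma> x)\<^sup>2"

lemma weight_le:
  "\<bar>\<mu>1 x \<theta>\<^sub>0 * \<mu> x \<theta>\<^sub>0 * w x\<bar> \<le> V x" "\<bar>\<mu>1x x * w x * (\<sigma> x)\<^sup>2\<bar> \<le> V x"
  "\<bar>\<mu>1 x \<theta>\<^sub>0 * w x * (\<sigma> x)\<^sup>2\<bar> \<le> V x" "\<bar>\<mu>1 x \<theta>\<^sub>0 * w' x * (\<sigma> x)\<^sup>2\<bar> \<le> V x"
  "\<bar>\<mu>1 x \<theta>\<^sub>0 * (\<sigma> x * \<sigma>' x) * w x\<bar> \<le> V x"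
proof -
  note \<mu>1 = \<mu>1_le[OF \<theta>\<^sub>0_mem, of x]
  have *: "\<bar>u * v\<bar> \<le> V x" if "\<bar>u\<bar> \<le> U" "U * \<bar>v\<bar> \<le> V x" for u v U
    using that mult_right_mono[OF that(1), of "\<bar>v\<bar>"] by (simp add: abs_mult)
  have "\<bar>\<mu>1 x \<theta>\<^sub>0 * \<mu> x \<theta>\<^sub>0\<bar> \<le> m2 x * m1 x"
    unfolding abs_mult using m_nonneg[of x] by (intro mult_mono \<mu>1 \<mu>_le \<theta>\<^sub>0_mem) auto
  from *[OF this, of "w x"] show "\<bar>\<mu>1 x \<theta>\<^sub>0 * \<mu> x \<theta>\<^sub>0 * w x\<bar> \<le> V x" using V_ge(4)[of x] w(3)[of x] by simp
  from *[OF \<mu>1x(3)[of x], of "w x * (\<sigma> x)\<^sup>2"] show "\<bar>\<mu>1x x * w x * (\<sigma> x)\<^sup>2\<bar> \<le> V x"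
    using V_ge(5)[of x] w(3)[of x] by (simp add: abs_mult mult_ac)
  from *[OF \<mu>1, of "w x * (\<sigma> x)\<^sup>2"] show "\<bar>\<mu>1 x \<theta>\<^sub>0 * w x * (\<sigma> x)\<^sup>2\<bar> \<le> V x"
    using V_ge(12)[of x] w(3)[of x] by (simp add: abs_mult mult_ac)
  from *[OF \<mu>1, of "w' x * (\<sigma> x)\<^sup>2"] show "\<bar>\<mu>1 x \<theta>\<^sub>0 * w' x * (\<sigma> x)\<^sup>2\<bar> \<le> V x"
    using V_ge(7)[of x] by (simp add: abs_mult mult_ac)
  from *[OF \<mu>1, of "(\<sigma> x * \<sigma>' x) * w x"] show "\<bar>\<mu>1 x \<theta>\<^sub>0 * (\<sigma> x * \<sigma>' x) * w x\<bar> \<le> V x"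
    using V_ge(13)[of x] w(3)[of x] by (simp add: abs_mult mult_ac)
qed

lemma influence_le: "\<bar>influence x\<bar> \<le> 3 * P * V x"
proof -
  have *: "\<bar>u * v\<bar> \<le> P * V x" if "\<bar>u\<bar> \<le> P" "\<bar>v\<bar> \<le> V x" for u v
    unfolding abs_mult using that P_nonneg by (intro mult_mono) auto
  have lin: "\<bar>y1 + 1 / 2 * (y2 + y3 + y4)\<bar> \<le> v + 1 / 2 * (v + v + v)"
    if "\<bar>y1\<bar> \<le> v" "\<bar>y2\<bar> \<le> v" "\<bar>y3\<bar> \<le> v" "\<bar>y4\<bar> \<le> v" for y1 y2 y3 y4 v :: real
    using that unfolding abs_le_iff distrib_left by linarith
  have "influence x = \<pi> x * (\<mu>1 x \<theta>\<^sub>0 * \<mu> x \<theta>\<^sub>0 * w x)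
      + 1 / 2 * (\<pi> x * (\<mu>1x x * w x * (\<sigma> x)\<^sup>2) + \<pi>' x * (\<mu>1 x \<theta>\<^sub>0 * w x * (\<sigma> x)\<^sup>2)
        + \<pi> x * (\<mu>1 x \<theta>\<^sub>0 * w' x * (\<sigma> x)\<^sup>2))"
    unfolding influence_def by (simp add: algebra_simps)
  also have "\<bar>\<dots>\<bar> \<le> P * V x + 1 / 2 * (P * V x + P * V x + P * V x)"
    by (rule lin[OF *[OF \<pi>(3)[of x] weight_le(1)] *[OF \<pi>(3)[of x] weight_le(2)]
      *[OF \<pi>(4)[of x] weight_le(3)] *[OF \<pi>(3)[of x] weight_le(4)]])
  also have "\<dots> \<le> 3 * (P * V x)" using P_nonneg V_nonneg[of x] by simp
  finally show ?thesis by simp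
qed

lemma influence_measurable [measurable]: "influence \<in> borel_measurable borel"
  unfolding influence_def[abs_def] by measurable

lemma influence_integrable: "integrable lborel influence"
  by (rule integrable_dominated[OF influence_measurable influence_le])

text \<open>The boundary terms of both integrations by parts have the form treated here, with \<open>f\<close> built from the
bounded functions \<open>\<pi>\<close> and \<open>q - \<pi>\<close>.\<close>

lemma boundary_vanishes:
  assumes "\<And>x. \<bar>f x\<bar> \<le> C"
  shows "((\<lambda>x. f x * (\<mu>1 x \<theta>\<^sub>0 * w x * (\<sigma> x)\<^sup>2)) \<longlongrightarrow> 0) at_infinity"
proof (rule Lim_null_comparison)
  show "\<forall>\<^sub>F x in at_infinity. norm (f x * (\<mu>1 x \<theta>\<^sub>0 * w x * (\<sigma> x)\<^sup>2)) \<le> C * (m2 x * w x * (\<sigma> x)\<^sup>2)"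
  proof (rule always_eventually, rule allI)
    fix x
    have "\<bar>\<mu>1 x \<theta>\<^sub>0 * w x * (\<sigma> x)\<^sup>2\<bar> \<le> m2 x * w x * (\<sigma> x)\<^sup>2"
      using \<mu>1_le[OF \<theta>\<^sub>0_mem, of x] w(3)[of x] by (auto simp: abs_mult intro!: mult_right_mono)
    then show "norm (f x * (\<mu>1 x \<theta>\<^sub>0 * w x * (\<sigma> x)\<^sup>2)) \<le> C * (m2 x * w x * (\<sigma> x)\<^sup>2)"
      unfolding real_norm_def abs_mult[of "f x"] using assms[of x] by (intro mult_mono) auto
  qed
  show "((\<lambda>x. C * (m2 x * w x * (\<sigma> x)\<^sup>2)) \<longlongrightarrow> 0) at_infinity"
    using tendsto_mult_right_zero[OF boundary] by simp
qed

end

section \<open>Minimisers of a perturbed contrast\<close>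

text \<open>A function \<open>q\<close> to be inserted into the contrast in place of \<open>\<pi>\<close>. The bound \<open>B\<close> on its error makes
all integrals below converge; the quantitative estimates are in terms of \<open>Q0\<close> and \<open>Q1\<close>.\<close>

locale contrast_candidate = contrast_model +
  fixes q q' :: "real \<Rightarrow> real" and B :: real
  assumes q: "\<And>x. (q has_real_derivative q' x) (at x)" "continuous_on UNIV q'"
    and near: "\<And>x. \<bar>q x - \<pi> x\<bar> \<le> B" "\<And>x. \<bar>q' x - \<pi>' x\<bar> \<le> B"
begin

text \<open>\<open>\<rho>\<close> is the residual of the balance equation for \<open>q\<close> at the true parameter: \<open>\<mu> q - flux q q'\<close>, which is
linear in the error \<open>d\<close> because \<open>\<pi>\<close> has residual zero.\<close>

definition d :: "real \<Rightarrow> real" where "d x = q x - \<pi> x"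
definition d' :: "real \<Rightarrow> real" where "d' x = q' x - \<pi>' x"
definition \<rho> :: "real \<Rightarrow> real" where "\<rho> x = \<mu> x \<theta>\<^sub>0 * d x - flux d d' x"
definition Q0 :: real where "Q0 = (LBINT x. V x * (d x)\<^sup>2)"
definition Q1 :: real where "Q1 = (LBINT x. V x * (d' x)\<^sup>2)"

lemma d_deriv: "(d has_real_derivative d' x) (at x)"
  unfolding d_def[abs_def] d'_def using q \<pi> by (intro derivative_intros)

lemma d_cont: "continuous_on UNIV d" "continuous_on UNIV d'"
proof -
  show "continuous_on UNIV d" using d_deriv by (intro DERIV_continuous_on) auto
  show "continuous_on UNIV d'" unfolding d'_def[abs_def] using q(2) \<pi>(2) by (intro continuous_intros)
qed

lemma d_meas [measurable]: "d \<in> borel_measurable borel" "d' \<in> borel_measurable borel"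
  using d_cont by (auto intro: borel_measurable_continuous_onI)

lemma d_le: "\<bar>d x\<bar> \<le> B" "\<bar>d' x\<bar> \<le> B" "(d x)\<^sup>2 \<le> B\<^sup>2" "(d' x)\<^sup>2 \<le> B\<^sup>2"
  using near[of x] power_mono[of "\<bar>d x\<bar>" B 2] power_mono[of "\<bar>d' x\<bar>" B 2] by (auto simp: d_def d'_def)

lemma q_measurable [measurable]: "q \<in> borel_measurable borel" "q' \<in> borel_measurable borel"
  using q by (auto intro!: borel_measurable_continuous_onI DERIV_continuous_on)

lemma integrable_Q: "integrable lborel (\<lambda>x. V x * (d x)\<^sup>2)" "integrable lborel (\<lambda>x. V x * (d' x)\<^sup>2)"
proof -
  show "integrable lborel (\<lambda>x. V x * (d x)\<^sup>2)"
    by (rule integrable_dominated[where c="B\<^sup>2"])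
       (use V_nonneg d_le in \<open>auto simp: abs_mult mult.commute[of "V _"] intro!: mult_right_mono\<close>)
  show "integrable lborel (\<lambda>x. V x * (d' x)\<^sup>2)"
    by (rule integrable_dominated[where c="B\<^sup>2"])
       (use V_nonneg d_le in \<open>auto simp: abs_mult mult.commute[of "V _"] intro!: mult_right_mono\<close>)
qed

lemma Q_nonneg: "0 \<le> Q0" "0 \<le> Q1"
  unfolding Q0_def Q1_def using V_nonneg by (auto intro!: integral_nonneg_AE)

lemma flux_measurable [measurable]: "flux d d' \<in> borel_measurable borel" "flux q q' \<in> borel_measurable borel"
  unfolding flux_def[abs_def] by measurable

lemma \<rho>_measurable [measurable]: "\<rho> \<in> borel_measurable borel"
  unfolding \<rho>_def[abs_def] by measurable

text \<open>The square of a sum of three terms is at most three times the sum of the squares; each of the three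
weights is dominated by \<open>V\<close>.\<close>

lemma residual_sq_le:
  assumes "\<theta> \<in> {a..b}"
  shows "(\<mu> x \<theta> * d x - flux d d' x)\<^sup>2 * w x \<le> 6 * (V x * (d x)\<^sup>2 + V x * (d' x)\<^sup>2)"
proof -
  define A S T where "A = \<mu> x \<theta> * d x" and "S = \<sigma> x * \<sigma>' x * d x" and "T = 1 / 2 * (\<sigma> x)\<^sup>2 * d' x"
  have "(A - (S + T))\<^sup>2 \<le> 3 * (A\<^sup>2 + S\<^sup>2 + T\<^sup>2)"
    using zero_le_power2[of "A + S"] zero_le_power2[of "A + T"] zero_le_power2[of "S - T"]
    by (simp add: power2_eq_square algebra_simps)
  then have "(A - (S + T))\<^sup>2 * w x \<le> 3 * (A\<^sup>2 + S\<^sup>2 + T\<^sup>2) * w x"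
    using w(3) by (rule mult_right_mono)
  also have "\<dots> = 3 * (A\<^sup>2 * w x + S\<^sup>2 * w x + T\<^sup>2 * w x)" by (simp add: algebra_simps)
  also have "A\<^sup>2 * w x \<le> V x * (d x)\<^sup>2"
  proof -
    have "(\<mu> x \<theta>)\<^sup>2 \<le> (m1 x)\<^sup>2" using power_mono[of "\<bar>\<mu> x \<theta>\<bar>" "m1 x" 2] \<mu>_le[OF assms] by simp
    then have "(\<mu> x \<theta>)\<^sup>2 * w x \<le> V x" using V_ge(1)[of x] w(3)[of x] by (meson mult_right_mono order_trans)
    then have "((\<mu> x \<theta>)\<^sup>2 * w x) * (d x)\<^sup>2 \<le> V x * (d x)\<^sup>2" by (rule mult_right_mono) simp
    then show ?thesis by (simp add: A_def power_mult_distrib mult_ac)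
  qed
  also have "S\<^sup>2 * w x \<le> V x * (d x)\<^sup>2"
    using mult_right_mono[OF V_ge(3), of "(d x)\<^sup>2" x] by (simp add: S_def power_mult_distrib mult_ac)
  also have "T\<^sup>2 * w x \<le> V x * (d' x)\<^sup>2"
  proof -
    have "T\<^sup>2 * w x = 1 / 4 * (((\<sigma> x)^4 * w x) * (d' x)\<^sup>2)"
      by (simp add: T_def power_mult_distrib power2_eq_square power4_eq_xxxx)
    also have "\<dots> \<le> 1 / 4 * (V x * (d' x)\<^sup>2)" by (intro mult_left_mono mult_right_mono V_ge) auto
    also have "\<dots> \<le> V x * (d' x)\<^sup>2" using V_nonneg[of x] by simp
    finally show ?thesis .
  qed
  finally have "(A - (S + T))\<^sup>2 * w x \<le> 3 * (V x * (d x)\<^sup>2 + V x * (d x)\<^sup>2 + V x * (d' x)\<^sup>2)"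
    by simp
  also have "\<dots> \<le> 6 * (V x * (d x)\<^sup>2 + V x * (d' x)\<^sup>2)" using V_nonneg[of x] by simp
  finally show ?thesis by (simp add: A_def S_def T_def flux_def)
qed

lemma integrable_residual_sq:
  assumes "\<theta> \<in> {a..b}"
  shows "integrable lborel (\<lambda>x. (\<mu> x \<theta> * d x - flux d d' x)\<^sup>2 * w x)"
proof -
  note [measurable] = \<mu>_meas[OF assms]
  show ?thesis
    by (rule Bochner_Integration.integrable_bound[where f = "\<lambda>x. 6 * (V x * (d x)\<^sup>2 + V x * (d' x)\<^sup>2)"])
       (use integrable_Q residual_sq_le[OF assms] w(3) V_nonneg in \<open>auto\<close>)
qed

lemma integral_residual_sq_le:
  assumes "\<theta> \<in> {a..b}"
  shows "(LBINT x. (\<mu> x \<theta> * d x - flux d d' x)\<^sup>2 * w x) \<le> 6 * (Q0 + Q1)"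
proof -
  have "(LBINT x. (\<mu> x \<theta> * d x - flux d d' x)\<^sup>2 * w x)
      \<le> (LBINT x. 6 * (V x * (d x)\<^sup>2 + V x * (d' x)\<^sup>2))"
    by (rule integral_mono[OF integrable_residual_sq[OF assms]]) (use integrable_Q residual_sq_le[OF assms] in auto)
  also have "\<dots> = 6 * (Q0 + Q1)" using integrable_Q by (simp add: Q0_def Q1_def)
  finally show ?thesis .
qed

lemma empirical_split:
  "\<mu> x \<theta> * q x - flux q q' x = (\<mu> x \<theta> - \<mu> x \<theta>\<^sub>0) * \<pi> x + (\<mu> x \<theta> * d x - flux d d' x)"
  using flux_diff[of q q' x] by (simp add: balance_flux d_def[symmetric] d'_def[symmetric])
     (simp add: d_def algebra_simps)

lemma integrable_criterion_candidate:
  assumes "\<theta> \<in> {a..b}"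
  shows "integrable lborel (\<lambda>x. (\<mu> x \<theta> * q x - flux q q' x)\<^sup>2 * w x)"
proof -
  note [measurable] = \<mu>_meas[OF assms]
  have le: "(\<mu> x \<theta> * q x - flux q q' x)\<^sup>2 * w x
      \<le> 2 * (((\<mu> x \<theta> - \<mu> x \<theta>\<^sub>0) * \<pi> x)\<^sup>2 * w x) + 2 * ((\<mu> x \<theta> * d x - flux d d' x)\<^sup>2 * w x)" for x
    using mult_right_mono[OF power2_sum_le w(3)[of x]] unfolding empirical_split
    by (simp only: distrib_right mult.assoc)
  show ?thesis
    by (rule Bochner_Integration.integrable_bound[where f = "\<lambda>x. 2 * (((\<mu> x \<theta> - \<mu> x \<theta>\<^sub>0) * \<pi> x)\<^sup>2 * w x)
          + 2 * ((\<mu> x \<theta> * d x - flux d d' x)\<^sup>2 * w x)"])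
       (use integrable_criterion_truth[OF assms] integrable_residual_sq[OF assms] le w(3) in auto)
qed

text \<open>The contrast is a squared weighted \<open>L\<^sup>2\<close>-norm, so replacing \<open>q\<close> by \<open>\<pi>\<close> changes it by at most a factor two and
the squared norm of the residual of the error. A minimiser for \<open>q\<close> is thus an almost-minimiser for \<open>\<pi>\<close>; with
identifiability this is consistency.\<close>

lemma criterion_minimiser_le:
  assumes mem: "\<theta> \<in> {a..b}" and min: "criterion \<mu> \<sigma> w q \<theta> \<le> criterion \<mu> \<sigma> w q \<theta>\<^sub>0"
  shows "criterion \<mu> \<sigma> w \<pi> \<theta> \<le> 24 * (Q0 + Q1)"
proof -
  have le: "((\<mu> x \<theta> - \<mu> x \<theta>\<^sub>0) * \<pi> x)\<^sup>2 * w x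
      \<le> 2 * ((\<mu> x \<theta> * q x - flux q q' x)\<^sup>2 * w x) + 2 * ((\<mu> x \<theta> * d x - flux d d' x)\<^sup>2 * w x)" for x
  proof -
    have "((\<mu> x \<theta> - \<mu> x \<theta>\<^sub>0) * \<pi> x)\<^sup>2
        = ((\<mu> x \<theta> * q x - flux q q' x) + - (\<mu> x \<theta> * d x - flux d d' x))\<^sup>2"
      unfolding empirical_split by simp
    also have "\<dots> \<le> 2 * (\<mu> x \<theta> * q x - flux q q' x)\<^sup>2 + 2 * (- (\<mu> x \<theta> * d x - flux d d' x))\<^sup>2"
      by (rule power2_sum_le)
    finally have "((\<mu> x \<theta> - \<mu> x \<theta>\<^sub>0) * \<pi> x)\<^sup>2 * w x
        \<le> (2 * (\<mu> x \<theta> * q x - flux q q' x)\<^sup>2 + 2 * (- (\<mu> x \<theta> * d x - flux d d' x))\<^sup>2) * w x"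
      using w(3) by (rule mult_right_mono)
    then show ?thesis unfolding power2_minus by (simp only: distrib_right mult.assoc)
  qed
  have "criterion \<mu> \<sigma> w \<pi> \<theta> \<le> (LBINT x. 2 * ((\<mu> x \<theta> * q x - flux q q' x)\<^sup>2 * w x)
       + 2 * ((\<mu> x \<theta> * d x - flux d d' x)\<^sup>2 * w x))"
    unfolding criterion_truth
    by (rule integral_mono[OF integrable_criterion_truth[OF mem]])
       (use integrable_criterion_candidate[OF mem] integrable_residual_sq[OF mem] le in auto)
  also have "\<dots> = 2 * criterion \<mu> \<sigma> w q \<theta> + 2 * (LBINT x. (\<mu> x \<theta> * d x - flux d d' x)\<^sup>2 * w x)"
    using integrable_criterion_candidate[OF mem] integrable_residual_sq[OF mem]
    by (simp add: criterion_eq[of q q', OF q(1)])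
  also have "\<dots> \<le> 2 * criterion \<mu> \<sigma> w q \<theta>\<^sub>0 + 2 * (6 * (Q0 + Q1))"
    using min integral_residual_sq_le[OF mem] by simp
  also have "criterion \<mu> \<sigma> w q \<theta>\<^sub>0 \<le> 6 * (Q0 + Q1)"
    using integral_residual_sq_le[OF \<theta>\<^sub>0_mem] by (simp add: criterion_eq[of q q', OF q(1)] empirical_split)
  finally show ?thesis by simp
qed

text \<open>The factor \<open>q\<close> is not small, so the left-hand side contains first powers of the errors. Young's
inequality \<open>2 * \<bar>u\<bar> \<le> \<eta> + u\<^sup>2 / \<eta>\<close> turns first powers of the errors into squares.\<close>

lemma score_remainder_le:
  assumes \<eta>: "0 < \<eta>"
  shows "m3 x * \<bar>q x\<bar> * \<bar>\<rho> x\<bar> * w x \<le> 2 * P * \<eta> * V x + (P / \<eta> + 3) * (V x * (d x)\<^sup>2 + V x * (d' x)\<^sup>2)"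
proof -
  have "\<bar>\<rho> x\<bar> \<le> \<bar>\<mu> x \<theta>\<^sub>0 * d x\<bar> + (\<bar>\<sigma> x * \<sigma>' x * d x\<bar> + \<bar>1 / 2 * (\<sigma> x)\<^sup>2 * d' x\<bar>)"
    unfolding \<rho>_def flux_def by linarith
  also have "\<dots> \<le> m1 x * \<bar>d x\<bar> + (\<bar>\<sigma> x * \<sigma>' x\<bar> * \<bar>d x\<bar> + (\<sigma> x)\<^sup>2 * \<bar>d' x\<bar>)"
    using \<mu>_le[OF \<theta>\<^sub>0_mem, of x] by (auto simp: abs_mult intro!: add_mono mult_right_mono)
  finally have "(m3 x * w x) * \<bar>\<rho> x\<bar> \<le> (m3 x * w x) * (m1 x * \<bar>d x\<bar> + (\<bar>\<sigma> x * \<sigma>' x\<bar> * \<bar>d x\<bar> + (\<sigma> x)\<^sup>2 * \<bar>d' x\<bar>))"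
    using m_nonneg(3)[of x] w(3)[of x] by (intro mult_left_mono) auto
  also have "\<dots> = (m3 x * m1 x * w x) * \<bar>d x\<bar> + (m3 x * \<bar>\<sigma> x * \<sigma>' x\<bar> * w x) * \<bar>d x\<bar> + (m3 x * (\<sigma> x)\<^sup>2 * w x) * \<bar>d' x\<bar>"
    by (simp add: algebra_simps)
  also have "\<dots> \<le> V x * \<bar>d x\<bar> + V x * \<bar>d x\<bar> + V x * \<bar>d' x\<bar>"
    by (intro add_mono mult_right_mono V_ge) auto
  finally have 1: "(m3 x * w x) * \<bar>\<rho> x\<bar> \<le> V x * (2 * \<bar>d x\<bar> + \<bar>d' x\<bar>)" by (simp add: algebra_simps)
  have "\<bar>q x\<bar> \<le> P + \<bar>d x\<bar>" using \<pi>(3)[of x] by (simp add: d_def)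
  then have "m3 x * \<bar>q x\<bar> * \<bar>\<rho> x\<bar> * w x \<le> (P + \<bar>d x\<bar>) * (V x * (2 * \<bar>d x\<bar> + \<bar>d' x\<bar>))"
    using mult_mono[OF _ 1, of "\<bar>q x\<bar>" "P + \<bar>d x\<bar>"] P_nonneg m_nonneg(3)[of x] w(3)[of x]
    by (simp add: mult_ac)
  also have "\<dots> = V x * ((P + \<bar>d x\<bar>) * (2 * \<bar>d x\<bar> + \<bar>d' x\<bar>))" by simp
  finally have 2: "m3 x * \<bar>q x\<bar> * \<bar>\<rho> x\<bar> * w x \<le> V x * ((P + \<bar>d x\<bar>) * (2 * \<bar>d x\<bar> + \<bar>d' x\<bar>))" .
  have 3: "(P + \<bar>d x\<bar>) * (2 * \<bar>d x\<bar> + \<bar>d' x\<bar>) \<le> 2 * P * \<eta> + (P / \<eta> + 3) * ((d x)\<^sup>2 + (d' x)\<^sup>2)"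
  proof -
    have young: "2 * \<bar>u\<bar> \<le> \<eta> + u\<^sup>2 / \<eta>" for u
    proof -
      have "0 \<le> (\<bar>u\<bar> - \<eta>)\<^sup>2 / \<eta>" using \<eta> by simp
      also have "\<dots> = u\<^sup>2 / \<eta> + \<eta> - 2 * \<bar>u\<bar>" using \<eta> by (simp add: field_simps power2_eq_square)
      finally show ?thesis by simp
    qed
    have "2 * \<bar>d x\<bar> + \<bar>d' x\<bar> \<le> (\<eta> + (d x)\<^sup>2 / \<eta>) + (\<eta> + (d' x)\<^sup>2 / \<eta>)"
      using young[of "d x"] young[of "d' x"] by linarith
    then have "P * (2 * \<bar>d x\<bar> + \<bar>d' x\<bar>) \<le> P * ((\<eta> + (d x)\<^sup>2 / \<eta>) + (\<eta> + (d' x)\<^sup>2 / \<eta>))"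
      using P_nonneg by (rule mult_left_mono)
    moreover have "\<bar>d x\<bar> * (2 * \<bar>d x\<bar> + \<bar>d' x\<bar>) \<le> 3 * ((d x)\<^sup>2 + (d' x)\<^sup>2)"
    proof -
      have "2 * (\<bar>d x\<bar> * \<bar>d' x\<bar>) \<le> \<bar>d x\<bar>\<^sup>2 + \<bar>d' x\<bar>\<^sup>2"
        using sum_squares_bound[of "\<bar>d x\<bar>" "\<bar>d' x\<bar>"] by simp
      moreover have "\<bar>d x\<bar> * (2 * \<bar>d x\<bar> + \<bar>d' x\<bar>) = 2 * (d x)\<^sup>2 + \<bar>d x\<bar> * \<bar>d' x\<bar>"
        by (simp add: algebra_simps power2_eq_square)
      ultimately show ?thesis using zero_le_power2[of "d x"] zero_le_power2[of "d' x"]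
        unfolding distrib_left[of 3] power2_abs by linarith
    qed
    ultimately show ?thesis by (simp add: algebra_simps add_divide_distrib)
  qed
  note 2
  also have "V x * ((P + \<bar>d x\<bar>) * (2 * \<bar>d x\<bar> + \<bar>d' x\<bar>))
      \<le> V x * (2 * P * \<eta> + (P / \<eta> + 3) * ((d x)\<^sup>2 + (d' x)\<^sup>2))"
    by (rule mult_left_mono[OF 3 V_nonneg])
  also have "\<dots> = 2 * P * \<eta> * V x + (P / \<eta> + 3) * (V x * (d x)\<^sup>2 + V x * (d' x)\<^sup>2)"
    by (simp add: algebra_simps)
  finally show ?thesis .
qed

text \<open>Half the derivative of the empirical contrast at the true parameter.\<close>

definition score :: real where
  "score = (LBINT x. \<mu>1 x \<theta>\<^sub>0 * q x * \<rho> x * w x)"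

lemma integrable_weighted_residual:
  assumes [measurable]: "k \<in> borel_measurable borel" and k: "\<And>x. (k x)\<^sup>2 * w x \<le> c * V x"
  shows "integrable lborel (\<lambda>x. k x * \<rho> x * w x)"
proof (rule Bochner_Integration.integrable_bound)
  show "integrable lborel (\<lambda>x. c * V x + (\<mu> x \<theta>\<^sub>0 * d x - flux d d' x)\<^sup>2 * w x)"
    using V integrable_residual_sq[OF \<theta>\<^sub>0_mem] by auto
  show "AE x in lborel. norm (k x * \<rho> x * w x) \<le> norm (c * V x + (\<mu> x \<theta>\<^sub>0 * d x - flux d d' x)\<^sup>2 * w x)"
  proof (rule AE_I2)
    fix x
    have "2 * (\<bar>k x\<bar> * \<bar>\<rho> x\<bar>) \<le> (k x)\<^sup>2 + (\<rho> x)\<^sup>2"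
      using sum_squares_bound[of "\<bar>k x\<bar>" "\<bar>\<rho> x\<bar>"] by simp
    moreover have "0 \<le> \<bar>k x\<bar> * \<bar>\<rho> x\<bar>" by simp
    ultimately have "\<bar>k x\<bar> * \<bar>\<rho> x\<bar> \<le> (k x)\<^sup>2 + (\<rho> x)\<^sup>2" by linarith
    from mult_right_mono[OF this w(3)[of x]]
    have "\<bar>k x\<bar> * \<bar>\<rho> x\<bar> * w x \<le> (k x)\<^sup>2 * w x + (\<rho> x)\<^sup>2 * w x" unfolding distrib_right .
    also have "\<dots> \<le> c * V x + (\<rho> x)\<^sup>2 * w x" by (rule add_right_mono[OF k])
    finally show "norm (k x * \<rho> x * w x) \<le> norm (c * V x + (\<mu> x \<theta>\<^sub>0 * d x - flux d d' x)\<^sup>2 * w x)"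
      using w(3)[of x] by (simp add: abs_mult \<rho>_def)
  qed
qed measurable

lemma q_le: "\<bar>q x\<bar> \<le> P + B" "(q x)\<^sup>2 \<le> (P + B)\<^sup>2"
proof -
  show "\<bar>q x\<bar> \<le> P + B" using near(1)[of x] \<pi>(3)[of x] by linarith
  then show "(q x)\<^sup>2 \<le> (P + B)\<^sup>2" using power_mono[of "\<bar>q x\<bar>" "P + B" 2] by simp
qed

text \<open>Comparison of the values of the contrast at a minimiser and at the truth. With
\<open>m = \<mu> x \<theta> - \<mu> x \<theta>\<^sub>0\<close> the difference of the two integrands is \<open>(m\<^sup>2 q\<^sup>2 + 2 m q \<rho>) w\<close>, and its integral is not
positive. Writing \<open>m = D * \<mu>1 x \<theta>\<^sub>0 + r\<close> with \<open>D = \<theta> - \<theta>\<^sub>0\<close> and \<open>r\<close> quadratic in \<open>D\<close>, the first term is at least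
\<open>D\<^sup>2 * information / 2\<close> up to errors, and the second is \<open>2 * D * score\<close> up to an error of order \<open>D\<^sup>2\<close> with a
small factor; dividing by \<open>\<bar>D\<bar>\<close> gives the claim.\<close>

lemma minimiser_quadratic_inequality:
  assumes mem: "\<theta> \<in> {a..b}" and min: "criterion \<mu> \<sigma> w q \<theta> \<le> criterion \<mu> \<sigma> w q \<theta>\<^sub>0" and \<eta>: "0 < \<eta>"
  defines "vv \<equiv> (LBINT x. V x)"
  shows "\<bar>\<theta> - \<theta>\<^sub>0\<bar> * (information / 2 - 2 * Q0 - 4 * P\<^sup>2 * \<bar>\<theta> - \<theta>\<^sub>0\<bar> * vv
            - 2 * (2 * P * \<eta> * vv + (P / \<eta> + 3) * (Q0 + Q1))) \<le> 2 * \<bar>score\<bar>"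
proof -
  note [measurable] = \<mu>_meas[OF mem]
  define D where "D = \<theta> - \<theta>\<^sub>0"
  define m where "m = (\<lambda>x. \<mu> x \<theta> - \<mu> x \<theta>\<^sub>0)"
  define r where "r = (\<lambda>x. m x - D * \<mu>1 x \<theta>\<^sub>0)"
  have [measurable]: "m \<in> borel_measurable borel" unfolding m_def by measurable
  have m_le: "\<bar>m x\<bar> \<le> m2 x * \<bar>D\<bar>" for x
    unfolding m_def D_def by (rule drift_Lipschitz[OF mem \<theta>\<^sub>0_mem])
  have r1: "\<bar>r x\<bar> \<le> m3 x * D\<^sup>2" for x
    unfolding r_def m_def D_def using drift_Taylor[OF mem \<theta>\<^sub>0_mem] by simp
  have r2: "\<bar>r x\<bar> \<le> 2 * (m2 x * \<bar>D\<bar>)" for x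
  proof -
    have "\<bar>D * \<mu>1 x \<theta>\<^sub>0\<bar> \<le> \<bar>D\<bar> * m2 x" unfolding abs_mult by (intro mult_left_mono \<mu>1_le \<theta>\<^sub>0_mem) auto
    then show ?thesis unfolding r_def using m_le[of x] by (simp add: mult.commute)
  qed
  have msq: "(m x)\<^sup>2 * w x \<le> D\<^sup>2 * V x" for x
  proof -
    have "(m x)\<^sup>2 \<le> (m2 x * \<bar>D\<bar>)\<^sup>2" using power_mono[OF m_le, of x 2] by simp
    then have "(m x)\<^sup>2 * w x \<le> (m2 x * \<bar>D\<bar>)\<^sup>2 * w x" using w(3) by (rule mult_right_mono)
    also have "\<dots> = D\<^sup>2 * ((m2 x)\<^sup>2 * w x)" by (simp add: power_mult_distrib)
    also have "\<dots> \<le> D\<^sup>2 * V x" using V_ge(6) by (intro mult_left_mono) auto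
    finally show ?thesis .
  qed
  \<comment> \<open>One factor \<open>r\<close> is estimated as quadratic in \<open>D\<close> and the other as linear: the weight \<open>m3 * m2 * w\<close> that appears is dominated by \<open>V\<close>, whereas \<open>m3\<^sup>2 * w\<close> need not be.\<close>
  have rsq: "(r x)\<^sup>2 * w x \<le> 2 * \<bar>D\<bar>^3 * V x" for x
  proof -
    have "(r x)\<^sup>2 = \<bar>r x\<bar> * \<bar>r x\<bar>" by (simp add: power2_eq_square)
    also have "\<dots> \<le> (m3 x * D\<^sup>2) * (2 * (m2 x * \<bar>D\<bar>))"
      using m_nonneg by (intro mult_mono r1 r2) auto
    finally have "(r x)\<^sup>2 * w x \<le> (m3 x * D\<^sup>2) * (2 * (m2 x * \<bar>D\<bar>)) * w x" using w(3) by (rule mult_right_mono)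
    also have "\<dots> = 2 * (\<bar>D\<bar>\<^sup>2 * \<bar>D\<bar>) * (m3 x * m2 x * w x)" by (simp add: mult_ac)
    also have "\<dots> \<le> 2 * (\<bar>D\<bar>\<^sup>2 * \<bar>D\<bar>) * V x" using V_ge(11) by (intro mult_left_mono) auto
    also have "\<bar>D\<bar>\<^sup>2 * \<bar>D\<bar> = \<bar>D\<bar>^3" by (simp add: power2_eq_square power3_eq_cube)
    finally show ?thesis .
  qed
  have qsq: "(q x)\<^sup>2 * u \<le> (P + B)\<^sup>2 * c" if "0 \<le> u" "u \<le> c" for x u c
    using q_le(2) that by (intro mult_mono) auto
  have int1: "integrable lborel (\<lambda>x. (m x)\<^sup>2 * (q x)\<^sup>2 * w x)"
  proof (rule integrable_dominated[where c = "(P + B)\<^sup>2 * D\<^sup>2"])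
    fix x
    show "\<bar>(m x)\<^sup>2 * (q x)\<^sup>2 * w x\<bar> \<le> (P + B)\<^sup>2 * D\<^sup>2 * V x"
      using qsq[OF _ msq[of x], of x] w(3)[of x] by (simp add: abs_mult mult_ac)
  qed measurable
  have int2: "integrable lborel (\<lambda>x. (m x * q x) * \<rho> x * w x)"
  proof (rule integrable_weighted_residual[where c = "(P + B)\<^sup>2 * D\<^sup>2"])
    fix x
    show "(m x * q x)\<^sup>2 * w x \<le> (P + B)\<^sup>2 * D\<^sup>2 * V x"
      using qsq[OF _ msq[of x], of x] w(3)[of x] by (simp add: power_mult_distrib mult_ac)
  qed measurable
  have int3: "integrable lborel (\<lambda>x. (\<mu>1 x \<theta>\<^sub>0 * q x) * \<rho> x * w x)"
  proof (rule integrable_weighted_residual[where c = "(P + B)\<^sup>2"])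
    fix x
    note score_weight_le[of x]
    from qsq[OF _ this, of x]
    show "(\<mu>1 x \<theta>\<^sub>0 * q x)\<^sup>2 * w x \<le> (P + B)\<^sup>2 * V x"
      using w(3)[of x] by (simp add: power_mult_distrib mult_ac)
  qed measurable
  have int4: "integrable lborel (\<lambda>x. (\<rho> x)\<^sup>2 * w x)"
    using integrable_residual_sq[OF \<theta>\<^sub>0_mem] by (simp add: \<rho>_def)
  have split: "\<mu> x \<theta> * q x - flux q q' x = m x * q x + \<rho> x" for x
    unfolding empirical_split \<rho>_def m_def d_def by (simp add: algebra_simps)
  have split0: "\<mu> x \<theta>\<^sub>0 * q x - flux q q' x = \<rho> x" for x
    unfolding empirical_split \<rho>_def by simp
  have "criterion \<mu> \<sigma> w q \<theta>
      = (LBINT x. (m x)\<^sup>2 * (q x)\<^sup>2 * w x + 2 * ((m x * q x) * \<rho> x * w x) + (\<rho> x)\<^sup>2 * w x)"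
    unfolding criterion_eq[of q q', OF q(1)] split
    by (intro Bochner_Integration.integral_cong refl) (simp add: power2_eq_square algebra_simps)
  also have "\<dots> = (LBINT x. (m x)\<^sup>2 * (q x)\<^sup>2 * w x + 2 * ((m x * q x) * \<rho> x * w x)) + (LBINT x. (\<rho> x)\<^sup>2 * w x)"
    using int1 int2 int4 by simp
  also have "(LBINT x. (\<rho> x)\<^sup>2 * w x) = criterion \<mu> \<sigma> w q \<theta>\<^sub>0"
    unfolding criterion_eq[of q q', OF q(1)] split0 ..
  finally have neg: "(LBINT x. (m x)\<^sup>2 * (q x)\<^sup>2 * w x + 2 * ((m x * q x) * \<rho> x * w x)) \<le> 0"
    using min by simp
  \<comment> \<open>A pointwise lower bound of the integrand whose integral consists of the terms of the claim.\<close>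
  define low where "low = (\<lambda>x. D\<^sup>2 / 2 * ((\<mu>1 x \<theta>\<^sub>0 * \<pi> x)\<^sup>2 * w x) - 2 * D\<^sup>2 * (V x * (d x)\<^sup>2) - 4 * P\<^sup>2 * \<bar>D\<bar>^3 * V x
      + 2 * D * ((\<mu>1 x \<theta>\<^sub>0 * q x) * \<rho> x * w x)
      - 2 * D\<^sup>2 * (2 * P * \<eta> * V x + (P / \<eta> + 3) * (V x * (d x)\<^sup>2 + V x * (d' x)\<^sup>2)))"
  have low_le: "low x \<le> (m x)\<^sup>2 * (q x)\<^sup>2 * w x + 2 * ((m x * q x) * \<rho> x * w x)" for x
  proof -
    have dec: "D * (\<mu>1 x \<theta>\<^sub>0 * \<pi> x) = m x * q x + - (m x * d x + r x * \<pi> x)"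
      by (simp add: r_def d_def algebra_simps)
    have "(D * (\<mu>1 x \<theta>\<^sub>0 * \<pi> x))\<^sup>2 = (m x * q x + - (m x * d x + r x * \<pi> x))\<^sup>2"
      unfolding dec ..
    also have "\<dots> \<le> 2 * (m x * q x)\<^sup>2 + 2 * (- (m x * d x + r x * \<pi> x))\<^sup>2" by (rule power2_sum_le)
    also have "(- (m x * d x + r x * \<pi> x))\<^sup>2 \<le> 2 * (m x * d x)\<^sup>2 + 2 * (r x * \<pi> x)\<^sup>2"
      using power2_sum_le[of "m x * d x" "r x * \<pi> x"] by (simp only: power2_minus)
    finally have "(D * (\<mu>1 x \<theta>\<^sub>0 * \<pi> x))\<^sup>2 * w x
        \<le> (2 * (m x * q x)\<^sup>2 + 2 * (2 * (m x * d x)\<^sup>2 + 2 * (r x * \<pi> x)\<^sup>2)) * w x"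
      using w(3) by (intro mult_right_mono) auto
    then have A: "D\<^sup>2 * ((\<mu>1 x \<theta>\<^sub>0 * \<pi> x)\<^sup>2 * w x)
        \<le> 2 * ((m x)\<^sup>2 * (q x)\<^sup>2 * w x) + 4 * ((d x)\<^sup>2 * ((m x)\<^sup>2 * w x)) + 4 * ((\<pi> x)\<^sup>2 * ((r x)\<^sup>2 * w x))"
      by (simp add: power_mult_distrib algebra_simps)
    have B: "(d x)\<^sup>2 * ((m x)\<^sup>2 * w x) \<le> (d x)\<^sup>2 * (D\<^sup>2 * V x)"
      by (intro mult_left_mono msq) auto
    have C: "(\<pi> x)\<^sup>2 * ((r x)\<^sup>2 * w x) \<le> P\<^sup>2 * (2 * \<bar>D\<bar>^3 * V x)"
      using w(3)[of x] by (intro \<pi>_sq_mult_le rsq) auto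
    have "\<bar>r x * q x * \<rho> x * w x\<bar> = \<bar>r x\<bar> * (\<bar>q x\<bar> * \<bar>\<rho> x\<bar> * w x)"
      using w(3)[of x] by (simp add: abs_mult)
    also have "\<dots> \<le> (m3 x * D\<^sup>2) * (\<bar>q x\<bar> * \<bar>\<rho> x\<bar> * w x)"
      using w(3)[of x] by (intro mult_right_mono r1) auto
    also have "\<dots> = D\<^sup>2 * (m3 x * \<bar>q x\<bar> * \<bar>\<rho> x\<bar> * w x)" by simp
    also have "\<dots> \<le> D\<^sup>2 * (2 * P * \<eta> * V x + (P / \<eta> + 3) * (V x * (d x)\<^sup>2 + V x * (d' x)\<^sup>2))"
      by (intro mult_left_mono score_remainder_le \<eta>) auto
    finally have E: "- (r x * q x * \<rho> x * w x)
        \<le> D\<^sup>2 * (2 * P * \<eta> * V x + (P / \<eta> + 3) * (V x * (d x)\<^sup>2 + V x * (d' x)\<^sup>2))" by linarith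
    have F: "(m x * q x) * \<rho> x * w x = D * ((\<mu>1 x \<theta>\<^sub>0 * q x) * \<rho> x * w x) + r x * q x * \<rho> x * w x"
      by (simp add: r_def algebra_simps)
    define R where "R = D\<^sup>2 * (2 * P * \<eta> * V x + (P / \<eta> + 3) * (V x * (d x)\<^sup>2 + V x * (d' x)\<^sup>2))"
    have G: "low x = (D\<^sup>2 * ((\<mu>1 x \<theta>\<^sub>0 * \<pi> x)\<^sup>2 * w x)) / 2 - 2 * ((d x)\<^sup>2 * (D\<^sup>2 * V x)) - 2 * (P\<^sup>2 * (2 * \<bar>D\<bar>^3 * V x))
        + 2 * (D * ((\<mu>1 x \<theta>\<^sub>0 * q x) * \<rho> x * w x)) - 2 * R"
      by (simp add: low_def R_def mult_ac)
    have "c0 / 2 - 2 * c2 - 2 * c4 + 2 * s - 2 * t \<le> u + 2 * (s + e)"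
      if "c0 \<le> 2 * u + 4 * c1 + 4 * c3" "c1 \<le> c2" "c3 \<le> c4" "- e \<le> t" for c0 c1 c2 c3 c4 s t u e :: real
      using that by simp
    from this[OF A B C E[folded R_def]] show ?thesis unfolding G F .
  qed
  define j1 where "j1 = (\<lambda>x. (\<mu>1 x \<theta>\<^sub>0 * \<pi> x)\<^sup>2 * w x)"
  define j2 where "j2 = (\<lambda>x. (\<mu>1 x \<theta>\<^sub>0 * q x) * \<rho> x * w x)"
  define k0 where "k0 = (\<lambda>x. V x * (d x)\<^sup>2)"
  define k1 where "k1 = (\<lambda>x. V x * (d' x)\<^sup>2)"
  have ints: "integrable lborel j1" "integrable lborel j2" "integrable lborel k0" "integrable lborel k1"
    unfolding j1_def j2_def k0_def k1_def using integrable_information integrable_Q int3 by auto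
  have vals: "(LBINT x. j1 x) = information" "(LBINT x. j2 x) = score"
    "(LBINT x. k0 x) = Q0" "(LBINT x. k1 x) = Q1" "(LBINT x. V x) = vv"
    unfolding j1_def j2_def k0_def k1_def information_def score_def Q0_def Q1_def vv_def by auto
  have lin: "x1 - x2 - x3 - x5 \<le> y"
    if "z = x1 - x2 - x3 + x4 - x5" "z \<le> 0" "- x4 \<le> y" for x1 x2 x3 x4 x5 y z :: real
    using that by linarith
  define U where "U = 2 * P * \<eta> * vv + (P / \<eta> + 3) * (Q0 + Q1)"
  have low_eq: "low = (\<lambda>x. D\<^sup>2 / 2 * j1 x - 2 * D\<^sup>2 * k0 x - 4 * P\<^sup>2 * \<bar>D\<bar>^3 * V x + 2 * D * j2 x
      - 2 * D\<^sup>2 * (2 * P * \<eta> * V x + (P / \<eta> + 3) * (k0 x + k1 x)))"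
    unfolding low_def j1_def j2_def k0_def k1_def ..
  have int_low: "integrable lborel low" unfolding low_eq
    using ints V by (intro Bochner_Integration.integrable_add Bochner_Integration.integrable_diff integrable_mult_right)
  have "(LBINT x. low x) = D\<^sup>2 / 2 * information - 2 * D\<^sup>2 * Q0 - 4 * P\<^sup>2 * \<bar>D\<bar>^3 * vv + 2 * D * score
      - 2 * D\<^sup>2 * U"
    unfolding low_eq U_def using ints V by (simp add: vals)
  moreover have "(LBINT x. low x) \<le> 0"
  proof (rule order_trans[OF integral_mono neg])
    show "integrable lborel (\<lambda>x. (m x)\<^sup>2 * (q x)\<^sup>2 * w x + 2 * ((m x * q x) * \<rho> x * w x))"
      by (intro Bochner_Integration.integrable_add integrable_mult_right int1 int2)
  qed (rule int_low, rule low_le)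
  moreover have "- (2 * D * score) \<le> \<bar>D\<bar> * (2 * \<bar>score\<bar>)"
  proof -
    have "- (2 * D * score) \<le> \<bar>2 * D * score\<bar>" by (rule abs_ge_minus_self)
    also have "\<dots> = \<bar>D\<bar> * (2 * \<bar>score\<bar>)" by (simp add: abs_mult)
    finally show ?thesis .
  qed
  ultimately have "D\<^sup>2 / 2 * information - 2 * D\<^sup>2 * Q0 - 4 * P\<^sup>2 * \<bar>D\<bar>^3 * vv - 2 * D\<^sup>2 * U \<le> \<bar>D\<bar> * (2 * \<bar>score\<bar>)"
    by (rule lin)
  also have "\<bar>D\<bar>^3 = D\<^sup>2 * \<bar>D\<bar>" by (simp add: power3_eq_cube power2_eq_square)
  also have "D\<^sup>2 / 2 * information - 2 * D\<^sup>2 * Q0 - 4 * P\<^sup>2 * (D\<^sup>2 * \<bar>D\<bar>) * vv - 2 * D\<^sup>2 * U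
      = D\<^sup>2 * (information / 2 - 2 * Q0 - 4 * P\<^sup>2 * \<bar>D\<bar> * vv - 2 * U)" (is "_ = D\<^sup>2 * ?c")
    by (simp add: algebra_simps)
  finally have "D\<^sup>2 * ?c \<le> \<bar>D\<bar> * (2 * \<bar>score\<bar>)" .
  moreover have "D\<^sup>2 * ?c = \<bar>D\<bar> * (\<bar>D\<bar> * ?c)" by (simp add: power2_eq_square mult.assoc[symmetric])
  ultimately have le: "\<bar>D\<bar> * (\<bar>D\<bar> * ?c) \<le> \<bar>D\<bar> * (2 * \<bar>score\<bar>)" by (simp only:)
  have "\<bar>D\<bar> * ?c \<le> 2 * \<bar>score\<bar>"
  proof (cases "D = 0")
    case False
    then have "0 < \<bar>D\<bar>" by simp
    with le show ?thesis by (rule mult_left_le_imp_le)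
  qed simp
  then show ?thesis unfolding D_def U_def .
qed

text \<open>Integration by parts of \<open>\<mu>1 \<pi> w\<close> against the flux of \<open>d\<close> removes the derivative of \<open>d\<close>. What remains is an
integral of \<open>d\<close> against a fixed function, which can be estimated at the parametric rate.\<close>

lemma score_linear_part:
  "integrable lborel (\<lambda>x. \<mu>1 x \<theta>\<^sub>0 * \<pi> x * \<rho> x * w x)"
  "(LBINT x. \<mu>1 x \<theta>\<^sub>0 * \<pi> x * \<rho> x * w x) = (LBINT x. influence x * d x)"
proof -
  define F where "F = (\<lambda>x. 1 / 2 * (\<mu>1 x \<theta>\<^sub>0 * \<pi> x * w x * (\<sigma> x)\<^sup>2 * d x))"
  define F' where "F' = (\<lambda>x. 1 / 2 * (((\<mu>1x x * \<pi> x + \<mu>1 x \<theta>\<^sub>0 * \<pi>' x) * w x + \<mu>1 x \<theta>\<^sub>0 * \<pi> x * w' x) * (\<sigma> x)\<^sup>2 * d x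
      + \<mu>1 x \<theta>\<^sub>0 * \<pi> x * w x * (2 * \<sigma> x * \<sigma>' x * d x + (\<sigma> x)\<^sup>2 * d' x)))"
  have F: "(F has_real_derivative F' x) (at x)" for x
    unfolding F_def F'_def
    by (auto intro!: derivative_eq_intros \<mu>1x(1) \<pi>(1) w(1) \<sigma>(1) d_deriv simp: algebra_simps power2_eq_square)
  have F'c: "continuous_on UNIV F'" unfolding F'_def
    by (intro continuous_intros coefficients_continuous \<pi>(2) \<sigma>(2) w(2) \<mu>1x(2) d_cont)
  have lim: "(F \<longlongrightarrow> 0) at_infinity"
  proof -
    have le: "\<bar>1 / 2 * \<pi> x * d x\<bar> \<le> 1 / 2 * P * B" for x
      unfolding abs_mult using \<pi>(3)[of x] d_le(1)[of x] P_nonneg by (intro mult_mono) auto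
    show ?thesis
      using boundary_vanishes[of "\<lambda>x. 1 / 2 * \<pi> x * d x", OF le] by (simp add: F_def mult_ac)
  qed
  have int1: "integrable lborel (\<lambda>x. \<mu>1 x \<theta>\<^sub>0 * \<pi> x * \<rho> x * w x)"
  proof (rule integrable_weighted_residual[where c = "P\<^sup>2"])
    fix x
    note score_weight_le[of x]
    from \<pi>_sq_mult_le[OF _ this, of x] show "(\<mu>1 x \<theta>\<^sub>0 * \<pi> x)\<^sup>2 * w x \<le> P\<^sup>2 * V x"
      using w(3)[of x] by (simp add: power_mult_distrib mult_ac)
  qed measurable
  then show "integrable lborel (\<lambda>x. \<mu>1 x \<theta>\<^sub>0 * \<pi> x * \<rho> x * w x)" .
  have int2: "integrable lborel (\<lambda>x. influence x * d x)"
  proof (rule integrable_dominated[where c = "3 * P * B"])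
    fix x
    have "\<bar>influence x\<bar> * \<bar>d x\<bar> \<le> (3 * P * V x) * B"
      using influence_le[of x] d_le(1)[of x] P_nonneg V_nonneg[of x] by (intro mult_mono) auto
    then show "\<bar>influence x * d x\<bar> \<le> 3 * P * B * V x" by (simp add: abs_mult mult_ac)
  qed measurable
  have eq: "F' x = influence x * d x - \<mu>1 x \<theta>\<^sub>0 * \<pi> x * \<rho> x * w x" for x
    by (simp add: F'_def influence_def \<rho>_def flux_def field_simps)
  have "(LBINT x. F' x) = 0"
    using Bochner_Integration.integrable_diff[OF int2 int1] unfolding eq[symmetric]
    by (rule integral_derivative_eq_0[OF F F'c _ lim])
  then show "(LBINT x. \<mu>1 x \<theta>\<^sub>0 * \<pi> x * \<rho> x * w x) = (LBINT x. influence x * d x)"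
    using int1 int2 by (simp add: eq)
qed

text \<open>Here the derivative enters through \<open>d * d'\<close>, half the derivative of \<open>d\<^sup>2\<close>, and is again removed by integration
by parts; therefore \<open>Q1\<close> does not occur in the bound.\<close>

lemma score_quadratic_part:
  "integrable lborel (\<lambda>x. \<mu>1 x \<theta>\<^sub>0 * d x * \<rho> x * w x)"
  "\<bar>LBINT x. \<mu>1 x \<theta>\<^sub>0 * d x * \<rho> x * w x\<bar> \<le> 3 * Q0"
proof -
  define F where "F = (\<lambda>x. 1 / 4 * (\<mu>1 x \<theta>\<^sub>0 * w x * (\<sigma> x)\<^sup>2 * (d x)\<^sup>2))"
  define k where "k = (\<lambda>x. 1 / 4 * (\<mu>1x x * w x * (\<sigma> x)\<^sup>2 + \<mu>1 x \<theta>\<^sub>0 * w' x * (\<sigma> x)\<^sup>2 + 2 * (\<mu>1 x \<theta>\<^sub>0 * (\<sigma> x * \<sigma>' x) * w x)))"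
  define F' where "F' = (\<lambda>x. k x * (d x)\<^sup>2 + 1 / 2 * (\<mu>1 x \<theta>\<^sub>0 * w x * (\<sigma> x)\<^sup>2 * (d x * d' x)))"
  have F: "(F has_real_derivative F' x) (at x)" for x
    unfolding F_def F'_def k_def
    by (auto intro!: derivative_eq_intros \<mu>1x(1) w(1) \<sigma>(1) d_deriv simp: field_simps power2_eq_square)
  have F'c: "continuous_on UNIV F'" unfolding F'_def k_def
    by (intro continuous_intros coefficients_continuous \<sigma>(2) w(2) \<mu>1x(2) d_cont)
  have lim: "(F \<longlongrightarrow> 0) at_infinity"
  proof -
    have le: "\<bar>1 / 4 * (d x)\<^sup>2\<bar> \<le> 1 / 4 * B\<^sup>2" for x using d_le(3)[of x] by simp
    show ?thesis
      using boundary_vanishes[of "\<lambda>x. 1 / 4 * (d x)\<^sup>2", OF le] by (simp add: F_def mult_ac)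
  qed
  have int1: "integrable lborel (\<lambda>x. \<mu>1 x \<theta>\<^sub>0 * d x * \<rho> x * w x)"
  proof (rule integrable_weighted_residual[where c = "B\<^sup>2"])
    fix x
    note score_weight_le[of x]
    then have "(d x)\<^sup>2 * ((\<mu>1 x \<theta>\<^sub>0)\<^sup>2 * w x) \<le> B\<^sup>2 * V x"
      using d_le(3)[of x] w(3)[of x] by (intro mult_mono) auto
    then show "(\<mu>1 x \<theta>\<^sub>0 * d x)\<^sup>2 * w x \<le> B\<^sup>2 * V x" by (simp add: power_mult_distrib mult_ac)
  qed measurable
  then show "integrable lborel (\<lambda>x. \<mu>1 x \<theta>\<^sub>0 * d x * \<rho> x * w x)" .
  define \<psi> where "\<psi> = (\<lambda>x. \<mu>1 x \<theta>\<^sub>0 * \<mu> x \<theta>\<^sub>0 * w x - \<mu>1 x \<theta>\<^sub>0 * (\<sigma> x * \<sigma>' x) * w x + k x)"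
  have lin: "\<bar>y1 - y2 + 1 / 4 * (y3 + y4 + 2 * y2)\<bar> \<le> 3 * v"
    if "\<bar>y1\<bar> \<le> v" "\<bar>y2\<bar> \<le> v" "\<bar>y3\<bar> \<le> v" "\<bar>y4\<bar> \<le> v" for y1 y2 y3 y4 v :: real
    using that unfolding abs_le_iff distrib_left by linarith
  have \<psi>_le: "\<bar>\<psi> x\<bar> \<le> 3 * V x" for x
    unfolding \<psi>_def k_def by (rule lin[OF weight_le(1) weight_le(5) weight_le(2) weight_le(4)])
  have [measurable]: "\<psi> \<in> borel_measurable borel" unfolding \<psi>_def k_def by measurable
  have le: "\<bar>\<psi> x * (d x)\<^sup>2\<bar> \<le> 3 * (V x * (d x)\<^sup>2)" for x
    using mult_right_mono[OF \<psi>_le[of x], of "(d x)\<^sup>2"] by (simp add: abs_mult mult.assoc)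
  have int2: "integrable lborel (\<lambda>x. \<psi> x * (d x)\<^sup>2)"
    by (rule Bochner_Integration.integrable_bound[where f = "\<lambda>x. 3 * (V x * (d x)\<^sup>2)"])
       (use integrable_Q le V_nonneg in auto)
  have eq: "F' x = \<psi> x * (d x)\<^sup>2 - \<mu>1 x \<theta>\<^sub>0 * d x * \<rho> x * w x" for x
    by (simp add: F'_def \<psi>_def \<rho>_def flux_def field_simps power2_eq_square)
  have "(LBINT x. F' x) = 0"
    using Bochner_Integration.integrable_diff[OF int2 int1] unfolding eq[symmetric]
    by (rule integral_derivative_eq_0[OF F F'c _ lim])
  then have "(LBINT x. \<mu>1 x \<theta>\<^sub>0 * d x * \<rho> x * w x) = (LBINT x. \<psi> x * (d x)\<^sup>2)"
    using int1 int2 by (simp add: eq)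
  also have "\<bar>\<dots>\<bar> \<le> (LBINT x. \<bar>\<psi> x * (d x)\<^sup>2\<bar>)" by (rule integral_abs_bound)
  also have "\<dots> \<le> (LBINT x. 3 * (V x * (d x)\<^sup>2))"
    by (rule integral_mono) (use int2 integrable_Q le in auto)
  also have "\<dots> = 3 * Q0" by (simp add: Q0_def)
  finally show "\<bar>LBINT x. \<mu>1 x \<theta>\<^sub>0 * d x * \<rho> x * w x\<bar> \<le> 3 * Q0" .
qed

lemma score_le: "\<bar>score\<bar> \<le> \<bar>LBINT x. influence x * d x\<bar> + 3 * Q0"
proof -
  have "score = (LBINT x. \<mu>1 x \<theta>\<^sub>0 * \<pi> x * \<rho> x * w x + \<mu>1 x \<theta>\<^sub>0 * d x * \<rho> x * w x)"
    unfolding score_def by (intro Bochner_Integration.integral_cong refl) (simp add: d_def algebra_simps)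
  also have "\<dots> = (LBINT x. influence x * d x) + (LBINT x. \<mu>1 x \<theta>\<^sub>0 * d x * \<rho> x * w x)"
    using score_linear_part score_quadratic_part(1) by simp
  finally show ?thesis using score_quadratic_part(2) by linarith
qed

end

context contrast_model begin

text \<open>The inequality for minimisers is solved for the distance to the truth: the threshold \<open>\<tau>\<close> is so small that
consistency brings \<open>\<theta>\<close> within \<open>e\<close> of \<open>\<theta>\<^sub>0\<close>, and each of the three error terms then takes at most a
sixteenth of \<open>information\<close>, leaving at least a quarter of it as coefficient.\<close>

lemma minimiser_rate:
  assumes info: "information > 0"
    and sep: "\<And>\<epsilon>. \<epsilon> > 0 \<Longrightarrow> \<exists>c>0. \<forall>\<theta>\<in>{a..b}. \<epsilon> \<le> \<bar>\<theta> - \<theta>\<^sub>0\<bar> \<longrightarrow> c \<le> criterion \<mu> \<sigma> w \<pi> \<theta>"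
  obtains \<tau> where "\<tau> > 0"
    "\<And>q q' B \<theta>. \<lbrakk>\<And>x. (q has_real_derivative q' x) (at x); continuous_on UNIV q';
       \<And>x. \<bar>q x - \<pi> x\<bar> \<le> B; \<And>x. \<bar>q' x - \<pi>' x\<bar> \<le> B; \<theta> \<in> {a..b};
       criterion \<mu> \<sigma> w q \<theta> \<le> criterion \<mu> \<sigma> w q \<theta>\<^sub>0;
       (LBINT x. V x * (q x - \<pi> x)\<^sup>2) + (LBINT x. V x * (q' x - \<pi>' x)\<^sup>2) < \<tau>\<rbrakk>
       \<Longrightarrow> \<bar>\<theta> - \<theta>\<^sub>0\<bar> \<le> 8 / information * (\<bar>LBINT x. influence x * (q x - \<pi> x)\<bar>
                + 3 * (LBINT x. V x * (q x - \<pi> x)\<^sup>2))"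
proof -
  define I where "I = information"
  have I0: "0 < I" using info by (simp add: I_def)
  define vv where "vv = (LBINT x. V x)"
  have vv0: "0 \<le> vv" unfolding vv_def using V_nonneg by (intro integral_nonneg_AE) auto
  define \<eta> where "\<eta> = I / (64 * (P * vv + 1))"
  have Pvv: "0 < P * vv + 1" "0 < P\<^sup>2 * vv + 1" using P_nonneg vv0 by (simp_all add: add_nonneg_pos)
  have \<eta>0: "0 < \<eta>" unfolding \<eta>_def using I0 Pvv by simp
  have \<eta>1: "2 * (2 * P * \<eta> * vv) \<le> I / 16"
  proof -
    have "2 * (2 * P * \<eta> * vv) = I / 16 * (P * vv / (P * vv + 1))" using Pvv by (simp add: \<eta>_def field_simps)
    also have "\<dots> \<le> I / 16 * 1" using Pvv I0 by (intro mult_left_mono) (auto simp: divide_le_eq)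
    finally show ?thesis by simp
  qed
  define e where "e = I / (64 * (P\<^sup>2 * vv + 1))"
  have e0: "0 < e" unfolding e_def using I0 Pvv by simp
  have e1: "4 * P\<^sup>2 * e * vv \<le> I / 16"
  proof -
    have "4 * P\<^sup>2 * e * vv = I / 16 * (P\<^sup>2 * vv / (P\<^sup>2 * vv + 1))" using Pvv by (simp add: e_def field_simps)
    also have "\<dots> \<le> I / 16 * 1" using Pvv I0 by (intro mult_left_mono) (auto simp: divide_le_eq)
    finally show ?thesis by simp
  qed
  obtain c where c: "c > 0" "\<And>\<theta>. \<theta> \<in> {a..b} \<Longrightarrow> e \<le> \<bar>\<theta> - \<theta>\<^sub>0\<bar> \<Longrightarrow> c \<le> criterion \<mu> \<sigma> w \<pi> \<theta>"
    using sep[OF e0] by blast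
  define k where "k = 2 + 2 * (P / \<eta> + 3)"
  have k0: "0 < k" unfolding k_def using divide_nonneg_pos[OF P_nonneg \<eta>0] by (intro add_pos_nonneg) auto
  define \<tau> where "\<tau> = min (c / 24) (I / (16 * k))"
  have \<tau>: "0 < \<tau>" "24 * \<tau> \<le> c" "k * \<tau> \<le> I / 16"
  proof -
    show "0 < \<tau>" unfolding \<tau>_def using c(1) I0 k0 by simp
    show "24 * \<tau> \<le> c" unfolding \<tau>_def by (simp add: min_def)
    have "k * \<tau> \<le> k * (I / (16 * k))" unfolding \<tau>_def using k0 by (intro mult_left_mono) auto
    then show "k * \<tau> \<le> I / 16" using k0 by simp
  qed
  show thesis
  proof (rule that[OF \<tau>(1)])
    fix q q' :: "real \<Rightarrow> real" and B \<theta> :: real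
    assume q: "\<And>x. (q has_real_derivative q' x) (at x)" "continuous_on UNIV q'"
      "\<And>x. \<bar>q x - \<pi> x\<bar> \<le> B" "\<And>x. \<bar>q' x - \<pi>' x\<bar> \<le> B"
      and mem: "\<theta> \<in> {a..b}" and min: "criterion \<mu> \<sigma> w q \<theta> \<le> criterion \<mu> \<sigma> w q \<theta>\<^sub>0"
      and small: "(LBINT x. V x * (q x - \<pi> x)\<^sup>2) + (LBINT x. V x * (q' x - \<pi>' x)\<^sup>2) < \<tau>"
    interpret contrast_candidate a b \<theta>\<^sub>0 \<mu> \<mu>1 \<mu>2 \<mu>1x \<pi> \<pi>' \<sigma> \<sigma>' w w' m1 m2 m3 m5 V P q q' B
      by unfold_locales (use q in auto)
    have sm: "Q0 + Q1 < \<tau>" using small unfolding Q0_def Q1_def d_def d'_def .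
    have "criterion \<mu> \<sigma> w \<pi> \<theta> < c"
    proof -
      have "24 * (Q0 + Q1) < 24 * \<tau>" using sm by simp
      with criterion_minimiser_le[OF mem min] \<tau>(2) show ?thesis by linarith
    qed
    then have close: "\<bar>\<theta> - \<theta>\<^sub>0\<bar> \<le> e" using c(2)[OF mem] by force
    define T where "T = \<bar>\<theta> - \<theta>\<^sub>0\<bar>"
    define F where "F = I / 2 - 2 * Q0 - 4 * P\<^sup>2 * T * vv - 2 * (2 * P * \<eta> * vv + (P / \<eta> + 3) * (Q0 + Q1))"
    have TF: "T * F \<le> 2 * \<bar>score\<bar>"
      using minimiser_quadratic_inequality[OF mem min \<eta>0] unfolding T_def F_def I_def vv_def .
    have "4 * P\<^sup>2 * T * vv \<le> I / 16"
    proof -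
      have "4 * P\<^sup>2 * T * vv \<le> 4 * P\<^sup>2 * e * vv"
        using close vv0 unfolding T_def by (intro mult_right_mono mult_left_mono) auto
      also note e1
      finally show ?thesis .
    qed
    moreover have "2 * Q0 + 2 * ((P / \<eta> + 3) * (Q0 + Q1)) \<le> I / 16"
    proof -
      have "2 * Q0 + 2 * ((P / \<eta> + 3) * (Q0 + Q1)) \<le> k * (Q0 + Q1)"
        unfolding k_def using Q_nonneg by (simp add: distrib_right mult.assoc)
      also have "\<dots> \<le> k * \<tau>" using sm k0 by (intro mult_left_mono) auto
      also note \<tau>(3)
      finally show ?thesis .
    qed
    ultimately have "I / 4 \<le> F" using \<eta>1 I0 unfolding F_def distrib_left[of 2] by linarith
    then have "T * (I / 4) \<le> T * F" unfolding T_def by (intro mult_left_mono) auto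
    also note TF
    finally have "T \<le> 8 / I * \<bar>score\<bar>" using I0 by (simp add: field_simps)
    also have "\<dots> \<le> 8 / I * (\<bar>LBINT x. influence x * d x\<bar> + 3 * Q0)"
      using I0 by (intro mult_left_mono score_le) auto
    finally show "\<bar>\<theta> - \<theta>\<^sub>0\<bar> \<le> 8 / information * (\<bar>LBINT x. influence x * (q x - \<pi> x)\<bar>
                + 3 * (LBINT x. V x * (q x - \<pi> x)\<^sup>2))"
      unfolding T_def I_def Q0_def d_def .
  qed
qed

end

section \<open>From mean bounds to stochastic order\<close>

text \<open>Markov's inequality for the three quantities \<open>S\<close>, \<open>R\<close> and \<open>T\<^sup>2\<close>. The pathwise bound on \<open>Y\<close> is available only
where \<open>S\<close> is below the threshold, an event whose probability tends to one.\<close>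

lemma bounded_in_prob_of_mean_bounds:
  fixes Y S R T :: "nat \<Rightarrow> 'a \<Rightarrow> real"
  assumes "prob_space M" and \<tau>: "0 < \<tau>" and c: "0 < c"
    and det: "\<And>n \<omega>. \<omega> \<in> space M \<Longrightarrow> S n \<omega> < \<tau> \<Longrightarrow> \<bar>Y n \<omega>\<bar> \<le> c * (\<bar>T n \<omega>\<bar> + 3 * R n \<omega>)"
    and S: "\<And>n. integrable M (S n)" "\<And>n \<omega>. 0 \<le> S n \<omega>" "(\<lambda>n. \<integral>\<omega>. S n \<omega> \<partial>M) \<longlonglongrightarrow> 0"
    and R: "\<And>n. integrable M (R n)" "\<And>n \<omega>. 0 \<le> R n \<omega>"
      "\<exists>A. \<forall>\<^sub>F n in sequentially. sqrt (real n) * (\<integral>\<omega>. R n \<omega> \<partial>M) \<le> A"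
    and T: "\<And>n. integrable M (\<lambda>\<omega>. (T n \<omega>)\<^sup>2)"
      "\<exists>A. \<forall>\<^sub>F n in sequentially. real n * (\<integral>\<omega>. (T n \<omega>)\<^sup>2 \<partial>M) \<le> A"
  shows "bounded_in_prob M (\<lambda>n \<omega>. sqrt (real n) * Y n \<omega>)"
  unfolding bounded_in_prob_def
proof (intro allI impI)
  interpret prob_space M by fact
  fix \<epsilon> :: real assume \<epsilon>: "0 < \<epsilon>"
  obtain A1 where A1: "\<forall>\<^sub>F n in sequentially. sqrt (real n) * (\<integral>\<omega>. R n \<omega> \<partial>M) \<le> A1" using R(3) by blast
  obtain A2 where A2: "\<forall>\<^sub>F n in sequentially. real n * (\<integral>\<omega>. (T n \<omega>)\<^sup>2 \<partial>M) \<le> A2" using T(2) by blast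
  define A where "A = max 0 (max A1 A2)"
  define y where "y = max 1 (3 * (A + 1) / \<epsilon>)"
  have y1: "1 \<le> y" unfolding y_def by simp
  have A0: "0 \<le> A" unfolding A_def by simp
  have Ay: "A / y < \<epsilon> / 3"
  proof -
    have "3 * A < 3 * (A + 1)" by simp
    also have "\<dots> = \<epsilon> * (3 * (A + 1) / \<epsilon>)" using \<epsilon> by simp
    also have "\<dots> \<le> \<epsilon> * y" unfolding y_def using \<epsilon> by (intro mult_left_mono) auto
    finally show ?thesis using y1 by (simp add: divide_less_eq)
  qed
  have Ay2: "A / y\<^sup>2 \<le> A / y"
  proof (rule divide_left_mono)
    show "y \<le> y\<^sup>2" using y1 mult_right_mono[of 1 y y] by (simp add: power2_eq_square)
  qed (use A0 y1 in simp_all)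
  have ES: "\<forall>\<^sub>F n in sequentially. (\<integral>\<omega>. S n \<omega> \<partial>M) < \<tau> * (\<epsilon> / 3)"
    using S(3) \<tau> \<epsilon> by (intro order_tendstoD(2)) auto
  show "\<exists>C. \<forall>\<^sub>F n in sequentially. prob {\<omega> \<in> space M. C < \<bar>sqrt (real n) * Y n \<omega>\<bar>} < \<epsilon>"
  proof (rule exI[of _ "c * (y + 3 * y)"])
    show "\<forall>\<^sub>F n in sequentially. prob {\<omega> \<in> space M. c * (y + 3 * y) < \<bar>sqrt (real n) * Y n \<omega>\<bar>} < \<epsilon>"
      using A1 A2 ES eventually_ge_at_top[of 1]
    proof eventually_elim
      case (elim n)
      define s where "s = sqrt (real n)"
      have s: "0 < s" "s\<^sup>2 = real n" using elim(4) by (auto simp: s_def)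
      have Sm [measurable]: "S n \<in> borel_measurable M" "R n \<in> borel_measurable M" "(\<lambda>\<omega>. (T n \<omega>)\<^sup>2) \<in> borel_measurable M"
        using S(1) R(1) T(1) by (auto dest: borel_measurable_integrable)
      define E1 where "E1 = {\<omega> \<in> space M. \<tau> \<le> S n \<omega>}"
      define E2 where "E2 = {\<omega> \<in> space M. y \<le> s * R n \<omega>}"
      define E3 where "E3 = {\<omega> \<in> space M. y\<^sup>2 \<le> real n * (T n \<omega>)\<^sup>2}"
      have [measurable]: "E1 \<in> sets M" "E2 \<in> sets M" "E3 \<in> sets M" unfolding E1_def E2_def E3_def by measurable
      have sub: "{\<omega> \<in> space M. c * (y + 3 * y) < \<bar>sqrt (real n) * Y n \<omega>\<bar>} \<subseteq> E1 \<union> E2 \<union> E3"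
      proof (rule subsetI, rule ccontr)
        fix \<omega> assume \<omega>: "\<omega> \<in> {\<omega> \<in> space M. c * (y + 3 * y) < \<bar>sqrt (real n) * Y n \<omega>\<bar>}" and "\<omega> \<notin> E1 \<union> E2 \<union> E3"
        from \<omega> have sp: "\<omega> \<in> space M" and big: "c * (y + 3 * y) < \<bar>s * Y n \<omega>\<bar>"
          unfolding s_def by blast+
        from \<open>\<omega> \<notin> E1 \<union> E2 \<union> E3\<close> sp have no: "S n \<omega> < \<tau>" "s * R n \<omega> < y" "real n * (T n \<omega>)\<^sup>2 < y\<^sup>2"
          unfolding E1_def E2_def E3_def Un_iff mem_Collect_eq not_le[symmetric] by blast+
        have "(s * \<bar>T n \<omega>\<bar>)\<^sup>2 = real n * (T n \<omega>)\<^sup>2" unfolding power_mult_distrib s(2) power2_abs ..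
        also note no(3)
        finally have sT: "s * \<bar>T n \<omega>\<bar> < y" by (rule power2_less_imp_less) (use y1 in linarith)
        have "\<bar>s * Y n \<omega>\<bar> = s * \<bar>Y n \<omega>\<bar>" using s(1) by (simp add: abs_mult)
        also have "\<dots> \<le> s * (c * (\<bar>T n \<omega>\<bar> + 3 * R n \<omega>))"
          by (intro mult_left_mono det no(1) sp less_imp_le[OF s(1)])
        also have "\<dots> = c * (s * \<bar>T n \<omega>\<bar> + 3 * (s * R n \<omega>))" by (simp add: algebra_simps)
        also have "\<dots> \<le> c * (y + 3 * y)" using sT no(2) by (intro mult_left_mono add_mono less_imp_le[OF c]) simp_all
        finally have "\<bar>s * Y n \<omega>\<bar> \<le> c * (y + 3 * y)" .
        from leD[OF this] big show False by (rule notE)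
      qed
      have P1: "prob E1 < \<epsilon> / 3"
      proof -
        have "prob E1 \<le> (\<integral>\<omega>. S n \<omega> \<partial>M) / \<tau>" unfolding E1_def
          by (rule integral_Markov_inequality_measure[where A="{}"]) (use S(1,2) \<tau> in auto)
        also have "\<dots> < \<epsilon> / 3" using elim(3) \<tau> by (simp add: divide_less_eq mult.commute)
        finally show ?thesis .
      qed
      have P2: "prob E2 < \<epsilon> / 3"
      proof -
        have "prob E2 \<le> (\<integral>\<omega>. s * R n \<omega> \<partial>M) / y" unfolding E2_def
          by (rule integral_Markov_inequality_measure[where A="{}"]) (use R(1,2) y1 s(1) in auto)
        also have "\<dots> \<le> A / y" using elim(1) y1 by (intro divide_right_mono) (auto simp: A_def s_def)
        also note Ay
        finally show ?thesis .
      qed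
      have P3: "prob E3 < \<epsilon> / 3"
      proof -
        have "prob E3 \<le> (\<integral>\<omega>. real n * (T n \<omega>)\<^sup>2 \<partial>M) / y\<^sup>2" unfolding E3_def
          by (rule integral_Markov_inequality_measure[where A="{}"]) (use T(1) y1 in auto)
        also have "\<dots> \<le> A / y\<^sup>2" using elim(2) by (intro divide_right_mono) (auto simp: A_def)
        also note Ay2
        also note Ay
        finally show ?thesis .
      qed
      have "prob {\<omega> \<in> space M. c * (y + 3 * y) < \<bar>sqrt (real n) * Y n \<omega>\<bar>} \<le> prob (E1 \<union> E2 \<union> E3)"
        by (rule finite_measure_mono[OF sub]) measurable
      also have "\<dots> \<le> prob E1 + prob E2 + prob E3"
        using measure_Un_le[of "E1 \<union> E2" M E3] measure_Un_le[of E1 M E2] by simp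
      also have "\<dots> < \<epsilon>" using P1 P2 P3 by simp
      finally show ?case .
    qed
  qed
qed

section \<open>Consequences of the model assumptions\<close>

lemma sets_sigma_subset:
  assumes "G \<subseteq> sets M" shows "sets (sigma (space M) G) \<subseteq> sets M"
proof -
  have "G \<subseteq> Pow (space M)" using assms sets.space_closed by blast
  then show ?thesis using sets.sigma_sets_subset[OF assms] by (simp add: sets_measure_of)
qed

lemma aug_filtration_measurable:
  assumes W: "\<And>t. t \<ge> 0 \<Longrightarrow> W t \<in> borel_measurable M" and \<xi>: "\<xi> \<in> borel_measurable M"
    and X: "X \<in> borel_measurable (aug_filtration M W \<xi> t)"
  shows "X \<in> borel_measurable M"
proof -
  define G where "G = sets (vimage_algebra (space M) \<xi> borel) \<union> sets (sigma_gen M W {0..t}) \<union> null_sets M"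
  have "sets (vimage_algebra (space M) \<xi> borel) \<subseteq> sets M"
    by (rule sets_image_in_sets) (use \<xi> in auto)
  moreover have "sets (sigma_gen M W {0..t}) \<subseteq> sets M"
  proof -
    have "{W i -` A \<inter> space M |i A. i \<in> {0..t} \<and> A \<in> sets borel} \<subseteq> sets M"
      using W by (auto intro: measurable_sets)
    then show ?thesis unfolding sigma_gen_def by (rule sets_sigma_subset)
  qed
  ultimately have G: "G \<subseteq> sets M" unfolding G_def by (auto simp: null_sets_def)
  have "sets (aug_filtration M W \<xi> t) \<subseteq> sets M" "space (aug_filtration M W \<xi> t) = space M"
    unfolding aug_filtration_def G_def[symmetric] using sets_sigma_subset[OF G] by (simp_all add: space_measure_of_conv)
  then show ?thesis using X unfolding measurable_def by auto
qed

lemma strong_solution_measurable: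
  assumes "brownian_motion M W" "\<xi> \<in> borel_measurable M" "strong_solution M W \<xi> \<beta> \<sigma> X" "0 \<le> t"
  shows "X t \<in> borel_measurable M"
  by (rule aug_filtration_measurable[where W=W and \<xi>=\<xi> and t=t])
     (use assms in \<open>auto simp: brownian_motion_def strong_solution_def\<close>)

text \<open>Evaluation at time \<open>0\<close> is measurable on the product space, so equality of the laws of the shifted paths
gives equality of the one-dimensional laws.\<close>

lemma strictly_stationary_marginal:
  assumes st: "strictly_stationary M X" and X: "\<And>t. 0 \<le> t \<Longrightarrow> X t \<in> borel_measurable M" and s: "0 \<le> s"
  shows "distr M borel (X s) = distr M borel (X 0)"
proof -
  have path: "(\<lambda>\<omega>. \<lambda>t\<in>{0..}. X (s + t) \<omega>) \<in> measurable M (Pi\<^sub>M {0..} (\<lambda>_. borel))" if "0 \<le> s" for s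
    by (rule measurable_restrict) (use X that in auto)
  have comp: "(\<lambda>p. p (0::real)) \<in> measurable (Pi\<^sub>M {0..} (\<lambda>_. borel)) borel"
    by (rule measurable_component_singleton) simp
  have "distr (distr M (Pi\<^sub>M {0..} (\<lambda>_. borel)) (\<lambda>\<omega>. \<lambda>t\<in>{0..}. X (s + t) \<omega>)) borel (\<lambda>p. p 0) = distr M borel (X s)"
    by (subst distr_distr[OF comp path[OF s]]) (simp add: o_def)
  moreover have "distr (distr M (Pi\<^sub>M {0..} (\<lambda>_. borel)) (\<lambda>\<omega>. \<lambda>t\<in>{0..}. X t \<omega>)) borel (\<lambda>p. p 0) = distr M borel (X 0)"
    using distr_distr[OF comp path[of 0]] by (simp add: o_def)
  ultimately show ?thesis using st s unfolding strictly_stationary_def by metis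
qed

text \<open>The support condition leaves the values at \<open>1\<close> and \<open>-1\<close> open; they vanish by continuity.\<close>

lemma kernel_of_support:
  fixes K :: "real \<Rightarrow> real"
  assumes C1: "K C1_differentiable_on UNIV" and supp: "closure (support_on UNIV K) = {-1..1}"
  obtains K' where "smoothing_kernel K K'"
proof -
  obtain K' where K': "\<And>x. (K has_vector_derivative K' x) (at x)" "continuous_on UNIV K'"
    using C1 unfolding C1_differentiable_on_def by auto
  have der: "(K has_real_derivative K' x) (at x)" for x
    using K'(1) by (simp add: has_real_derivative_iff_has_vector_derivative)
  have out: "K u = 0" if "1 < \<bar>u\<bar>" for u
  proof (rule ccontr)
    assume "K u \<noteq> 0"
    then have "u \<in> closure (support_on UNIV K)" by (intro closure_subset[THEN subsetD]) (simp add: support_on_def)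
    then show False using that unfolding supp by auto
  qed
  have edge: "K u = 0" if "\<bar>u\<bar> = 1" for u
  proof -
    have "(\<lambda>n. u * (1 + inverse (real (Suc n)))) \<longlonglongrightarrow> u * (1 + 0)"
      by (intro tendsto_intros LIMSEQ_inverse_real_of_nat)
    then have "(\<lambda>n. K (u * (1 + inverse (real (Suc n))))) \<longlonglongrightarrow> K u"
      using DERIV_isCont[OF der[of u]] by (intro isCont_tendsto_compose[of _ K]) auto
    moreover have "K (u * (1 + inverse (real (Suc n)))) = 0" for n
      by (rule out) (use that in \<open>simp add: abs_mult\<close>)
    ultimately show ?thesis by (simp add: LIMSEQ_const_iff)
  qed
  have "smoothing_kernel K K'"
    by unfold_locales (use der K'(2) out edge in \<open>auto simp: order_le_less\<close>)
  then show thesis by (rule that)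
qed

text \<open>The exponent is chosen such that \<open>(h n)^(2 * p)\<close>, the order of the squared bias, is \<open>1 / n\<close>.\<close>

lemma bandwidth_bias_rate:
  fixes h :: "nat \<Rightarrow> real"
  assumes p: "0 < p" and h: "\<And>n. 0 < h n"
    and rate: "h \<in> \<Theta>(\<lambda>n. real n powr (- (1 / (2 * real p))))"
  shows "\<exists>A. \<forall>\<^sub>F n in sequentially. real n * h n ^ (2 * p) \<le> A"
proof -
  from rate have "h \<in> O(\<lambda>n. real n powr (- (1 / (2 * real p))))" by (rule bigthetaD1)
  then obtain c where c: "c > 0" "\<forall>\<^sub>F n in sequentially. norm (h n) \<le> c * norm (real n powr (- (1 / (2 * real p))))"
    by (rule landau_o.bigE)
  have "\<forall>\<^sub>F n in sequentially. real n * h n ^ (2 * p) \<le> c ^ (2 * p)"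
    using c(2) eventually_ge_at_top[of 1]
  proof eventually_elim
    case (elim n)
    then have "h n \<le> c * real n powr (- (1 / (2 * real p)))" using h[of n] by simp
    then have "h n ^ (2 * p) \<le> (c * real n powr (- (1 / (2 * real p)))) ^ (2 * p)"
      using h[of n] by (intro power_mono) auto
    also have "\<dots> = c ^ (2 * p) * real n powr (- 1)"
      using p elim(2) by (simp add: power_mult_distrib powr_powr flip: powr_realpow)
    also have "\<dots> = c ^ (2 * p) / real n" using elim(2) by (simp add: powr_minus divide_inverse)
    finally show ?case using elim(2) by (simp add: field_simps)
  qed
  then show ?thesis ..
qed

text \<open>The sum of the absolute values serves as common majorant.\<close>

lemma bdd_integrable_majorant:
  assumes "list_all bdd_integrable us"
  obtains V where "bdd_integrable V" "list_all (\<lambda>u. \<forall>x. \<bar>u x\<bar> \<le> V x) us"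
proof -
  have "\<exists>V. bdd_integrable V \<and> (\<forall>u\<in>set us. \<forall>x. \<bar>u x\<bar> \<le> V x) \<and> (\<forall>x. 0 \<le> V x)"
    using assms unfolding list_all_iff
  proof (induction us)
    case Nil
    show ?case by (rule exI[of _ "\<lambda>x. 0"]) (simp add: bdd_integrable_def)
  next
    case (Cons u us)
    then obtain V where V: "bdd_integrable V" "\<forall>u\<in>set us. \<forall>x. \<bar>u x\<bar> \<le> V x" "\<forall>x. 0 \<le> V x" by auto
    have u: "bdd_integrable u" using Cons.prems by simp
    have "bounded (range (\<lambda>x. \<bar>u x\<bar>))" using u unfolding bdd_integrable_def bounded_iff by auto
    then have "bounded (range (\<lambda>x. \<bar>u x\<bar> + V x))"
      using V(1) unfolding bdd_integrable_def by (intro bounded_plus_comp) auto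
    then have "bdd_integrable (\<lambda>x. \<bar>u x\<bar> + V x)"
      using u V(1) unfolding bdd_integrable_def by simp
    moreover have "\<bar>v x\<bar> \<le> \<bar>u x\<bar> + V x" if "v \<in> set (u # us)" for v x
      using that V(2) V(3)[rule_format, of x] by (auto intro: order_trans[OF _ le_add_same_cancel2[THEN iffD2]])
    ultimately show ?case using V(3) by (intro exI[of _ "\<lambda>x. \<bar>u x\<bar> + V x"]) auto
  qed
  then show thesis using that unfolding list_all_iff by blast
qed

section \<open>The root-n rate of the minimum contrast estimator\<close>

theorem theorem2:
  fixes M :: "'a measure"
    and W X :: "real \<Rightarrow> 'a \<Rightarrow> real"
    and \<xi> :: "'a \<Rightarrow> real"
    and \<mu> :: "real \<Rightarrow> real \<Rightarrow> real"
    and \<sigma> :: "real \<Rightarrow> real"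
    and p :: "real \<Rightarrow> real \<Rightarrow> real \<Rightarrow> real \<Rightarrow> real"
    and \<pi> :: "real \<Rightarrow> real \<Rightarrow> real"
    and a b \<theta>\<^sub>0 \<Delta> :: real
    and Z :: "nat \<Rightarrow> 'a \<Rightarrow> real"
    and K w :: "real \<Rightarrow> real"
    and h :: "nat \<Rightarrow> real"
    and \<alpha> :: nat
    and L :: "real \<Rightarrow> real"
    and \<mu>t :: "nat \<Rightarrow> real \<Rightarrow> real"
    and est :: "nat \<Rightarrow> 'a \<Rightarrow> real"
  assumes setting: "prob_space M" "brownian_motion M W"
      "\<xi> \<in> borel_measurable M" "indep_of_process M \<xi> W"
      "\<theta>\<^sub>0 \<in> {a..b}" "\<Delta> > 0"
    and X: "strong_solution M W \<xi> (\<lambda>x. \<mu> x \<theta>\<^sub>0) \<sigma> X"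
      "distributed M lborel \<xi> (\<lambda>x. \<pi> x \<theta>\<^sub>0)"
    and Z: "\<And>j. Z j = X (real j * \<Delta>)"
    and A1: "a < b"
    and A2_solution: "\<And>\<theta> \<zeta>. \<lbrakk>\<theta> \<in> {a..b}; \<zeta> \<in> borel_measurable M; indep_of_process M \<zeta> W\<rbrakk> \<Longrightarrow>
        unique_strong_solution M W \<zeta> (\<lambda>x. \<mu> x \<theta>) \<sigma>"
    and A2_transition: "\<And>\<theta>. \<theta> \<in> {a..b} \<Longrightarrow> transition_density (\<lambda>t x y. p t x y \<theta>)"
    and A2_markov: "\<And>\<theta> \<zeta> Y. \<lbrakk>\<theta> \<in> {a..b}; \<zeta> \<in> borel_measurable M; indep_of_process M \<zeta> W;
          strong_solution M W \<zeta> (\<lambda>x. \<mu> x \<theta>) \<sigma> Y\<rbrakk> \<Longrightarrow>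
        markov_with_density M Y (\<lambda>t x y. p t x y \<theta>)"
    and A2_stationary: "\<And>\<theta> \<zeta> Y. \<lbrakk>\<theta> \<in> {a..b}; \<zeta> \<in> borel_measurable M; indep_of_process M \<zeta> W;
          strong_solution M W \<zeta> (\<lambda>x. \<mu> x \<theta>) \<sigma> Y; distributed M lborel \<zeta> (\<lambda>x. \<pi> x \<theta>)\<rbrakk> \<Longrightarrow>
        strictly_stationary M Y"
    and A2_density: "\<And>\<theta>. \<theta> \<in> {a..b} \<Longrightarrow>
        prob_density (\<lambda>x. \<pi> x \<theta>) \<and>
        ergodic_density (\<lambda>t x y. p t x y \<theta>) (\<lambda>x. \<pi> x \<theta>) \<and>
        bounded (range (\<lambda>x. \<pi> x \<theta>)) \<and>
        (\<lambda>x. \<pi> x \<theta>) differentiable_on UNIV \<and>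
        bounded (range (deriv (\<lambda>x. \<pi> x \<theta>))) \<and>
        continuous_on UNIV (deriv (\<lambda>x. \<pi> x \<theta>)) \<and>
        integrable lborel (deriv (\<lambda>x. \<pi> x \<theta>)) \<and>
        closure (support_on UNIV (\<lambda>x. \<pi> x \<theta>)) = UNIV"
    and A2_param: "\<And>x \<theta>. \<theta> \<in> {a..b} \<Longrightarrow> \<pi> x differentiable (at \<theta> within {a..b})"
    and A3: "mixing_coeff M Z \<longlonglongrightarrow> 0" "summable (mixing_coeff M Z)"
    and A4: "\<alpha> > 3"
      "\<And>\<theta> i. \<lbrakk>\<theta> \<in> {a..b}; i < \<alpha>\<rbrakk> \<Longrightarrow> (deriv ^^ i) (\<lambda>x. \<pi> x \<theta>) differentiable_on UNIV"
      "\<And>\<theta>. \<theta> \<in> {a..b} \<Longrightarrow> L \<theta> > 0"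
      "\<And>\<theta> t. \<theta> \<in> {a..b} \<Longrightarrow>
        integrable lborel (\<lambda>x. ((deriv ^^ \<alpha>) (\<lambda>x. \<pi> x \<theta>) (x + t) - (deriv ^^ \<alpha>) (\<lambda>x. \<pi> x \<theta>) x)\<^sup>2) \<and>
        sqrt (LINT x|lborel. ((deriv ^^ \<alpha>) (\<lambda>x. \<pi> x \<theta>) (x + t) - (deriv ^^ \<alpha>) (\<lambda>x. \<pi> x \<theta>) x)\<^sup>2) \<le> L \<theta>"
    and A5: "\<And>u. K (- u) = K u" "K C1_differentiable_on UNIV"
      "closure (support_on UNIV K) = {-1..1}"
      "(LINT u:{-1..1}|lborel. K u) = 1"
      "\<And>l. l \<in> {1..\<alpha>} \<Longrightarrow> (LINT u:{-1..1}|lborel. u ^ l * K u) = 0"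
    and A6: "\<And>n. h n > 0" "decseq h" "h \<longlonglongrightarrow> 0" "filterlim (\<lambda>n. real n * h n ^ 4) at_top sequentially"
    and A7: "\<And>x. w x \<ge> 0" "w C1_differentiable_on UNIV" "bdd_integrable w"
    and A8: "\<sigma> differentiable_on UNIV"
      "\<And>x. \<mu> x \<theta>\<^sub>0 * \<pi> x \<theta>\<^sub>0 - 1 / 2 * deriv (\<lambda>y. (\<sigma> y)\<^sup>2 * \<pi> y \<theta>\<^sub>0) x = 0"
    and A9_diff:
      "\<And>i x \<theta>. \<lbrakk>i < 3; \<theta> \<in> {a..b}\<rbrakk> \<Longrightarrow>
        (param_deriv {a..b} ^^ i) \<mu> x differentiable (at \<theta> within {a..b})"
      "\<And>\<theta>. \<theta> \<in> {a..b} \<Longrightarrow> (\<lambda>x. param_deriv {a..b} \<mu> x \<theta>) differentiable_on UNIV"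
    and A9_cont:
      "\<And>i. i \<le> 3 \<Longrightarrow> continuous_on (UNIV \<times> {a..b}) (\<lambda>(x, \<theta>). (param_deriv {a..b} ^^ i) \<mu> x \<theta>)"
      "continuous_on (UNIV \<times> {a..b}) (\<lambda>(x, \<theta>). deriv (\<lambda>y. param_deriv {a..b} \<mu> y \<theta>) x)"
      "continuous_on UNIV \<sigma>" "continuous_on UNIV (deriv \<sigma>)"
    and A9_bounds:
      "\<And>i x \<theta>. \<lbrakk>i \<le> 3; \<theta> \<in> {a..b}\<rbrakk> \<Longrightarrow> \<bar>(param_deriv {a..b} ^^ i) \<mu> x \<theta>\<bar> \<le> \<mu>t (i + 1) x"
      "\<And>x \<theta>. \<theta> \<in> {a..b} \<Longrightarrow> \<bar>deriv (\<lambda>y. param_deriv {a..b} \<mu> y \<theta>) x\<bar> \<le> \<mu>t 5 x"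
    and A9_integrable:
      "bdd_integrable (\<lambda>x. (\<mu>t 1 x)\<^sup>2 * w x)"
      "bdd_integrable (\<lambda>x. \<sigma> x ^ 4 * w x)"
      "bdd_integrable (\<lambda>x. (\<sigma> x)\<^sup>2 * (deriv \<sigma> x)\<^sup>2 * w x)"
      "bdd_integrable (\<lambda>x. \<mu>t 2 x * \<mu>t 1 x * w x)"
      "bdd_integrable (\<lambda>x. \<mu>t 5 x * (\<sigma> x)\<^sup>2 * w x)"
      "bdd_integrable (\<lambda>x. (\<mu>t 2 x)\<^sup>2 * w x)"
      "bdd_integrable (\<lambda>x. (\<sigma> x)\<^sup>2 * w x)"
      "bdd_integrable (\<lambda>x. \<sigma> x * deriv \<sigma> x * w x)"
      "bdd_integrable (\<lambda>x. \<mu>t 2 x * (\<sigma> x)\<^sup>2 * deriv w x)"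
      "bdd_integrable (\<lambda>x. \<mu>t 3 x * \<mu>t 1 x * w x)"
      "bdd_integrable (\<lambda>x. \<mu>t 3 x * \<sigma> x ^ 4 * w x)"
      "bdd_integrable (\<lambda>x. \<mu>t 3 x * \<sigma> x * deriv \<sigma> x * w x)"
      "bdd_integrable (\<lambda>x. \<mu>t 3 x * (\<sigma> x)\<^sup>2 * w x)"
      "bdd_integrable (\<lambda>x. \<mu>t 3 x * \<mu>t 2 x * w x)"
      "bdd_integrable (\<lambda>x. \<mu>t 4 x * \<mu>t 1 x * w x)"
      "bdd_integrable (\<lambda>x. \<mu>t 4 x * \<sigma> x * deriv \<sigma> x * w x)"
      "bdd_integrable (\<lambda>x. \<mu>t 4 x * (\<sigma> x)\<^sup>2 * w x)"
      "bdd_integrable (\<lambda>x. \<mu>t 2 x * (\<sigma> x)\<^sup>2 * w x)"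
      "bdd_integrable (\<lambda>x. \<mu>t 2 x * \<sigma> x * deriv \<sigma> x * w x)"
    and A9_limit: "((\<lambda>x. \<mu>t 2 x * w x * (\<sigma> x)\<^sup>2) \<longlongrightarrow> 0) at_infinity"
    and estimator: "\<And>n. est n \<in> borel_measurable M"
      "\<And>n \<omega>. \<omega> \<in> space M \<Longrightarrow>
        is_arg_min (criterion \<mu> \<sigma> w (kernel_estimator K h Z n \<omega>)) (\<lambda>\<theta>. \<theta> \<in> {a..b}) (est n \<omega>)"
    and identifiable: "\<And>\<epsilon>. \<epsilon> > 0 \<Longrightarrow>
        (INF \<theta>\<in>{\<theta> \<in> {a..b}. \<bar>\<theta> - \<theta>\<^sub>0\<bar> \<ge> \<epsilon>}. ereal (criterion \<mu> \<sigma> w (\<lambda>x. \<pi> x \<theta>\<^sub>0) \<theta>))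
          > ereal (criterion \<mu> \<sigma> w (\<lambda>x. \<pi> x \<theta>\<^sub>0) \<theta>\<^sub>0)"
    and interior: "\<theta>\<^sub>0 \<in> interior {a..b}"
    and rate: "h \<in> \<Theta>(\<lambda>n. real n powr (- (1 / (2 * real \<alpha>))))"
    and second_deriv: "(deriv ^^ 2) (criterion \<mu> \<sigma> w (\<lambda>x. \<pi> x \<theta>\<^sub>0)) \<theta>\<^sub>0 \<noteq> 0"
  shows "bounded_in_prob M (\<lambda>n \<omega>. sqrt (real n) * (est n \<omega> - \<theta>\<^sub>0))"
proof -
  interpret prob_space M by (rule setting(1))
  have \<theta>\<^sub>0: "a < \<theta>\<^sub>0" "\<theta>\<^sub>0 < b" using interior by auto
  have mem: "\<theta>\<^sub>0 \<in> {a..b}" by (rule setting(5))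
  have X_meas: "X t \<in> borel_measurable M" if "0 \<le> t" for t
    by (rule strong_solution_measurable[OF setting(2,3) X(1) that])
  have Z_meas: "Z j \<in> borel_measurable M" for j
    unfolding Z using X_meas setting(6) by simp
  define f where "f = (\<lambda>x. \<pi> x \<theta>\<^sub>0)"
  define f' where "f' = deriv f"
  note dens = A2_density[OF mem, folded f_def]
  have f_nonneg: "0 \<le> f x" for x using dens by (auto simp: prob_density_def)
  have marginal: "distributed M lborel (Z j) f" for j
  proof -
    have "strictly_stationary M X"
      by (rule A2_stationary[OF mem setting(3,4) X])
    then have "distr M borel (Z j) = distr M borel (X 0)"
      unfolding Z using X_meas setting(6) by (intro strictly_stationary_marginal) auto
    also have "\<dots> = distr M borel \<xi>"
      using X(1) X_meas[of 0] setting(3) by (intro distr_cong_AE) (auto simp: strong_solution_def)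
    finally have "distr M lborel (Z j) = distr M lborel \<xi>"
      using distr_cong[of M M lborel borel "Z j" "Z j"] distr_cong[of M M lborel borel \<xi> \<xi>] by simp
    then show ?thesis using X(2) Z_meas unfolding distributed_def f_def by auto
  qed
  define D where "D = (\<lambda>i. (deriv ^^ i) f)"
  have D: "(D i has_real_derivative D (Suc i) x) (at x)" if "i < \<alpha>" for i x
    using A4(2)[OF mem that] unfolding D_def f_def
    by (simp add: DERIV_deriv_iff_real_differentiable differentiable_on_eq_differentiable_at[OF open_UNIV])
  have f_deriv: "(f has_real_derivative f' x) (at x)" for x
    using D[of 0 x] A4(1) by (simp add: D_def f'_def)
  have f'_cont: "continuous_on UNIV f'" using dens by (simp add: f'_def)
  obtain P1 P2 where P12: "\<And>x. \<bar>f x\<bar> \<le> P1" "\<And>x. \<bar>f' x\<bar> \<le> P2"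
    using dens unfolding f'_def bounded_iff by auto
  define P where "P = max P1 P2"
  have P: "\<bar>f x\<bar> \<le> P" "\<bar>f' x\<bar> \<le> P" for x
    using P12[of x] unfolding P_def by auto
  have L2: "(\<integral>\<^sup>+ x. ennreal ((D \<alpha> (x + t) - D \<alpha> x)\<^sup>2) \<partial>lborel) \<le> ennreal ((L \<theta>\<^sub>0)\<^sup>2)" for t
  proof -
    have A: "integrable lborel (\<lambda>x. (D \<alpha> (x + t) - D \<alpha> x)\<^sup>2)"
      "sqrt (LBINT x. (D \<alpha> (x + t) - D \<alpha> x)\<^sup>2) \<le> L \<theta>\<^sub>0"
      using A4(4)[OF mem, of t] unfolding D_def f_def by auto
    have "(LBINT x. (D \<alpha> (x + t) - D \<alpha> x)\<^sup>2) \<le> (L \<theta>\<^sub>0)\<^sup>2"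
      using A(2) by (rule sqrt_le_D)
    then show ?thesis using A(1) by (subst nn_integral_eq_integral) (auto intro: ennreal_leI)
  qed
  obtain K' where K': "smoothing_kernel K K'" using kernel_of_support[OF A5(2,3)] .
  interpret smoothing_kernel K K' by (rule K')
  have K_line: "(LBINT u. F u * K u) = (LINT u:{-1..1}|lborel. F u * K u)" for F :: "real \<Rightarrow> real"
  proof -
    have "F u * K u = indicator {-1..1} u *\<^sub>R (F u * K u)" for u
      using K_outside[of u] by (cases "1 \<le> \<bar>u\<bar>") (auto simp: indicator_def)
    then show ?thesis unfolding set_lebesgue_integral_def by presburger
  qed
  interpret kernel_density_estimation M Z f K K' f' D \<alpha> P "L \<theta>\<^sub>0" h
  proof unfold_locales
    show "(LBINT u. K u) = 1" using K_line[of "\<lambda>_. 1"] A5(4) by simp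
    show "(LBINT u. u ^ l * K u) = 0" if "l \<in> {1..\<alpha>}" for l
      unfolding K_line by (rule A5(5)[OF that])
    show "\<exists>A. \<forall>\<^sub>F n in sequentially. real n * h n ^ (2 * \<alpha>) \<le> A"
      using A4(1) by (intro bandwidth_bias_rate A6(1) rate) simp
    show "0 < \<alpha>" using A4(1) by simp
    show "D 0 = f" by (simp add: D_def)
  qed (fact Z_meas A3(2) marginal f_nonneg f_deriv f'_cont P D L2 A6)+
  define \<mu>1 where "\<mu>1 = param_deriv {a..b} \<mu>"
  define \<mu>2 where "\<mu>2 = param_deriv {a..b} \<mu>1"
  define \<mu>1x where "\<mu>1x = deriv (\<lambda>y. \<mu>1 y \<theta>\<^sub>0)"
  \<comment> \<open>The weights that are to be dominated by \<open>V\<close>.\<close>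
  define us where "us = [\<lambda>x. (\<mu>t 1 x)\<^sup>2 * w x,
      \<lambda>x. \<sigma> x ^ 4 * w x,
      \<lambda>x. (\<sigma> x)\<^sup>2 * (deriv \<sigma> x)\<^sup>2 * w x,
      \<lambda>x. \<mu>t 2 x * \<mu>t 1 x * w x,
      \<lambda>x. \<mu>t 5 x * (\<sigma> x)\<^sup>2 * w x,
      \<lambda>x. (\<mu>t 2 x)\<^sup>2 * w x,
      \<lambda>x. \<mu>t 2 x * (\<sigma> x)\<^sup>2 * deriv w x,
      \<lambda>x. \<mu>t 3 x * \<mu>t 1 x * w x,
      \<lambda>x. \<mu>t 3 x * \<sigma> x * deriv \<sigma> x * w x,
      \<lambda>x. \<mu>t 3 x * (\<sigma> x)\<^sup>2 * w x,
      \<lambda>x. \<mu>t 3 x * \<mu>t 2 x * w x,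
      \<lambda>x. \<mu>t 2 x * (\<sigma> x)\<^sup>2 * w x,
      \<lambda>x. \<mu>t 2 x * \<sigma> x * deriv \<sigma> x * w x]"
  have us: "list_all bdd_integrable us"
    unfolding us_def list.pred_inject(2) by (intro conjI A9_integrable list.pred_inject(1))
  obtain V where V: "bdd_integrable V" and V_dom: "list_all (\<lambda>u. \<forall>x. \<bar>u x\<bar> \<le> V x) us"
    using bdd_integrable_majorant[OF us] .
  note V_dom = V_dom[unfolded us_def list.pred_inject(2)]
  have V_int: "integrable lborel V" using V by (simp add: bdd_integrable_def)
  obtain Vm where Vm: "\<And>x. V x \<le> Vm"
    using V unfolding bdd_integrable_def bounded_iff by (metis UNIV_I abs_le_D1 image_eqI real_norm_def)
  have bounds: "\<bar>\<mu> x \<theta>\<bar> \<le> \<mu>t 1 x" "\<bar>\<mu>1 x \<theta>\<bar> \<le> \<mu>t 2 x" "\<bar>\<mu>2 x \<theta>\<bar> \<le> \<mu>t 3 x" if "\<theta> \<in> {a..b}" for x \<theta>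
    using A9_bounds(1)[OF _ that, of 0] A9_bounds(1)[OF _ that, of 1] A9_bounds(1)[OF _ that, of 2]
    by (simp_all add: \<mu>1_def \<mu>2_def numeral_2_eq_2 numeral_3_eq_3)
  have \<mu>t0: "0 \<le> \<mu>t 1 x" "0 \<le> \<mu>t 2 x" "0 \<le> \<mu>t 3 x" for x
    using bounds[OF mem, of x] by linarith+
  have V0: "0 \<le> V x" for x
    using V_dom by (blast intro: order_trans[OF abs_ge_zero])
  have V_ge: "(\<mu>t 1 x)\<^sup>2 * w x \<le> V x" "(\<sigma> x)^4 * w x \<le> V x" "(\<sigma> x)\<^sup>2 * (deriv \<sigma> x)\<^sup>2 * w x \<le> V x"
      "\<mu>t 2 x * \<mu>t 1 x * w x \<le> V x" "\<mu>t 5 x * (\<sigma> x)\<^sup>2 * w x \<le> V x" "(\<mu>t 2 x)\<^sup>2 * w x \<le> V x"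
      "\<mu>t 2 x * (\<sigma> x)\<^sup>2 * \<bar>deriv w x\<bar> \<le> V x" "\<mu>t 3 x * \<mu>t 1 x * w x \<le> V x"
      "\<mu>t 3 x * \<bar>\<sigma> x * deriv \<sigma> x\<bar> * w x \<le> V x" "\<mu>t 3 x * (\<sigma> x)\<^sup>2 * w x \<le> V x"
      "\<mu>t 3 x * \<mu>t 2 x * w x \<le> V x" "\<mu>t 2 x * (\<sigma> x)\<^sup>2 * w x \<le> V x"
      "\<mu>t 2 x * \<bar>\<sigma> x * deriv \<sigma> x\<bar> * w x \<le> V x" for x
  proof -
    have e1: "\<mu>t 2 x * (\<sigma> x)\<^sup>2 * \<bar>deriv w x\<bar> = \<bar>\<mu>t 2 x * (\<sigma> x)\<^sup>2 * deriv w x\<bar>"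
      "\<mu>t 3 x * \<bar>\<sigma> x * deriv \<sigma> x\<bar> * w x = \<bar>\<mu>t 3 x * \<sigma> x * deriv \<sigma> x * w x\<bar>"
      "\<mu>t 2 x * \<bar>\<sigma> x * deriv \<sigma> x\<bar> * w x = \<bar>\<mu>t 2 x * \<sigma> x * deriv \<sigma> x * w x\<bar>"
      using \<mu>t0[of x] A7(1)[of x] by (simp_all add: abs_mult)
    show "(\<mu>t 1 x)\<^sup>2 * w x \<le> V x" "(\<sigma> x)^4 * w x \<le> V x" "(\<sigma> x)\<^sup>2 * (deriv \<sigma> x)\<^sup>2 * w x \<le> V x"
      "\<mu>t 2 x * \<mu>t 1 x * w x \<le> V x" "\<mu>t 5 x * (\<sigma> x)\<^sup>2 * w x \<le> V x" "(\<mu>t 2 x)\<^sup>2 * w x \<le> V x"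
      "\<mu>t 2 x * (\<sigma> x)\<^sup>2 * \<bar>deriv w x\<bar> \<le> V x" "\<mu>t 3 x * \<mu>t 1 x * w x \<le> V x"
      "\<mu>t 3 x * \<bar>\<sigma> x * deriv \<sigma> x\<bar> * w x \<le> V x" "\<mu>t 3 x * (\<sigma> x)\<^sup>2 * w x \<le> V x"
      "\<mu>t 3 x * \<mu>t 2 x * w x \<le> V x" "\<mu>t 2 x * (\<sigma> x)\<^sup>2 * w x \<le> V x"
      "\<mu>t 2 x * \<bar>\<sigma> x * deriv \<sigma> x\<bar> * w x \<le> V x"
      unfolding e1 using V_dom by (blast intro: order_trans[OF abs_ge_self])+
  qed
  have \<mu>_deriv: "(\<mu> x has_real_derivative \<mu>1 x \<theta>) (at \<theta> within {a..b})"
    "(\<mu>1 x has_real_derivative \<mu>2 x \<theta>) (at \<theta> within {a..b})" if "\<theta> \<in> {a..b}" for x \<theta>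
    using A9_diff(1)[OF _ that, of 0 x] A9_diff(1)[OF _ that, of 1 x]
    by (simp_all add: \<mu>1_def \<mu>2_def param_deriv_def[abs_def] vector_derivative_works
        has_real_derivative_iff_has_vector_derivative)
  have section_meas: "(\<lambda>x. F x \<theta>) \<in> borel_measurable borel"
    if "continuous_on (UNIV \<times> {a..b}) (\<lambda>(x, \<theta>). F x \<theta>)" "\<theta> \<in> {a..b}" for F :: "real \<Rightarrow> real \<Rightarrow> real" and \<theta>
    by (rule borel_measurable_continuous_onI, rule continuous_on_compose2[OF that(1), of UNIV "\<lambda>x. (x, \<theta>)", simplified])
       (use that(2) in \<open>auto intro!: continuous_intros\<close>)
  have \<mu>_meas: "(\<lambda>x. \<mu> x \<theta>) \<in> borel_measurable borel" "(\<lambda>x. \<mu>1 x \<theta>) \<in> borel_measurable borel"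
    if "\<theta> \<in> {a..b}" for \<theta>
    using section_meas[OF _ that, of \<mu>] section_meas[OF _ that, of \<mu>1] A9_cont(1)[of 0] A9_cont(1)[of 1]
    by (simp_all add: \<mu>1_def)
  have \<mu>1x: "((\<lambda>x. \<mu>1 x \<theta>\<^sub>0) has_real_derivative \<mu>1x x) (at x)" "\<bar>\<mu>1x x\<bar> \<le> \<mu>t 5 x" for x
    using A9_diff(2)[OF mem] A9_bounds(2)[OF mem, of x] unfolding \<mu>1x_def \<mu>1_def
    by (simp_all add: DERIV_deriv_iff_real_differentiable differentiable_on_eq_differentiable_at[OF open_UNIV])
  have \<mu>1x_cont: "continuous_on UNIV \<mu>1x"
    unfolding \<mu>1x_def \<mu>1_def
    by (rule continuous_on_compose2[OF A9_cont(2), of UNIV "\<lambda>x. (x, \<theta>\<^sub>0)", simplified])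
       (use mem in \<open>auto intro!: continuous_intros\<close>)
  have \<sigma>_deriv: "(\<sigma> has_real_derivative deriv \<sigma> x) (at x)" for x
    using A8(1) by (simp add: DERIV_deriv_iff_real_differentiable differentiable_on_eq_differentiable_at[OF open_UNIV])
  have w_deriv: "(w has_real_derivative deriv w x) (at x)" "continuous_on UNIV (deriv w)" for x
  proof -
    obtain w' where w': "\<And>x. (w has_vector_derivative w' x) (at x)" "continuous_on UNIV w'"
      using A7(2) unfolding C1_differentiable_on_def by auto
    have "deriv w = w'"
      using w'(1) by (intro ext DERIV_imp_deriv) (simp add: has_real_derivative_iff_has_vector_derivative)
    then show "(w has_real_derivative deriv w x) (at x)" "continuous_on UNIV (deriv w)"
      using w' by (simp_all add: has_real_derivative_iff_has_vector_derivative)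
  qed
  have balance: "\<mu> x \<theta>\<^sub>0 * f x = \<sigma> x * deriv \<sigma> x * f x + 1 / 2 * (\<sigma> x)\<^sup>2 * f' x" for x
  proof -
    have "deriv (\<lambda>y. (\<sigma> y)\<^sup>2 * f y) x = 2 * \<sigma> x * deriv \<sigma> x * f x + (\<sigma> x)\<^sup>2 * f' x"
      by (rule DERIV_imp_deriv) (auto intro!: derivative_eq_intros \<sigma>_deriv f_deriv)
    then show ?thesis using A8(2)[of x] by (simp add: f_def field_simps)
  qed
  interpret contrast_model a b \<theta>\<^sub>0 \<mu> \<mu>1 \<mu>2 \<mu>1x f f' \<sigma> "deriv \<sigma>" w "deriv w" "\<mu>t 1" "\<mu>t 2" "\<mu>t 3" "\<mu>t 5" V P
    by unfold_locales
       (fact \<theta>\<^sub>0 \<mu>_deriv bounds \<mu>_meas \<mu>1x \<mu>1x_cont f_deriv f'_cont P \<sigma>_deriv A9_cont(4) w_deriv A7(1)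
          balance V_int V_ge A9_limit)+
  \<comment> \<open>The second derivative is twice the nonnegative \<open>information\<close>, so it is nonzero only if that is positive.\<close>
  have info: "0 < information"
    using second_derivative_criterion information_nonneg second_deriv unfolding f_def by auto
  have at_truth: "criterion \<mu> \<sigma> w f \<theta>\<^sub>0 = 0" unfolding criterion_truth by simp
  have sep: "\<exists>c>0. \<forall>\<theta>\<in>{a..b}. \<epsilon> \<le> \<bar>\<theta> - \<theta>\<^sub>0\<bar> \<longrightarrow> c \<le> criterion \<mu> \<sigma> w f \<theta>" if "\<epsilon> > 0" for \<epsilon>
  proof -
    have "0 < (INF \<theta>\<in>{\<theta> \<in> {a..b}. \<bar>\<theta> - \<theta>\<^sub>0\<bar> \<ge> \<epsilon>}. ereal (criterion \<mu> \<sigma> w f \<theta>))"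
      using identifiable[OF that] at_truth unfolding f_def by (simp add: zero_ereal_def)
    then obtain c where c: "0 < ereal c" "ereal c < (INF \<theta>\<in>{\<theta> \<in> {a..b}. \<bar>\<theta> - \<theta>\<^sub>0\<bar> \<ge> \<epsilon>}. ereal (criterion \<mu> \<sigma> w f \<theta>))"
      using ereal_dense2 by blast
    have "c \<le> criterion \<mu> \<sigma> w f \<theta>" if "\<theta> \<in> {a..b}" "\<epsilon> \<le> \<bar>\<theta> - \<theta>\<^sub>0\<bar>" for \<theta>
    proof -
      have "(INF \<theta>\<in>{\<theta> \<in> {a..b}. \<bar>\<theta> - \<theta>\<^sub>0\<bar> \<ge> \<epsilon>}. ereal (criterion \<mu> \<sigma> w f \<theta>)) \<le> ereal (criterion \<mu> \<sigma> w f \<theta>)"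
        by (rule INF_lower) (use that in auto)
      from less_le_trans[OF c(2) this] show ?thesis by simp
    qed
    then show ?thesis using c(1) by (intro exI[of _ c]) auto
  qed
  obtain \<tau> where \<tau>: "\<tau> > 0" and rate_bound:
    "\<And>q q' B \<theta>. \<lbrakk>\<And>x. (q has_real_derivative q' x) (at x); continuous_on UNIV q';
       \<And>x. \<bar>q x - f x\<bar> \<le> B; \<And>x. \<bar>q' x - f' x\<bar> \<le> B; \<theta> \<in> {a..b};
       criterion \<mu> \<sigma> w q \<theta> \<le> criterion \<mu> \<sigma> w q \<theta>\<^sub>0;
       (LBINT x. V x * (q x - f x)\<^sup>2) + (LBINT x. V x * (q' x - f' x)\<^sup>2) < \<tau>\<rbrakk>
       \<Longrightarrow> \<bar>\<theta> - \<theta>\<^sub>0\<bar> \<le> 8 / information * (\<bar>LBINT x. influence x * (q x - f x)\<bar>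
                + 3 * (LBINT x. V x * (q x - f x)\<^sup>2))"
    using minimiser_rate[OF info sep] by blast
  define R where "R = (\<lambda>n \<omega>. LBINT x. V x * (kde n \<omega> x - f x)\<^sup>2)"
  define R' where "R' = (\<lambda>n \<omega>. LBINT x. V x * (kde' n \<omega> x - f' x)\<^sup>2)"
  define T where "T = (\<lambda>n \<omega>. LBINT x. influence x * (kde n \<omega> x - f x))"
  have influence_bdd: "\<bar>influence x\<bar> \<le> 3 * P * Vm" for x
    using influence_le[of x] mult_left_mono[OF Vm[of x], of "3 * P"] P_nonneg by simp
  have R: "integrable M (R n)" "\<exists>A. \<forall>\<^sub>F n in sequentially. sqrt (real n) * (\<integral>\<omega>. R n \<omega> \<partial>M) \<le> A" for n
    unfolding R_def using kde_L2_rate[OF V_int V0 Vm] by blast+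
  have R': "integrable M (R' n)" "(\<lambda>n. \<integral>\<omega>. R' n \<omega> \<partial>M) \<longlonglongrightarrow> 0" for n
    unfolding R'_def using kde'_L2_consistent[OF V_int V0] by blast+
  have T: "integrable M (\<lambda>\<omega>. (T n \<omega>)\<^sup>2)" "\<exists>A. \<forall>\<^sub>F n in sequentially. real n * (\<integral>\<omega>. (T n \<omega>)\<^sup>2 \<partial>M) \<le> A" for n
    unfolding T_def using kde_linear_functional_rate[OF influence_integrable influence_bdd] by blast+
  have R0: "0 \<le> R n \<omega>" "0 \<le> R' n \<omega>" for n \<omega>
    unfolding R_def R'_def using V0 by (auto intro!: integral_nonneg_AE)
  have ER0: "(\<lambda>n. \<integral>\<omega>. R n \<omega> \<partial>M) \<longlonglongrightarrow> 0"
  proof -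
    obtain A where A: "\<forall>\<^sub>F n in sequentially. sqrt (real n) * (\<integral>\<omega>. R n \<omega> \<partial>M) \<le> A" using R(2) by blast
    show ?thesis
    proof (rule Lim_null_comparison)
      show "\<forall>\<^sub>F n in sequentially. norm (\<integral>\<omega>. R n \<omega> \<partial>M) \<le> A / sqrt (real n)"
        using A eventually_ge_at_top[of 1]
      proof eventually_elim
        case (elim n)
        have "0 \<le> (\<integral>\<omega>. R n \<omega> \<partial>M)" using R0 by (intro integral_nonneg_AE) auto
        then show ?case using elim by (simp add: pos_le_divide_eq mult.commute)
      qed
      show "(\<lambda>n. A / sqrt (real n)) \<longlonglongrightarrow> 0" 
        by (intro tendsto_divide_0[OF tendsto_const] filterlim_at_top_imp_at_infinity
            filterlim_compose[OF sqrt_at_top filterlim_real_sequentially])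
    qed
  qed
  show ?thesis
  proof (rule bounded_in_prob_of_mean_bounds[OF setting(1) \<tau>, where c = "8 / information" and S = "\<lambda>n \<omega>. R n \<omega> + R' n \<omega>" and R = R and T = T])
    show "0 < 8 / information" using info by simp
    fix n \<omega> assume \<omega>: "\<omega> \<in> space M" and small: "R n \<omega> + R' n \<omega> < \<tau>"
    have argmin: "est n \<omega> \<in> {a..b}" "criterion \<mu> \<sigma> w (kde n \<omega>) (est n \<omega>) \<le> criterion \<mu> \<sigma> w (kde n \<omega>) \<theta>\<^sub>0"
      using estimator(2)[OF \<omega>, of n] mem unfolding kernel_estimator_eq_kde is_arg_min_def by (auto simp: not_less)
    obtain B where B: "\<And>x. \<bar>kde n \<omega> x - f x\<bar> \<le> B" "\<And>x. \<bar>kde' n \<omega> x - f' x\<bar> \<le> B" using kde_near by blast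
    show "\<bar>est n \<omega> - \<theta>\<^sub>0\<bar> \<le> 8 / information * (\<bar>T n \<omega>\<bar> + 3 * R n \<omega>)"
      unfolding T_def R_def
      by (rule rate_bound[OF kde_has_derivative kde'_continuous B argmin]) (use small in \<open>simp add: R_def R'_def\<close>)
  next
    show "integrable M (\<lambda>\<omega>. R n \<omega> + R' n \<omega>)" for n using R(1) R'(1) by simp
    show "0 \<le> R n \<omega> + R' n \<omega>" for n \<omega> using R0 by simp
    have "(\<lambda>n. (\<integral>\<omega>. R n \<omega> \<partial>M) + (\<integral>\<omega>. R' n \<omega> \<partial>M)) \<longlonglongrightarrow> 0 + 0" by (intro tendsto_add ER0 R'(2))
    then show "(\<lambda>n. \<integral>\<omega>. R n \<omega> + R' n \<omega> \<partial>M) \<longlonglongrightarrow> 0" using R(1) R'(1) by simp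
  qed (use R T R0 in auto)
qed

end
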